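(* Let $H$ be a CQG algebra and let $A\subseteq H$ be a CQG subalgebra (i.e. the inclusion $\iota:A\to H$ is an inclusion of CQG algebras). Then the expectation $p:H\to A$ is positive in the following sense: $p$ extends to a completely positive map $H_u\to A_u$.
   Context: A CQG algebra is a Hopf algebra $H$ over $\mathbb{C}$ which is also a $*$-algebra, such that comultiplication and counit are $*$-homomorphisms, and such that every finite-dimensional comodule is unitarizable (equivalently, $H$ is spanned by matrix coefficients of finite-dimensional unitary comodules). CQG algebras are cosemisimple. An inclusion of CQG algebras is an inclusion of a Hopf subalgebra that is also a $*$-subalgebra. Since $H$ is cosemisimple, it is the direct sum of its simple subcoalgebras, and $A$ is the direct sum of those simple subcoalgebras of $H$ contained in $A$. The expectation $p:H\to A$ is the linear map which is the identity on $A$ and which is zero on every simple subcoalgebra of $H$ not contained in $A$. $H_u$ denotes the universal (enveloping) $C^*$-algebra completion of the $*$-algebra $H$, in which $H$ is regarded as embedded, and $A_u$ is the completion (closure) of $A$ in $H_u$ with respect to the norm inherited from $H_u$. A linear map $T:B_1\to B_2$ of $C^*$-algebras is positive if it sends every element $x^*x$ to an element of the form $y^*y$, and completely positive if $\mathrm{id}\otimes T:M_n\otimes B_1\to M_n\otimes B_2$ is positive for every $n$. *)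

theory Defs
  imports "HOL-Analysis.Analysis" "Jordan_Normal_Form.Matrix"
begin

section \<open>Complex vector spaces, *-algebras and C*-algebras\<close>

class complex_vector = ab_group_add +
  fixes scaleC :: "complex \<Rightarrow> 'a \<Rightarrow> 'a"  (infixr \<open>*\<^sub>C\<close> 75)
  assumes scaleC_add_right: "c *\<^sub>C (x + y) = c *\<^sub>C x + c *\<^sub>C y"
    and scaleC_add_left: "(c + d) *\<^sub>C x = c *\<^sub>C x + d *\<^sub>C x"
    and scaleC_scaleC: "c *\<^sub>C d *\<^sub>C x = (c * d) *\<^sub>C x"
    and scaleC_one: "1 *\<^sub>C x = x"

class complex_algebra_1 = complex_vector + ring_1 +
  assumes mult_scaleC_left: "(c *\<^sub>C x) * y = c *\<^sub>C (x * y)"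
    and mult_scaleC_right: "x * (c *\<^sub>C y) = c *\<^sub>C (x * y)"

class complex_star_algebra = complex_algebra_1 +
  fixes star :: "'a \<Rightarrow> 'a"
  assumes star_star: "star (star x) = x"
    and star_add: "star (x + y) = star x + star y"
    and star_scaleC: "star (c *\<^sub>C x) = cnj c *\<^sub>C star x"
    and star_mult: "star (x * y) = star y * star x"

text \<open>
  Unital and non-zero (\<open>ring_1\<close>), so that \<open>norm 1 = 1\<close>. Enveloping C*-algebras of CQG algebras are
  of this kind, because the counit is a character.
\<close>

class cstar_algebra = complex_star_algebra + real_normed_algebra_1 + banach +
  assumes scaleR_scaleC: "scaleR r x = complex_of_real r *\<^sub>C x"
    and norm_scaleC: "norm (c *\<^sub>C x) = cmod c * norm x"
    and norm_star_mult: "norm (star x * x) = (norm x)\<^sup>2"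

instantiation complex :: cstar_algebra
begin
definition scaleC_complex :: "complex \<Rightarrow> complex \<Rightarrow> complex" where
  "scaleC_complex c x = c * x"
definition star_complex :: "complex \<Rightarrow> complex" where
  "star_complex = cnj"
instance
  by standard
    (simp_all add: scaleC_complex_def star_complex_def algebra_simps scaleR_conv_of_real
      norm_mult power2_eq_square)
end

global_interpretation cvs: vector_space "scaleC :: complex \<Rightarrow> 'a \<Rightarrow> 'a::complex_vector"
  by standard (simp_all add: scaleC_add_right scaleC_add_left scaleC_scaleC scaleC_one)

abbreviation csubspace :: "'a::complex_vector set \<Rightarrow> bool" where
  "csubspace \<equiv> module.subspace scaleC"

abbreviation cspan :: "'a::complex_vector set \<Rightarrow> 'a set" where
  "cspan \<equiv> module.span scaleC"

abbreviation clinear :: "('a::complex_vector \<Rightarrow> 'b::complex_vector) \<Rightarrow> bool" where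
  "clinear \<equiv> Vector_Spaces.linear scaleC scaleC"

definition cbilinear ::
  "('a::complex_vector \<Rightarrow> 'b::complex_vector \<Rightarrow> 'c::complex_vector) \<Rightarrow> bool" where
  "cbilinear B \<longleftrightarrow> (\<forall>y. clinear (\<lambda>x. B x y)) \<and> (\<forall>x. clinear (B x))"

definition star_hom :: "('a::complex_star_algebra \<Rightarrow> 'b::complex_star_algebra) \<Rightarrow> bool" where
  "star_hom f \<longleftrightarrow> clinear f \<and> f 1 = 1 \<and> (\<forall>x y. f (x * y) = f x * f y) \<and>
     (\<forall>x. f (star x) = star (f x))"

lemma clinear_iff:
  "clinear f \<longleftrightarrow> (\<forall>x y. f (x + y) = f x + f y) \<and> (\<forall>c x. f (c *\<^sub>C x) = c *\<^sub>C f x)"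
  unfolding Vector_Spaces.linear_iff by (simp add: cvs.vector_space_axioms)

lemma cbilinear_iff:
  "cbilinear B \<longleftrightarrow>
     (\<forall>x x' y. B (x + x') y = B x y + B x' y) \<and> (\<forall>c x y. B (c *\<^sub>C x) y = c *\<^sub>C B x y) \<and>
     (\<forall>x y y'. B x (y + y') = B x y + B x y') \<and> (\<forall>c x y. B x (c *\<^sub>C y) = c *\<^sub>C B x y)"
  unfolding cbilinear_def clinear_iff by blast

lemma scaleC_0_left [simp]: "0 *\<^sub>C x = 0"
  using scaleC_add_left[of 0 0 x] by simp

lemma scaleC_0_right [simp]: "c *\<^sub>C (0::'a::complex_vector) = 0"
  using scaleC_add_right[of c 0 "0::'a"] by simp

lemma scaleC_minus1: "(-1) *\<^sub>C x = - x"
proof -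
  have "(-1) *\<^sub>C x + x = (-1 + 1) *\<^sub>C x"
    unfolding scaleC_add_left scaleC_one ..
  thus ?thesis by (simp add: eq_neg_iff_add_eq_0)
qed

lemma star_0 [simp]: "star (0::'a::complex_star_algebra) = 0"
  using star_add[of 0 "0::'a"] by simp

lemma star_1: "star (1::'a::complex_star_algebra) = 1"
  by (metis mult.left_neutral mult.right_neutral star_mult star_star)

lemma clinear_functional_separates:
  fixes x :: "'a::complex_vector"
  assumes "x \<noteq> 0"
  shows "\<exists>f :: 'a \<Rightarrow> complex. clinear f \<and> f x = 1"
proof -
  interpret vector_space_pair "scaleC :: complex \<Rightarrow> 'a \<Rightarrow> 'a"
    "scaleC :: complex \<Rightarrow> complex \<Rightarrow> complex" ..
  have "cvs.independent {x}" using assms by simp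
  from linear_independent_extend[OF this, of "\<lambda>_. 1"] show ?thesis by auto
qed


section \<open>The algebraic tensor product\<close>

text \<open>
  The tensor product of \<open>V\<close> and \<open>W\<close> is the linear span, inside the dual of the space of bilinear
  forms on \<open>V \<times> W\<close>, of the evaluations \<open>\<beta> \<mapsto> \<beta> a b\<close>. To make representatives unique, all elements
  are set to zero on functions that are not bilinear.
\<close>

definition tensor_fun ::
  "('a::complex_vector \<times> 'b::complex_vector) list \<Rightarrow> ('a \<Rightarrow> 'b \<Rightarrow> complex) \<Rightarrow> complex" where
  "tensor_fun ps = (\<lambda>\<beta>. if cbilinear \<beta> then \<Sum>(a, b)\<leftarrow>ps. \<beta> a b else 0)"

typedef (overloaded) ('a::complex_vector, 'b::complex_vector) tensor =
  "range (tensor_fun :: ('a \<times> 'b) list \<Rightarrow> _)"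
  by blast

setup_lifting type_definition_tensor

lift_definition tensor ::
  "'a::complex_vector \<Rightarrow> 'b::complex_vector \<Rightarrow> ('a, 'b) tensor"  (infixr \<open>\<otimes>\<^sub>t\<close> 75)
  is "\<lambda>a b. tensor_fun [(a, b)]" by blast

lemma tensor_fun_append:
  "tensor_fun (ps @ qs) = (\<lambda>\<beta>. tensor_fun ps \<beta> + tensor_fun qs \<beta>)"
  by (auto simp: tensor_fun_def)

lemma tensor_fun_scale:
  "tensor_fun (map (\<lambda>(a, b). (c *\<^sub>C a, b)) ps) = (\<lambda>\<beta>. c * tensor_fun ps \<beta>)"
proof
  fix \<beta> :: "'a \<Rightarrow> 'b \<Rightarrow> complex"
  show "tensor_fun (map (\<lambda>(a, b). (c *\<^sub>C a, b)) ps) \<beta> = c * tensor_fun ps \<beta>"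
    by (induction ps)
      (auto simp: tensor_fun_def cbilinear_iff scaleC_complex_def distrib_left)
qed

instantiation tensor :: (complex_vector, complex_vector) complex_vector
begin

lift_definition zero_tensor :: "('a, 'b) tensor" is "\<lambda>_. 0"
proof -
  have "tensor_fun ([] :: ('a \<times> 'b) list) = (\<lambda>_. 0)" by (auto simp: tensor_fun_def)
  thus "(\<lambda>_. 0) \<in> range (tensor_fun :: ('a \<times> 'b) list \<Rightarrow> _)" by (metis rangeI)
qed

lift_definition plus_tensor :: "('a, 'b) tensor \<Rightarrow> ('a, 'b) tensor \<Rightarrow> ('a, 'b) tensor"
  is "\<lambda>s t \<beta>. s \<beta> + t \<beta>"
  by (auto simp flip: tensor_fun_append)

lift_definition scaleC_tensor :: "complex \<Rightarrow> ('a, 'b) tensor \<Rightarrow> ('a, 'b) tensor"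
  is "\<lambda>c t \<beta>. c * t \<beta>"
  by (auto simp flip: tensor_fun_scale)

lift_definition uminus_tensor :: "('a, 'b) tensor \<Rightarrow> ('a, 'b) tensor"
  is "\<lambda>t \<beta>. - t \<beta>"
proof -
  fix t :: "('a \<Rightarrow> 'b \<Rightarrow> complex) \<Rightarrow> complex"
  assume "t \<in> range tensor_fun"
  then obtain ps where "t = tensor_fun ps" by blast
  hence "(\<lambda>\<beta>. - t \<beta>) = tensor_fun (map (\<lambda>(a, b). ((-1) *\<^sub>C a, b)) ps)"
    unfolding tensor_fun_scale by simp
  thus "(\<lambda>\<beta>. - t \<beta>) \<in> range tensor_fun" by blast
qed

definition minus_tensor :: "('a, 'b) tensor \<Rightarrow> ('a, 'b) tensor \<Rightarrow> ('a, 'b) tensor" where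
  "minus_tensor s t = s + (- t)"

instance
proof
  fix s t u :: "('a, 'b) tensor" and c d :: complex
  show "s + t + u = s + (t + u)" by transfer (simp add: add.assoc)
  show "s + t = t + s" by transfer (simp add: add.commute)
  show "0 + t = t" by transfer simp
  show "- t + t = 0" by transfer simp
  show "s - t = s + - t" by (rule minus_tensor_def)
  show "c *\<^sub>C (s + t) = c *\<^sub>C s + c *\<^sub>C t" by transfer (simp add: distrib_left)
  show "(c + d) *\<^sub>C t = c *\<^sub>C t + d *\<^sub>C t" by transfer (simp add: distrib_right)
  show "c *\<^sub>C d *\<^sub>C t = (c * d) *\<^sub>C t" by transfer (simp add: mult.assoc)
  show "1 *\<^sub>C t = t" by transfer simp
qed

end

lemma cbilinear_tensor: "cbilinear (\<otimes>\<^sub>t)"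
  unfolding cbilinear_iff
  by (intro conjI allI; transfer)
    (auto simp: tensor_fun_def cbilinear_iff scaleC_complex_def)

lemma tensor_add_left: "(a + a') \<otimes>\<^sub>t b = a \<otimes>\<^sub>t b + a' \<otimes>\<^sub>t b"
  and tensor_add_right: "a \<otimes>\<^sub>t (b + b') = a \<otimes>\<^sub>t b + a \<otimes>\<^sub>t b'"
  and tensor_scale_left: "(c *\<^sub>C a) \<otimes>\<^sub>t b = c *\<^sub>C (a \<otimes>\<^sub>t b)"
  and tensor_scale_right: "a \<otimes>\<^sub>t (c *\<^sub>C b) = c *\<^sub>C (a \<otimes>\<^sub>t b)"
  using cbilinear_tensor unfolding cbilinear_iff by blast+

lemma Rep_tensor_sum_list: "Rep_tensor (\<Sum>(a, b)\<leftarrow>ps. a \<otimes>\<^sub>t b) = tensor_fun ps"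
proof (induction ps)
  case Nil
  show ?case by (auto simp: zero_tensor.rep_eq tensor_fun_def)
next
  case (Cons p ps)
  obtain a b where p: "p = (a, b)" by force
  show ?case
    using Cons tensor_fun_append[of "[p]" ps]
    by (simp add: p plus_tensor.rep_eq tensor.rep_eq)
qed

lemma tensor_repE:
  obtains ps where "t = (\<Sum>(a, b)\<leftarrow>ps. a \<otimes>\<^sub>t b)"
proof -
  from Rep_tensor[of t] obtain ps where "Rep_tensor t = tensor_fun ps" by blast
  hence "t = (\<Sum>(a, b)\<leftarrow>ps. a \<otimes>\<^sub>t b)"
    by (simp add: Rep_tensor_sum_list flip: Rep_tensor_inject)
  thus ?thesis by (rule that)
qed

lemma tensor_induct [case_names zero add]:
  assumes "P 0" "\<And>a b t. P t \<Longrightarrow> P (a \<otimes>\<^sub>t b + t)"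
  shows "P t"
proof -
  obtain ps where t: "t = (\<Sum>(a, b)\<leftarrow>ps. a \<otimes>\<^sub>t b)" by (rule tensor_repE)
  have "P (\<Sum>(a, b)\<leftarrow>ps. a \<otimes>\<^sub>t b)" by (induction ps) (auto intro: assms)
  thus ?thesis by (simp add: t)
qed

text \<open>
  \<open>tensor_lift B\<close> sends \<open>\<Sum>i. a\<^sub>i \<otimes>\<^sub>t b\<^sub>i\<close> to \<open>\<Sum>i. B a\<^sub>i b\<^sub>i\<close>. This is independent of the chosen
  representation whenever \<open>B\<close> is bilinear, and also when \<open>B\<close> is conjugate-linear in both arguments,
  see \<open>tensor_lift_tensor\<close> and \<open>tensor_lift_add\<close>.
\<close>

definition tensor_lift ::
  "('a::complex_vector \<Rightarrow> 'b::complex_vector \<Rightarrow> 'c::complex_vector) \<Rightarrow> ('a, 'b) tensor \<Rightarrow> 'c" where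
  "tensor_lift B t = (\<Sum>(a, b)\<leftarrow>(SOME ps. t = (\<Sum>(a, b)\<leftarrow>ps. a \<otimes>\<^sub>t b)). B a b)"

definition csemibilinear ::
  "(complex \<Rightarrow> complex) \<Rightarrow>
   ('a::complex_vector \<Rightarrow> 'b::complex_vector \<Rightarrow> 'c::complex_vector) \<Rightarrow> bool" where
  "csemibilinear \<sigma> B \<longleftrightarrow> \<sigma> \<in> {id, cnj} \<and>
     (\<forall>x x' y. B (x + x') y = B x y + B x' y) \<and> (\<forall>c x y. B (c *\<^sub>C x) y = \<sigma> c *\<^sub>C B x y) \<and>
     (\<forall>x y y'. B x (y + y') = B x y + B x y') \<and> (\<forall>c x y. B x (c *\<^sub>C y) = \<sigma> c *\<^sub>C B x y)"

lemma cbilinear_csemibilinear: "cbilinear B \<Longrightarrow> csemibilinear id B"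
  unfolding cbilinear_iff csemibilinear_def by simp

lemma tensor_lift_well_defined:
  fixes B :: "'a::complex_vector \<Rightarrow> 'b::complex_vector \<Rightarrow> 'c::complex_vector"
  assumes B: "csemibilinear \<sigma> B"
    and eq: "(\<Sum>(a, b)\<leftarrow>ps. a \<otimes>\<^sub>t b) = (\<Sum>(a, b)\<leftarrow>qs. a \<otimes>\<^sub>t b)"
  shows "(\<Sum>(a, b)\<leftarrow>ps. B a b) = (\<Sum>(a, b)\<leftarrow>qs. B a b)"
proof (rule ccontr)
  define d where "d = (\<Sum>(a, b)\<leftarrow>ps. B a b) - (\<Sum>(a, b)\<leftarrow>qs. B a b)"
  assume "(\<Sum>(a, b)\<leftarrow>ps. B a b) \<noteq> (\<Sum>(a, b)\<leftarrow>qs. B a b)"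
  hence "d \<noteq> 0" by (simp add: d_def)
  then obtain f :: "'c \<Rightarrow> complex" where f: "clinear f" and fd: "f d = 1"
    using clinear_functional_separates by blast
  have f_add: "f (x + y) = f x + f y" and f_scale: "f (c *\<^sub>C x) = c * f x" for x y c
    using f by (auto simp: clinear_iff scaleC_complex_def)
  have f0: "f 0 = 0" using f_add[of 0 0] by simp
  have \<sigma>: "\<sigma> (x + y) = \<sigma> x + \<sigma> y" "\<sigma> (x * y) = \<sigma> x * \<sigma> y" "\<sigma> (\<sigma> x) = x" "\<sigma> 0 = 0" for x y
    using B by (auto simp: csemibilinear_def)
  have "cbilinear (\<lambda>a b. \<sigma> (f (B a b)))"
    using B unfolding cbilinear_iff csemibilinear_def
    by (simp add: f_add f_scale \<sigma> scaleC_complex_def)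
  moreover have "tensor_fun ps = tensor_fun qs"
    using eq by (metis Rep_tensor_sum_list)
  ultimately have eq': "(\<Sum>(a, b)\<leftarrow>ps. \<sigma> (f (B a b))) = (\<Sum>(a, b)\<leftarrow>qs. \<sigma> (f (B a b)))"
    by (metis (mono_tags, lifting) tensor_fun_def)
  have push: "\<sigma> (f (\<Sum>(a, b)\<leftarrow>rs. B a b)) = (\<Sum>(a, b)\<leftarrow>rs. \<sigma> (f (B a b)))" for rs
    by (induction rs) (auto simp: f_add f0 \<sigma>)
  have "f (\<Sum>(a, b)\<leftarrow>ps. B a b) = f (\<Sum>(a, b)\<leftarrow>qs. B a b)"
    using eq' push \<sigma>(3) by metis
  moreover have "f (\<Sum>(a, b)\<leftarrow>ps. B a b) = f d + f (\<Sum>(a, b)\<leftarrow>qs. B a b)"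
    by (simp add: d_def flip: f_add)
  ultimately show False using fd by simp
qed

lemma tensor_lift_sum_list:
  assumes "csemibilinear \<sigma> B"
  shows "tensor_lift B (\<Sum>(a, b)\<leftarrow>ps. a \<otimes>\<^sub>t b) = (\<Sum>(a, b)\<leftarrow>ps. B a b)"
  unfolding tensor_lift_def
  by (rule tensor_lift_well_defined[OF assms, symmetric], rule someI_ex) blast

lemma tensor_lift_tensor: "csemibilinear \<sigma> B \<Longrightarrow> tensor_lift B (a \<otimes>\<^sub>t b) = B a b"
  using tensor_lift_sum_list[of \<sigma> B "[(a, b)]"] by simp

lemma tensor_lift_0: "csemibilinear \<sigma> B \<Longrightarrow> tensor_lift B 0 = 0"
  using tensor_lift_sum_list[of \<sigma> B "[]"] by simp

lemma tensor_lift_add: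
  assumes "csemibilinear \<sigma> B"
  shows "tensor_lift B (s + t) = tensor_lift B s + tensor_lift B t"
proof -
  obtain ps where ps: "s = (\<Sum>(a, b)\<leftarrow>ps. a \<otimes>\<^sub>t b)" by (rule tensor_repE)
  obtain qs where qs: "t = (\<Sum>(a, b)\<leftarrow>qs. a \<otimes>\<^sub>t b)" by (rule tensor_repE)
  show ?thesis
    using tensor_lift_sum_list[OF assms, of "ps @ qs"]
    by (simp add: ps qs tensor_lift_sum_list[OF assms])
qed

lemma tensor_lift_scale:
  assumes "csemibilinear \<sigma> B"
  shows "tensor_lift B (c *\<^sub>C t) = \<sigma> c *\<^sub>C tensor_lift B t"
proof (induction t rule: tensor_induct)
  case zero
  show ?case by (simp add: tensor_lift_0[OF assms])
next
  case (add a b t)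
  have "tensor_lift B (c *\<^sub>C (a \<otimes>\<^sub>t b)) = \<sigma> c *\<^sub>C B a b"
    using assms by (simp add: tensor_lift_tensor[OF assms] csemibilinear_def flip: tensor_scale_left)
  thus ?case
    using add by (simp add: scaleC_add_right tensor_lift_add[OF assms] tensor_lift_tensor[OF assms])
qed

lemma clinear_tensor_lift: "cbilinear B \<Longrightarrow> clinear (tensor_lift B)"
  unfolding clinear_iff
  using tensor_lift_add tensor_lift_scale cbilinear_csemibilinear by fastforce

definition tensor_map ::
  "('a::complex_vector \<Rightarrow> 'c::complex_vector) \<Rightarrow> ('b::complex_vector \<Rightarrow> 'd::complex_vector) \<Rightarrow>
   ('a, 'b) tensor \<Rightarrow> ('c, 'd) tensor" where
  "tensor_map f g = tensor_lift (\<lambda>a b. f a \<otimes>\<^sub>t g b)"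

definition tensor_assoc ::
  "(('a::complex_vector, 'b::complex_vector) tensor, 'c::complex_vector) tensor \<Rightarrow>
   ('a, ('b, 'c) tensor) tensor" where
  "tensor_assoc = tensor_lift (\<lambda>t c. tensor_lift (\<lambda>a b. a \<otimes>\<^sub>t (b \<otimes>\<^sub>t c)) t)"

lemma tensor_map_tensor: "clinear f \<Longrightarrow> clinear g \<Longrightarrow> tensor_map f g (a \<otimes>\<^sub>t b) = f a \<otimes>\<^sub>t g b"
  unfolding tensor_map_def
  by (rule tensor_lift_tensor, rule cbilinear_csemibilinear)
    (simp add: cbilinear_iff clinear_iff
      tensor_add_left tensor_add_right tensor_scale_left tensor_scale_right)

lemma tensor_assoc_tensor:
  "\<And>(a::'a::complex_vector) (b::'b::complex_vector) (c::'c::complex_vector).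
     tensor_assoc ((a \<otimes>\<^sub>t b) \<otimes>\<^sub>t c) = a \<otimes>\<^sub>t (b \<otimes>\<^sub>t c)"
  and clinear_tensor_assoc:
  "clinear (tensor_assoc :: (('a, 'b) tensor, 'c) tensor \<Rightarrow> ('a, ('b, 'c) tensor) tensor)"
proof -
  define G where "G c = (\<lambda>(a::'a) (b::'b). a \<otimes>\<^sub>t (b \<otimes>\<^sub>t c))" for c :: 'c
  have G: "G c a b = a \<otimes>\<^sub>t (b \<otimes>\<^sub>t c)" for a b c by (simp add: G_def)
  have "cbilinear (G c)" for c
    by (simp add: cbilinear_iff G
        tensor_add_left tensor_add_right tensor_scale_left tensor_scale_right)
  note inner = cbilinear_csemibilinear[OF this]
  have eq: "tensor_lift (G (c + c')) t = tensor_lift (G c) t + tensor_lift (G c') t"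
    "tensor_lift (G (z *\<^sub>C c)) t = z *\<^sub>C tensor_lift (G c) t" for c c' t z
    by (induction t rule: tensor_induct)
      (simp_all add: tensor_lift_0[OF inner] tensor_lift_add[OF inner] tensor_lift_tensor[OF inner]
        G tensor_add_right tensor_scale_right scaleC_add_right)
  have B: "cbilinear (\<lambda>t c. tensor_lift (G c) t)"
    by (simp add: cbilinear_iff eq tensor_lift_add[OF inner] tensor_lift_scale[OF inner])
  have assoc: "(tensor_assoc :: (('a, 'b) tensor, 'c) tensor \<Rightarrow> _) =
      tensor_lift (\<lambda>t c. tensor_lift (G c) t)"
    by (simp add: tensor_assoc_def G_def)
  show "clinear (tensor_assoc :: (('a, 'b) tensor, 'c) tensor \<Rightarrow> _)"
    unfolding assoc by (rule clinear_tensor_lift[OF B])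
  show "tensor_assoc ((a \<otimes>\<^sub>t b) \<otimes>\<^sub>t c) = a \<otimes>\<^sub>t (b \<otimes>\<^sub>t c)" for a :: 'a and b :: 'b and c :: 'c
    by (simp add: assoc tensor_lift_tensor[OF cbilinear_csemibilinear[OF B]]
        tensor_lift_tensor[OF inner] G)
qed

definition tensor_subspace ::
  "'a::complex_vector set \<Rightarrow> 'b::complex_vector set \<Rightarrow> ('a, 'b) tensor set" where
  "tensor_subspace V W = cspan {v \<otimes>\<^sub>t w | v w. v \<in> V \<and> w \<in> W}"

instantiation tensor :: (complex_star_algebra, complex_star_algebra) complex_star_algebra
begin

definition one_tensor :: "('a, 'b) tensor" where
  "one_tensor = 1 \<otimes>\<^sub>t 1"

definition times_tensor :: "('a, 'b) tensor \<Rightarrow> ('a, 'b) tensor \<Rightarrow> ('a, 'b) tensor" where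
  "times_tensor s t = tensor_lift (\<lambda>a b. tensor_lift (\<lambda>c d. (a * c) \<otimes>\<^sub>t (b * d)) t) s"

definition star_tensor :: "('a, 'b) tensor \<Rightarrow> ('a, 'b) tensor" where
  "star_tensor = tensor_lift (\<lambda>a b. star a \<otimes>\<^sub>t star b)"

lemma times_tensor_aux1:
  "csemibilinear id (\<lambda>c d. ((a::'a) * c) \<otimes>\<^sub>t ((b::'b) * d))"
  by (rule cbilinear_csemibilinear)
    (simp add: cbilinear_iff distrib_left mult_scaleC_right
      tensor_add_left tensor_add_right tensor_scale_left tensor_scale_right)

lemma times_tensor_aux2:
  "csemibilinear id (\<lambda>(a::'a) (b::'b). tensor_lift (\<lambda>c d. (a * c) \<otimes>\<^sub>t (b * d)) t)"
proof (rule cbilinear_csemibilinear, induction t rule: tensor_induct)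
  case zero
  show ?case by (simp add: cbilinear_iff tensor_lift_0[OF times_tensor_aux1])
next
  case (add x y t)
  thus ?case
    by (simp add: cbilinear_iff tensor_lift_add[OF times_tensor_aux1]
        tensor_lift_tensor[OF times_tensor_aux1] distrib_right mult_scaleC_left
        tensor_add_left tensor_add_right tensor_scale_left tensor_scale_right scaleC_add_right)
qed

lemma star_tensor_aux: "csemibilinear cnj (\<lambda>(a::'a) (b::'b). star a \<otimes>\<^sub>t star b)"
  by (auto simp: csemibilinear_def star_add star_scaleC
      tensor_add_left tensor_add_right tensor_scale_left tensor_scale_right)

lemma times_tensor_pure:
  "((a::'a) \<otimes>\<^sub>t (b::'b)) * (c \<otimes>\<^sub>t d) = (a * c) \<otimes>\<^sub>t (b * d)"
  unfolding times_tensor_def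
  by (subst tensor_lift_tensor[OF times_tensor_aux2]) (rule tensor_lift_tensor[OF times_tensor_aux1])

lemma star_tensor_pure: "star ((a::'a) \<otimes>\<^sub>t (b::'b)) = star a \<otimes>\<^sub>t star b"
  by (simp add: star_tensor_def tensor_lift_tensor[OF star_tensor_aux])

lemma times_tensor_0_left: "0 * (t :: ('a, 'b) tensor) = 0"
  by (simp add: times_tensor_def tensor_lift_0[OF times_tensor_aux2])

lemma times_tensor_add_left: "(s + s') * t = s * t + s' * (t :: ('a, 'b) tensor)"
  by (simp add: times_tensor_def tensor_lift_add[OF times_tensor_aux2])

lemma times_tensor_scale_left: "(c *\<^sub>C s) * t = c *\<^sub>C (s * (t :: ('a, 'b) tensor))"
  by (simp add: times_tensor_def tensor_lift_scale[OF times_tensor_aux2])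

lemma times_tensor_pure_left:
  "((a::'a) \<otimes>\<^sub>t (b::'b)) * t = tensor_lift (\<lambda>c d. (a * c) \<otimes>\<^sub>t (b * d)) t"
  by (simp add: times_tensor_def tensor_lift_tensor[OF times_tensor_aux2])

lemma times_tensor_0_right: "(t :: ('a, 'b) tensor) * 0 = 0"
  by (induction t rule: tensor_induct)
    (simp_all add: times_tensor_0_left times_tensor_add_left times_tensor_pure_left
      tensor_lift_0[OF times_tensor_aux1])

lemma times_tensor_add_right: "(t :: ('a, 'b) tensor) * (s + s') = t * s + t * s'"
  by (induction t rule: tensor_induct)
    (simp_all add: times_tensor_0_left times_tensor_add_left times_tensor_pure_left
      tensor_lift_add[OF times_tensor_aux1] algebra_simps)

lemma times_tensor_scale_right: "(t :: ('a, 'b) tensor) * (c *\<^sub>C s) = c *\<^sub>C (t * s)"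
  by (induction t rule: tensor_induct)
    (simp_all add: times_tensor_0_left times_tensor_add_left times_tensor_pure_left
      tensor_lift_scale[OF times_tensor_aux1] scaleC_add_right)

lemmas times_tensor_simps =
  times_tensor_0_left times_tensor_0_right times_tensor_add_left times_tensor_add_right
  times_tensor_pure

lemma star_tensor_add: "star (s + t) = star s + star (t :: ('a, 'b) tensor)"
  by (simp add: star_tensor_def tensor_lift_add[OF star_tensor_aux])

lemma star_tensor_0: "star (0 :: ('a, 'b) tensor) = 0"
  by (simp add: star_tensor_def tensor_lift_0[OF star_tensor_aux])

instance
proof
  fix s t u :: "('a, 'b) tensor" and c :: complex
  have pp: "(a \<otimes>\<^sub>t b) * (a' \<otimes>\<^sub>t b') * u = (a \<otimes>\<^sub>t b) * ((a' \<otimes>\<^sub>t b') * u)"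
    for a a' :: 'a and b b' :: 'b
    by (induction u rule: tensor_induct) (simp_all add: times_tensor_simps mult.assoc)
  have p: "(a \<otimes>\<^sub>t b) * t * u = (a \<otimes>\<^sub>t b) * (t * u)" for a :: 'a and b :: 'b
    by (induction t rule: tensor_induct) (simp_all add: times_tensor_simps flip: pp)
  show "s * t * u = s * (t * u)"
    by (induction s rule: tensor_induct) (simp_all add: times_tensor_simps p)
  show "1 * t = t"
    by (induction t rule: tensor_induct) (simp_all add: times_tensor_simps one_tensor_def)
  show "t * 1 = t"
    by (induction t rule: tensor_induct) (simp_all add: times_tensor_simps one_tensor_def)
  show "(s + t) * u = s * u + t * u" by (rule times_tensor_add_left)
  show "s * (t + u) = s * t + s * u" by (rule times_tensor_add_right)
  show "(c *\<^sub>C s) * t = c *\<^sub>C (s * t)" by (rule times_tensor_scale_left)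
  show "s * (c *\<^sub>C t) = c *\<^sub>C (s * t)" by (rule times_tensor_scale_right)
  show "(0::('a, 'b) tensor) \<noteq> 1"
  proof -
    obtain f :: "'a \<Rightarrow> complex" where f: "clinear f" "f 1 = 1"
      using clinear_functional_separates[of "1::'a"] by auto
    obtain g :: "'b \<Rightarrow> complex" where g: "clinear g" "g 1 = 1"
      using clinear_functional_separates[of "1::'b"] by auto
    have "cbilinear (\<lambda>a b. f a * g b)"
      using f g by (simp add: cbilinear_iff clinear_iff scaleC_complex_def algebra_simps)
    hence B: "csemibilinear id (\<lambda>a b. f a * g b)" by (rule cbilinear_csemibilinear)
    have "tensor_lift (\<lambda>a b. f a * g b) 1 = 1"
      using f g by (simp add: one_tensor_def tensor_lift_tensor[OF B])
    thus ?thesis using tensor_lift_0[OF B] by fastforce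
  qed
  show "star (star t) = t"
    by (induction t rule: tensor_induct)
      (simp_all add: star_tensor_0 star_tensor_add star_tensor_pure star_star)
  show "star (s + t) = star s + star t" by (rule star_tensor_add)
  show "star (c *\<^sub>C t) = cnj c *\<^sub>C star t"
    by (simp add: star_tensor_def tensor_lift_scale[OF star_tensor_aux])
  have q: "star ((a \<otimes>\<^sub>t b) * t) = star t * star (a \<otimes>\<^sub>t b)" for a :: 'a and b :: 'b
    by (induction t rule: tensor_induct)
      (simp_all add: times_tensor_simps star_tensor_0 star_tensor_add star_tensor_pure star_mult)
  show "star (s * t) = star t * star s"
    by (induction s rule: tensor_induct)
      (simp_all add: times_tensor_simps star_tensor_0 star_tensor_add q)
qed

end


section \<open>CQG algebras\<close>

locale coalgebra =
  fixes \<Delta> :: "'a::complex_vector \<Rightarrow> ('a, 'a) tensor"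
    and \<epsilon> :: "'a \<Rightarrow> complex"
  assumes clinear_comult: "clinear \<Delta>"
    and clinear_counit: "clinear \<epsilon>"
    and coassoc: "tensor_assoc (tensor_map \<Delta> id (\<Delta> x)) = tensor_map id \<Delta> (\<Delta> x)"
    and counit_left: "tensor_lift (\<lambda>a b. \<epsilon> a *\<^sub>C b) (\<Delta> x) = x"
    and counit_right: "tensor_lift (\<lambda>a b. \<epsilon> b *\<^sub>C a) (\<Delta> x) = x"

locale hopf_star_algebra = coalgebra \<Delta> \<epsilon>
  for \<Delta> :: "'a::complex_star_algebra \<Rightarrow> ('a, 'a) tensor"
    and \<epsilon> :: "'a \<Rightarrow> complex" +
  fixes S :: "'a \<Rightarrow> 'a"
  assumes star_hom_comult: "star_hom \<Delta>"
    and star_hom_counit: "star_hom \<epsilon>"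
    and clinear_antipode: "clinear S"
    and antipode_left: "tensor_lift (\<lambda>a b. S a * b) (\<Delta> x) = \<epsilon> x *\<^sub>C 1"
    and antipode_right: "tensor_lift (\<lambda>a b. a * S b) (\<Delta> x) = \<epsilon> x *\<^sub>C 1"

definition mat_star :: "'a::complex_star_algebra mat \<Rightarrow> 'a mat" where
  "mat_star X = map_mat star (transpose_mat X)"

text \<open>
  The matrix \<open>u\<close> encodes the right comodule \<open>\<complex>\<^sup>n\<close> with coaction \<open>e\<^sub>j \<mapsto> \<Sum>i. e\<^sub>i \<otimes>\<^sub>t u\<^sub>i\<^sub>j\<close>; every
  \<open>n\<close>-dimensional comodule is of this form in a basis. It is unitary for the inner product that
  makes the basis orthonormal iff \<open>u\<close> is a unitary element of \<open>M\<^sub>n(H)\<close>. The entries of \<open>u\<close> are its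
  matrix coefficients.
\<close>

definition comodule_mat ::
  "('a::complex_star_algebra \<Rightarrow> ('a, 'a) tensor) \<Rightarrow> ('a \<Rightarrow> complex) \<Rightarrow> nat \<Rightarrow> 'a mat \<Rightarrow> bool" where
  "comodule_mat \<Delta> \<epsilon> n u \<longleftrightarrow> u \<in> carrier_mat n n \<and>
     (\<forall>i<n. \<forall>j<n. \<Delta> (u $$ (i, j)) = (\<Sum>k<n. u $$ (i, k) \<otimes>\<^sub>t u $$ (k, j)) \<and>
                  \<epsilon> (u $$ (i, j)) = (if i = j then 1 else 0))"

definition unitary_comodule_mat ::
  "('a::complex_star_algebra \<Rightarrow> ('a, 'a) tensor) \<Rightarrow> ('a \<Rightarrow> complex) \<Rightarrow> nat \<Rightarrow> 'a mat \<Rightarrow> bool" where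
  "unitary_comodule_mat \<Delta> \<epsilon> n u \<longleftrightarrow> comodule_mat \<Delta> \<epsilon> n u \<and>
     mat_star u * u = 1\<^sub>m n \<and> u * mat_star u = 1\<^sub>m n"

locale cqg_algebra = hopf_star_algebra +
  assumes span_unitary_coefficients:
    "cspan (\<Union> {elements_mat u | n u. unitary_comodule_mat \<Delta> \<epsilon> n u}) = UNIV"

definition subcoalgebra ::
  "('a::complex_vector \<Rightarrow> ('a, 'a) tensor) \<Rightarrow> 'a set \<Rightarrow> bool" where
  "subcoalgebra \<Delta> C \<longleftrightarrow> csubspace C \<and> \<Delta> ` C \<subseteq> tensor_subspace C C"

definition simple_subcoalgebra ::
  "('a::complex_vector \<Rightarrow> ('a, 'a) tensor) \<Rightarrow> 'a set \<Rightarrow> bool" where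
  "simple_subcoalgebra \<Delta> C \<longleftrightarrow> subcoalgebra \<Delta> C \<and> C \<noteq> {0} \<and>
     (\<forall>D. subcoalgebra \<Delta> D \<and> D \<subseteq> C \<longrightarrow> D = {0} \<or> D = C)"

definition cqg_subalgebra ::
  "('a::complex_star_algebra \<Rightarrow> ('a, 'a) tensor) \<Rightarrow> ('a \<Rightarrow> 'a) \<Rightarrow> 'a set \<Rightarrow> bool" where
  "cqg_subalgebra \<Delta> S A \<longleftrightarrow> subcoalgebra \<Delta> A \<and> 1 \<in> A \<and> (\<forall>x\<in>A. \<forall>y\<in>A. x * y \<in> A) \<and>
     S ` A \<subseteq> A \<and> star ` A \<subseteq> A"

text \<open>
  In a cosemisimple \<open>H\<close> these conditions determine \<open>p\<close> uniquely, since \<open>H\<close> is the direct sum of its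
  simple subcoalgebras.
\<close>

definition is_expectation ::
  "('a::complex_vector \<Rightarrow> ('a, 'a) tensor) \<Rightarrow> 'a set \<Rightarrow> ('a \<Rightarrow> 'a) \<Rightarrow> bool" where
  "is_expectation \<Delta> A p \<longleftrightarrow> clinear p \<and> range p \<subseteq> A \<and> (\<forall>a\<in>A. p a = a) \<and>
     (\<forall>C. simple_subcoalgebra \<Delta> C \<and> \<not> C \<subseteq> A \<longrightarrow> (\<forall>x\<in>C. p x = 0))"


section \<open>The enveloping C*-algebra and complete positivity\<close>

definition cstar_seminorm :: "('a::complex_star_algebra \<Rightarrow> real) \<Rightarrow> bool" where
  "cstar_seminorm q \<longleftrightarrow>
     (\<forall>x y. q (x + y) \<le> q x + q y) \<and> (\<forall>c x. q (c *\<^sub>C x) = cmod c * q x) \<and>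
     (\<forall>x y. q (x * y) \<le> q x * q y) \<and> (\<forall>x. q (star x * x) = (q x)\<^sup>2)"

text \<open>
  \<open>j\<close> exhibits \<open>'b\<close> as the completion of \<open>'a\<close> in the greatest C*-seminorm, which is
  \<open>x \<mapsto> norm (j x)\<close>: the C*-seminorms on \<open>'a\<close> are exactly the functions \<open>x \<mapsto> norm (\<pi> x)\<close>
  for *-representations \<open>\<pi>\<close>. This determines \<open>('b, j)\<close> up to isomorphism.
\<close>

definition is_enveloping_cstar_algebra ::
  "('a::complex_star_algebra \<Rightarrow> 'b::cstar_algebra) \<Rightarrow> bool" where
  "is_enveloping_cstar_algebra j \<longleftrightarrow> star_hom j \<and> closure (range j) = UNIV \<and>
     (\<forall>q. cstar_seminorm q \<longrightarrow> (\<forall>x. q x \<le> norm (j x)))"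

text \<open>
  The elements of \<open>M\<^sub>n \<otimes> B\<close> of the form \<open>x\<^sup>* x\<close>, for a C*-subalgebra \<open>B\<close>; this is \<open>M\<^sub>n(B)\<close>
  with \<open>id \<otimes> T\<close> acting entrywise.
\<close>

definition positive_mats :: "nat \<Rightarrow> 'b::cstar_algebra set \<Rightarrow> 'b mat set" where
  "positive_mats n B = {mat_star X * X | X. X \<in> carrier_mat n n \<and> elements_mat X \<subseteq> B}"

definition completely_positive ::
  "'b::cstar_algebra set \<Rightarrow> 'c::cstar_algebra set \<Rightarrow> ('b \<Rightarrow> 'c) \<Rightarrow> bool" where
  "completely_positive B\<^sub>1 B\<^sub>2 T \<longleftrightarrow> T ` B\<^sub>1 \<subseteq> B\<^sub>2 \<and>
     (\<forall>n. map_mat T ` positive_mats n B\<^sub>1 \<subseteq> positive_mats n B\<^sub>2)"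

end

theory Submission
  imports Defs
begin

text \<open>
  With \<open>phi = \<epsilon> \<circ> p\<close> one has \<open>p = (id \<otimes> phi) \<circ> \<Delta>\<close>, so everything rests on positivity of \<open>phi\<close>.
  Every element of \<open>H\<close> is a matrix coefficient \<open>y = a\<^sup>T u b\<close> of a unitary comodule \<open>u\<close>, and
  \<open>phi (y\<^sup>* y)\<close> is a diagonal value of \<open>E(m) = (id \<otimes> phi)(u\<^sup>* (m \<otimes> 1) u)\<close> at a rank one positive
  matrix \<open>m\<close>. Here \<open>E\<close> is a bimodule projection of a full matrix algebra onto the *-subalgebra of
  those \<open>m\<close> for which \<open>u\<^sup>* (m \<otimes> 1) u\<close> has entries in \<open>A\<close>. It preserves the faithful positive functional
  given by an invariant inner product on the conjugate comodule, which forces \<open>E\<close> to be positive.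

  Consequently \<open>(x, y) \<mapsto> p (x\<^sup>* y)\<close> makes \<open>H\<close> a pre-Hilbert module over \<open>A\<close>. The operator norm of left
  multiplication on it is a C*-seminorm, hence dominated by the universal one, and therefore \<open>p\<close> is
  contractive and extends to the completion. Matrix positivity survives the limit because the
  positive cone of a C*-algebra is closed, and square roots of positive matrices over a C*-subalgebra
  have their entries in that subalgebra.
\<close>

section \<open>Positive elements of a C*-algebra\<close>

text \<open>On \<open>A\<close> the functional \<open>phi\<close> is the counit, a character, and it
  vanishes on the complement \<open>A'\<close>. This alone does not make it positive: for
  \<open>b\<close> in \<open>A'\<close> the product \<open>star b * b\<close> can have a component
  in \<open>A\<close>, whose counit is not visibly nonnegative. The sign is found only after moving
  to a finite-dimensional matrix algebra, where \<open>E\<close> has a multiplicative structure.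
  That \<open>E\<close> is a bimodule map rests on \<open>p\<close> being one over \<open>A\<close>,
  and the proof of this uses that \<open>A\<close> is stable under the antipode.

  No Haar state is involved. Orthogonality comes from the matrices \<open>(f (u i j))\<close> of
  functionals: their Hilbert-Schmidt product is definite, and slices have adjoints for it because
  the antipode of a unitary comodule is given by the involution. Complements of subcoalgebras and
  the invariant form of the conjugate comodule are both obtained from it.

  Positivity in C*-algebras is handled by norms and the binomial series of the square root, without
  spectra. The same theory serves complex matrices in the argument about \<open>E\<close> and
  matrices over the completion at the end.\<close>

lemma star_minus: "star (- x) = - star (x::'a::complex_star_algebra)"
  using star_add[of x "- x"] by (simp add: minus_unique)

lemma star_diff: "star (x - y) = star x - star (y::'a::complex_star_algebra)"
  using star_add[of x "- y"] by (simp add: star_minus)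

lemma star_sum: "star (sum f I) = (\<Sum>i\<in>I. star (f i :: 'a::complex_star_algebra))"
  by (induction I rule: infinite_finite_induct) (simp_all add: star_add)

lemma star_power: "star (x ^ k) = star (x::'a::complex_star_algebra) ^ k"
  by (induction k) (simp_all add: star_1 star_mult power_commutes)

lemma star_scaleR: "star (r *\<^sub>R x) = r *\<^sub>R star (x::'a::cstar_algebra)"
  by (simp add: scaleR_scaleC star_scaleC)

lemma norm_star: "norm (star x) = norm (x::'a::cstar_algebra)"
proof -
  have *: "norm y \<le> norm (star y)" for y :: 'a
  proof (cases "y = 0")
    case False
    have "(norm y)\<^sup>2 \<le> norm (star y) * norm y"
      by (metis norm_star_mult norm_mult_ineq)
    with False show ?thesis by (simp add: power2_eq_square)
  qed simp
  show ?thesis using *[of x] *[of "star x"] by (simp add: star_star)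
qed

lemma bounded_linear_star: "bounded_linear (star :: 'a::cstar_algebra \<Rightarrow> 'a)"
  by (rule bounded_linear_intro[of _ 1]) (simp_all add: star_add star_scaleR norm_star)

lemma norm_hermitian_square:
  "star (x::'a::cstar_algebra) = x \<Longrightarrow> norm (x * x) = (norm x)\<^sup>2"
  using norm_star_mult[of x] by simp

lemma star_mult_self_eq_0: "star (x::'a::cstar_algebra) * x = 0 \<Longrightarrow> x = 0"
  using norm_star_mult[of x] by simp

section \<open>The binomial series of \<open>sqrt (1 - x)\<close> on the closed unit ball\<close>

definition sqrt_coeff :: "nat \<Rightarrow> real" where
  "sqrt_coeff k = (1/2 gchoose k) * (-1) ^ k"

lemma sqrt_coeff_0 [simp]: "sqrt_coeff 0 = 1"
  by (simp add: sqrt_coeff_def)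

text \<open>These are the Taylor coefficients of \<open>1 / sqrt (1 - x)\<close>, which upper
  negation makes visibly nonnegative. They determine the sign of \<open>sqrt_coeff (Suc k)\<close>
  and also the partial sums of \<open>sqrt_coeff\<close>.\<close>

lemma neg_half_gbinomial: "(-1) ^ m * ((-1/2::real) gchoose m) \<ge> 0"
proof -
  have "(-1) ^ m * ((-1/2::real) gchoose m) = (1/2 + of_nat m - 1) gchoose m"
    using gbinomial_negated_upper[of "-1/2::real" m] by (simp add: algebra_simps)
  also have "\<dots> = pochhammer (1/2) m / fact m"
    by (simp add: gbinomial_pochhammer')
  also have "\<dots> \<ge> 0"
    by (intro divide_nonneg_pos) (simp_all add: pochhammer_nonneg)
  finally show ?thesis .
qed

lemma sqrt_coeff_Suc: "sqrt_coeff (Suc k) \<le> 0"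
proof -
  have "sqrt_coeff (Suc k) =
      - (1 / (2 * Suc k)) * ((-1) ^ k * ((-1/2::real) gchoose k))"
    using gbinomial_absorption[of k "1/2::real"] 
    by (simp add: sqrt_coeff_def field_simps)
  also have "\<dots> \<le> 0"
    using neg_half_gbinomial[of k] by (intro mult_nonpos_nonneg) auto
  finally show ?thesis .
qed

text \<open>All coefficients after the first have the same sign, so the absolute sum is 1 minus a
  partial sum of \<open>sqrt_coeff\<close>, and that partial sum is nonnegative. Hence the series
  converges absolutely even at \<open>norm b = 1\<close>; the exact bound 1 returns in
  \<open>norm_sqrt_series\<close>.\<close>

lemma sum_abs_sqrt_coeff: "(\<Sum>k<n. \<bar>sqrt_coeff (Suc k)\<bar>) \<le> 1"
proof -
  have "(\<Sum>k<n. \<bar>sqrt_coeff (Suc k)\<bar>) = 1 - (\<Sum>k\<le>n. sqrt_coeff k)"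
    by (simp add: sum.atMost_shift sqrt_coeff_Suc abs_of_nonpos sum_negf)
  also have "(\<Sum>k\<le>n. sqrt_coeff k) = (-1) ^ n * ((-1/2::real) gchoose n)"
    unfolding sqrt_coeff_def by (subst gbinomial_sum_lower_neg) simp
  finally show ?thesis using neg_half_gbinomial[of n] by simp
qed

lemma summable_sqrt_coeff: "summable (\<lambda>k. \<bar>sqrt_coeff k\<bar>)"
proof -
  have "summable (\<lambda>k. \<bar>sqrt_coeff (Suc k)\<bar>)"
    by (rule bounded_imp_summable[of _ 1])
      (use sum_abs_sqrt_coeff[of "Suc _"] in \<open>auto simp: lessThan_Suc_atMost\<close>)
  thus ?thesis by (subst (asm) summable_Suc_iff)
qed

text \<open>The coefficients of the square of \<open>sqrt (1 - x)\<close>; Vandermonde's convolution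
  reduces them to the binomials of 1.\<close>

lemma sqrt_coeff_convolution:
  "(\<Sum>i\<le>n. sqrt_coeff i * sqrt_coeff (n - i)) = (if n = 0 then 1 else if n = 1 then -1 else 0)"
proof -
  have "(\<Sum>i\<le>n. sqrt_coeff i * sqrt_coeff (n - i)) =
      (\<Sum>i\<le>n. ((1/2::real) gchoose i) * ((1/2) gchoose (n - i)) * (-1) ^ n)"
    by (rule sum.cong) (auto simp: sqrt_coeff_def mult_ac simp flip: power_add)
  also have "\<dots> = ((1::real) gchoose n) * (-1) ^ n"
    using gbinomial_Vandermonde[of "1/2::real" "1/2" n]
    by (simp add: atLeast0AtMost flip: sum_distrib_right)
  also have "(1::real) gchoose n = of_nat (1 choose n)"
    by (metis binomial_gbinomial of_nat_1)
  also have "\<dots> * (-1) ^ n = (if n = 0 then 1 else if n = 1 then -1 else 0)"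
    by (cases n) (auto simp: binomial_eq_0)
  finally show ?thesis .
qed

definition sqrt_series :: "'a::cstar_algebra \<Rightarrow> 'a" where
  "sqrt_series b = (\<Sum>k. sqrt_coeff k *\<^sub>R b ^ k)"

context
  fixes b :: "'a::cstar_algebra"
  assumes norm_b: "norm b \<le> 1"
begin

lemma norm_sqrt_series_term: "norm (sqrt_coeff k *\<^sub>R b ^ k) \<le> \<bar>sqrt_coeff k\<bar>"
proof -
  have "norm (b ^ k) \<le> 1"
    using norm_power_ineq[of b k] power_le_one[of "norm b" k] norm_b by simp
  thus ?thesis by (simp add: mult_left_le)
qed

lemma summable_norm_sqrt_series: "summable (\<lambda>k. norm (sqrt_coeff k *\<^sub>R b ^ k))"
  by (rule summable_comparison_test'[OF summable_sqrt_coeff, of 0])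
    (use norm_sqrt_series_term in auto)

lemma sqrt_series_sums: "(\<lambda>k. sqrt_coeff k *\<^sub>R b ^ k) sums sqrt_series b"
  unfolding sqrt_series_def
  by (rule summable_sums[OF summable_norm_cancel[OF summable_norm_sqrt_series]])

lemma sqrt_series_square: "sqrt_series b * sqrt_series b = 1 - b"
proof -
  have "(\<lambda>n. \<Sum>i\<le>n. (sqrt_coeff i *\<^sub>R b ^ i) * (sqrt_coeff (n - i) *\<^sub>R b ^ (n - i))) sums
      (sqrt_series b * sqrt_series b)"
    unfolding sqrt_series_def
    by (rule Cauchy_product_sums[OF summable_norm_sqrt_series summable_norm_sqrt_series])
  moreover have "(\<Sum>i\<le>n. (sqrt_coeff i *\<^sub>R b ^ i) * (sqrt_coeff (n - i) *\<^sub>R b ^ (n - i))) =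
      (if n = 0 then 1 else if n = 1 then -1 else 0::real) *\<^sub>R b ^ n" for n
    unfolding sqrt_coeff_convolution[symmetric] scaleR_left.sum
    by (rule sum.cong) (auto simp flip: power_add)
  ultimately have "(\<lambda>n. (if n = 0 then 1 else if n = 1 then -1 else 0::real) *\<^sub>R b ^ n) sums
      (sqrt_series b * sqrt_series b)" by simp
  moreover have "(\<lambda>n. (if n = 0 then 1 else if n = 1 then -1 else 0::real) *\<^sub>R b ^ n) sums
      (\<Sum>n\<in>{0,1}. (if n = 0 then 1 else if n = 1 then -1 else 0::real) *\<^sub>R b ^ n)"
    by (rule sums_finite) auto
  ultimately show ?thesis using sums_unique2 by fastforce
qed

text \<open>The coefficients after the constant one have absolute sum at most 1. This keeps the root
  in the unit ball around 1, which is what makes it positive in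
  \<open>positive_sqrt\<close>.\<close>

lemma norm_sqrt_series: "norm (1 - sqrt_series b) \<le> 1"
proof -
  have "(\<lambda>k. sqrt_coeff (Suc k) *\<^sub>R b ^ Suc k) sums (sqrt_series b - 1)"
    using sqrt_series_sums by (subst sums_Suc_iff) simp
  hence "(\<lambda>n. norm (\<Sum>k<n. sqrt_coeff (Suc k) *\<^sub>R b ^ Suc k)) \<longlonglongrightarrow> norm (sqrt_series b - 1)"
    unfolding sums_def by (rule tendsto_norm)
  moreover have "norm (\<Sum>k<n. sqrt_coeff (Suc k) *\<^sub>R b ^ Suc k) \<le> 1" for n
    using sum_norm_le[of "{..<n}" "\<lambda>k. sqrt_coeff (Suc k) *\<^sub>R b ^ Suc k" "\<lambda>k. \<bar>sqrt_coeff (Suc k)\<bar>"]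
      norm_sqrt_series_term[of "Suc _"] sum_abs_sqrt_coeff[of n] by (meson order_trans)
  ultimately have "norm (sqrt_series b - 1) \<le> 1"
    by (meson LIMSEQ_le_const2)
  thus ?thesis by (simp add: norm_minus_commute)
qed

lemma star_sqrt_series:
  assumes "star b = b"
  shows "star (sqrt_series b) = sqrt_series b"
proof -
  have "(\<lambda>k. star (sqrt_coeff k *\<^sub>R b ^ k)) sums star (sqrt_series b)"
    by (rule bounded_linear.sums[OF bounded_linear_star sqrt_series_sums])
  hence "(\<lambda>k. sqrt_coeff k *\<^sub>R b ^ k) sums star (sqrt_series b)"
    by (simp add: star_scaleR star_power assms)
  thus ?thesis using sums_unique2 sqrt_series_sums by blast
qed

text \<open>The relation passes to powers and so to the series. With different \<open>b\<close> and
  \<open>c\<close> it carries square roots across a \<open>y\<close> that need not commute with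
  them, as \<open>star_mult_self_not_negative\<close> requires; \<open>c = b\<close> gives
  commutation.\<close>

lemma sqrt_series_intertwine:
  assumes "norm c \<le> 1" "y * b = c * y"
  shows "y * sqrt_series b = sqrt_series c * y"
proof -
  have pow: "y * b ^ k = c ^ k * y" for k
  proof (induction k)
    case (Suc k)
    have "y * b ^ Suc k = (y * b) * b ^ k" by (simp add: mult.assoc)
    also have "\<dots> = c * (y * b ^ k)" by (simp add: assms(2) mult.assoc)
    finally show ?case by (simp add: Suc mult.assoc)
  qed simp
  have "(\<lambda>k. y * (sqrt_coeff k *\<^sub>R b ^ k)) sums (y * sqrt_series b)"
    by (rule sums_mult[OF sqrt_series_sums])
  moreover have "(\<lambda>k. (sqrt_coeff k *\<^sub>R c ^ k) * y) sums (sqrt_series c * y)"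
    unfolding sqrt_series_def
    by (rule sums_mult2[OF summable_sums[OF summable_norm_cancel]],
        rule summable_comparison_test'[OF summable_sqrt_coeff, of 0])
      (use assms(1) norm_power_ineq[of c] power_le_one[of "norm c"] in
        \<open>auto simp: intro!: mult_left_le order_trans[OF norm_power_ineq]\<close>)
  ultimately show ?thesis using sums_unique2 by (simp add: pow)
qed

end

section \<open>Closed subalgebras, positivity and rescaled square roots\<close>

definition closed_subalgebra :: "'a::cstar_algebra set \<Rightarrow> bool" where
  "closed_subalgebra D \<longleftrightarrow> closed D \<and> csubspace D \<and> 1 \<in> D \<and> (\<forall>x\<in>D. \<forall>y\<in>D. x * y \<in> D)"

lemma closed_subalgebra_scaleR:
  "closed_subalgebra D \<Longrightarrow> x \<in> D \<Longrightarrow> r *\<^sub>R x \<in> D"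
  by (simp add: closed_subalgebra_def scaleR_scaleC cvs.subspace_scale)

lemma closed_subalgebra_diff:
  "closed_subalgebra D \<Longrightarrow> x \<in> D \<Longrightarrow> y \<in> D \<Longrightarrow> x - y \<in> D"
  by (simp add: closed_subalgebra_def cvs.subspace_diff)

lemma closed_subalgebra_sqrt_series:
  assumes D: "closed_subalgebra D" and b: "b \<in> D" "norm b \<le> 1"
  shows "sqrt_series b \<in> D"
proof -
  have "b ^ k \<in> D" for k
    using D b by (induction k) (auto simp: closed_subalgebra_def)
  hence "(\<Sum>k<n. sqrt_coeff k *\<^sub>R b ^ k) \<in> D" for n
    using D by (auto simp: closed_subalgebra_def scaleR_scaleC
        intro!: cvs.subspace_sum cvs.subspace_scale)
  thus ?thesis
    using sqrt_series_sums[OF b(2)] D unfolding sums_def closed_subalgebra_def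
    by (meson closed_sequentially)
qed

text \<open>Squares of hermitian elements are taken rather than elements \<open>star x * x\<close>:
  the equivalence, \<open>positive_iff_star_mult_self\<close>, itself needs the theory of this
  cone.\<close>

definition is_positive :: "'a::cstar_algebra \<Rightarrow> bool" where
  "is_positive a \<longleftrightarrow> (\<exists>s. star s = s \<and> a = s * s)"

lemma positive_hermitian: "is_positive a \<Longrightarrow> star a = a"
  by (auto simp: is_positive_def star_mult)

text \<open>The series needs an argument in the unit ball, hence the rescaling by \<open>t\<close>.
  For hermitian \<open>a\<close> the condition \<open>norm (t *\<^sub>R 1 - a) \<le> t\<close> says
  that \<open>a\<close> lies between 0 and \<open>2 * t\<close>.\<close>

definition psqrt :: "real \<Rightarrow> 'a::cstar_algebra \<Rightarrow> 'a" where
  "psqrt t a = sqrt t *\<^sub>R sqrt_series (1 - a /\<^sub>R t)"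

context
  fixes t :: real and a :: "'a::cstar_algebra"
  assumes t: "t > 0" and bound: "norm (t *\<^sub>R 1 - a) \<le> t"
begin

lemma psqrt_aux: "norm (1 - a /\<^sub>R t) \<le> 1"
proof -
  have "1 - a /\<^sub>R t = (t *\<^sub>R 1 - a) /\<^sub>R t" using t by (simp add: scaleR_diff_right)
  also have "norm \<dots> \<le> 1" unfolding norm_scaleR using t bound by (simp add: field_simps)
  finally show ?thesis .
qed

lemma psqrt_square: "psqrt t a * psqrt t a = a"
proof -
  have "psqrt t a * psqrt t a = (sqrt t * sqrt t) *\<^sub>R (a /\<^sub>R t)"
    unfolding psqrt_def by (simp add: sqrt_series_square[OF psqrt_aux])
  thus ?thesis using t by simp
qed

lemma star_psqrt: "star a = a \<Longrightarrow> star (psqrt t a) = psqrt t a"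
  unfolding psqrt_def star_scaleR
  by (subst star_sqrt_series[OF psqrt_aux]) (simp_all add: star_diff star_1 star_scaleR)

lemma norm_psqrt: "norm (sqrt t *\<^sub>R 1 - psqrt t a) \<le> sqrt t"
proof -
  have "norm (sqrt t *\<^sub>R (1 - sqrt_series (1 - a /\<^sub>R t))) \<le> sqrt t"
    using norm_sqrt_series[OF psqrt_aux] t by (simp add: mult_left_le)
  thus ?thesis by (simp add: psqrt_def scaleR_diff_right)
qed

lemma psqrt_intertwine:
  assumes "norm (t *\<^sub>R 1 - c) \<le> t" "y * a = c * y"
  shows "y * psqrt t a = psqrt t c * y"
proof -
  have "norm (1 - c /\<^sub>R t) \<le> 1"
  proof -
    have "1 - c /\<^sub>R t = (t *\<^sub>R 1 - c) /\<^sub>R t" using t by (simp add: scaleR_diff_right)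
    also have "norm \<dots> \<le> 1" unfolding norm_scaleR using t assms by (simp add: field_simps)
    finally show ?thesis .
  qed
  hence "y * sqrt_series (1 - a /\<^sub>R t) = sqrt_series (1 - c /\<^sub>R t) * y"
    by (rule sqrt_series_intertwine[OF psqrt_aux])
      (simp add: algebra_simps assms)
  thus ?thesis by (simp add: psqrt_def)
qed

lemma psqrt_commute: "y * a = a * y \<Longrightarrow> y * psqrt t a = psqrt t a * y"
  by (rule psqrt_intertwine[OF bound])

lemma psqrt_in_closed_subalgebra:
  "closed_subalgebra D \<Longrightarrow> a \<in> D \<Longrightarrow> psqrt t a \<in> D"
  unfolding psqrt_def
  by (intro closed_subalgebra_scaleR closed_subalgebra_sqrt_series closed_subalgebra_diff
      psqrt_aux) (auto simp: closed_subalgebra_def)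

lemma positive_if_norm_le: "star a = a \<Longrightarrow> is_positive a"
  unfolding is_positive_def using star_psqrt psqrt_square by metis

end

text \<open>With \<open>c\<close> the square root of \<open>t - s\<^sup>2\<close>, the element \<open>c + i s\<close> is \<open>sqrt t\<close> times a unitary.\<close>

lemma norm_hermitian_le_if_squares_sum:
  fixes c s :: "'a::cstar_algebra"
  assumes "star c = c" "star s = s" "c * s = s * c" "c * c + s * s = t *\<^sub>R 1" "t \<ge> 0"
  shows "norm c \<le> sqrt t"
proof -
  define u where "u = c + \<i> *\<^sub>C s"
  have su: "star u = c - \<i> *\<^sub>C s"
    by (simp add: u_def star_add star_scaleC assms)
  have "star u * u = c * c - (\<i> * \<i>) *\<^sub>C (s * s) + \<i> *\<^sub>C (c * s - s * c)"
    unfolding su unfolding u_def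
    by (simp add: algebra_simps mult_scaleC_left mult_scaleC_right scaleC_scaleC cvs.scale_right_diff_distrib)
  also have "\<dots> = t *\<^sub>R 1"
    using assms(3,4) by (simp add: scaleC_minus1)
  finally have "(norm u)\<^sup>2 = t"
    using norm_star_mult[of u] assms(5) by simp
  hence nu: "norm u = sqrt t" by (simp add: real_sqrt_unique)
  have "u + star u = 2 *\<^sub>R c" unfolding su unfolding u_def by (simp add: scaleR_2)
  hence "2 * norm c \<le> norm u + norm (star u)"
    by (metis norm_scaleR abs_numeral norm_triangle_ineq)
  thus ?thesis by (simp add: norm_star nu)
qed

text \<open>Since \<open>t - s * s\<close> is within distance \<open>t\<close> of \<open>t\<close>,
  it has a root \<open>c\<close>, which commutes with \<open>s\<close>. Then
  \<open>c * c + s * s = t\<close> bounds \<open>norm c\<close>.\<close>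

lemma norm_diff_square_le:
  fixes s :: "'a::cstar_algebra"
  assumes s: "star s = s" and t: "norm (s * s) \<le> t"
  shows "norm (t *\<^sub>R 1 - s * s) \<le> t"
proof (cases "t = 0")
  case True
  thus ?thesis using t by simp
next
  case False
  with t norm_ge_zero[of "s * s"] have t0: "t > 0" by linarith
  have b: "norm (t *\<^sub>R 1 - (t *\<^sub>R 1 - s * s)) \<le> t" using t by simp
  define c where "c = psqrt t (t *\<^sub>R 1 - s * s)"
  have c: "star c = c" "c * c = t *\<^sub>R 1 - s * s"
    using star_psqrt[OF t0 b] psqrt_square[OF t0 b]
    by (simp_all add: c_def star_diff star_scaleR star_1 star_mult s)
  have "s * c = c * s" unfolding c_def
    by (rule psqrt_commute[OF t0 b]) (simp add: algebra_simps)
  hence "norm c \<le> sqrt t"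
    by (intro norm_hermitian_le_if_squares_sum[of c s]) (use c s t0 in auto)
  hence "norm (c * c) \<le> t"
    using t0 by (simp add: norm_hermitian_square[OF c(1)] sqrt_ge_absD)
  thus ?thesis by (simp add: c)
qed

text \<open>Converse of \<open>positive_if_norm_le\<close>. Together they turn positivity of a
  hermitian element into a norm inequality, and such inequalities survive sums and limits.\<close>

lemma positive_norm_le:
  "is_positive (a::'a::cstar_algebra) \<Longrightarrow> norm a \<le> t \<Longrightarrow> norm (t *\<^sub>R 1 - a) \<le> t"
  unfolding is_positive_def using norm_diff_square_le by blast

lemma positive_0 [simp]: "is_positive 0"
  unfolding is_positive_def by (rule exI[of _ 0]) simp

lemma positive_scaleR:
  assumes "is_positive (a::'a::cstar_algebra)" "r \<ge> 0"
  shows "is_positive (r *\<^sub>R a)"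
proof -
  from assms obtain s where s: "star s = s" "a = s * s" by (auto simp: is_positive_def)
  have "r *\<^sub>R a = (sqrt r *\<^sub>R s) * (sqrt r *\<^sub>R s)" using assms(2) s by simp
  moreover have "star (sqrt r *\<^sub>R s) = sqrt r *\<^sub>R s" by (simp add: star_scaleR s)
  ultimately show ?thesis unfolding is_positive_def by blast
qed

lemma is_positive_add:
  assumes "is_positive (a::'a::cstar_algebra)" "is_positive b"
  shows "is_positive (a + b)"
\<comment> \<open>The summand 1 keeps the radius nonzero when \<open>a\<close> and \<open>b\<close>
  are 0.\<close>
proof (rule positive_if_norm_le[of "(norm a + 1) + norm b"])
  have "norm ((norm a + 1) *\<^sub>R 1 - a + (norm b *\<^sub>R 1 - b)) \<le> (norm a + 1) + norm b"
    using positive_norm_le[OF assms(1), of "norm a + 1"] positive_norm_le[OF assms(2), of "norm b"]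
    by (intro norm_triangle_mono) auto
  thus "norm (((norm a + 1) + norm b) *\<^sub>R 1 - (a + b)) \<le> (norm a + 1) + norm b"
    by (simp add: algebra_simps)
  show "0 < norm a + 1 + norm b" using norm_ge_zero[of a] norm_ge_zero[of b] by linarith
qed (use assms in \<open>simp add: star_add positive_hermitian\<close>)

lemma is_positive_sum: "(\<And>i. i \<in> I \<Longrightarrow> is_positive (f i)) \<Longrightarrow> is_positive (sum f I)"
  by (induction I rule: infinite_finite_induct) (auto intro: is_positive_add)

lemma positive_norm_diff:
  assumes "star a = (a::'a::cstar_algebra)" "norm a \<le> t"
  shows "is_positive (t *\<^sub>R 1 - a)"
proof (cases "t = 0")
  case False
  with assms norm_ge_zero[of a] have "t > 0" by linarith
  thus ?thesis by (rule positive_if_norm_le) (use assms in \<open>auto simp: star_diff star_scaleR star_1\<close>)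
qed (use assms in auto)

text \<open>With \<open>t = norm b\<close>, both \<open>a\<close> and \<open>t - a\<close> are
  positive. Their roots commute and the squares of the roots add up to \<open>t\<close>, so
  \<open>norm_hermitian_le_if_squares_sum\<close> bounds the root of \<open>a\<close> by
  \<open>sqrt t\<close>.\<close>

lemma positive_norm_mono:
  assumes a: "is_positive (a::'a::cstar_algebra)" and ba: "is_positive (b - a)"
  shows "norm a \<le> norm b"
proof -
  define t where "t = norm b"
  have b: "is_positive b" using is_positive_add[OF a ba] by simp
  have "is_positive (t *\<^sub>R 1 - b)"
    by (rule positive_norm_diff) (auto simp: t_def positive_hermitian[OF b])
  from is_positive_add[OF this ba] have "is_positive (t *\<^sub>R 1 - a)" by simp
  \<comment> \<open>One radius for the roots of both \<open>a\<close> and \<open>t - a\<close>: it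
    exceeds the norm of each and is never zero.\<close>
  define T where "T = norm a + t + 1"
  have T: "T > 0" unfolding T_def t_def using norm_ge_zero[of a] norm_ge_zero[of b] by linarith
  define x where "x = psqrt T a"
  define y where "y = psqrt T (t *\<^sub>R 1 - a)"
  have bx: "norm (T *\<^sub>R 1 - a) \<le> T"
    by (rule positive_norm_le[OF a]) (simp add: T_def t_def)
  have "norm (t *\<^sub>R 1 - a) \<le> t + norm a"
    using norm_triangle_ineq4[of "t *\<^sub>R 1" a] by (simp add: t_def)
  hence bb: "norm (T *\<^sub>R 1 - (t *\<^sub>R 1 - a)) \<le> T"
    by (intro positive_norm_le[OF \<open>is_positive (t *\<^sub>R 1 - a)\<close>]) (simp add: T_def t_def)
  have "a * x = x * a" unfolding x_def by (rule psqrt_commute[OF T bx]) simp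
  hence "x * y = y * x" unfolding y_def
    by (intro psqrt_commute[OF T bb]) (simp add: algebra_simps)
  moreover have "star x = x" "star y = y" unfolding x_def y_def
    using star_psqrt[OF T bx] star_psqrt[OF T bb] a
    by (simp_all add: positive_hermitian star_diff star_scaleR star_1)
  moreover have xx: "x * x = a" "y * y = t *\<^sub>R 1 - a"
    unfolding x_def y_def using psqrt_square[OF T bx] psqrt_square[OF T bb] by simp_all
  ultimately have "norm x \<le> sqrt t"
    by (intro norm_hermitian_le_if_squares_sum[of x y]) (auto simp: t_def)
  hence "(norm x)\<^sup>2 \<le> t" by (simp add: sqrt_ge_absD t_def)
  thus ?thesis using xx(1) norm_hermitian_square[OF \<open>star x = x\<close>] by (simp add: t_def)
qed

lemma positive_antisym:
  "is_positive (a::'a::cstar_algebra) \<Longrightarrow> is_positive (- a) \<Longrightarrow> a = 0"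
  using positive_norm_mono[of a 0] by simp

text \<open>A convergent sequence is bounded by a single \<open>t\<close>, so all its terms satisfy
  the same closed inequality of \<open>positive_norm_le\<close>.\<close>

lemma positive_closed:
  assumes f: "f \<longlonglongrightarrow> (a::'a::cstar_algebra)" and pos: "\<And>n::nat. is_positive (f n)"
  shows "is_positive a"
proof -
  obtain t where t: "t > 0" "\<And>n. norm (f n) \<le> t"
    using convergentI[OF f, THEN convergent_imp_Bseq] unfolding Bseq_def by blast
  show ?thesis
  proof (rule positive_if_norm_le[OF t(1)])
    show "norm (t *\<^sub>R 1 - a) \<le> t"
      by (rule LIMSEQ_le_const2[OF tendsto_norm[OF tendsto_diff[OF tendsto_const f]]])
        (use positive_norm_le[OF pos t(2)] in auto)
    show "star a = a"
      by (rule LIMSEQ_unique[OF bounded_linear.tendsto[OF bounded_linear_star f]])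
        (use f in \<open>simp add: positive_hermitian[OF pos]\<close>)
  qed
qed

lemma positive_sqrt:
  assumes "is_positive (a::'a::cstar_algebra)" "norm a < t"
  shows "star (psqrt t a) = psqrt t a" "psqrt t a * psqrt t a = a" "is_positive (psqrt t a)"
    "\<And>y. y * a = a * y \<Longrightarrow> y * psqrt t a = psqrt t a * y"
proof -
  have t: "t > 0" using assms(2) norm_ge_zero[of a] by linarith
  have b: "norm (t *\<^sub>R 1 - a) \<le> t" by (rule positive_norm_le) (use assms in auto)
  show s: "star (psqrt t a) = psqrt t a" "psqrt t a * psqrt t a = a"
    using star_psqrt[OF t b] psqrt_square[OF t b] assms by (auto simp: positive_hermitian)
  show "is_positive (psqrt t a)"
    by (rule positive_if_norm_le[OF _ norm_psqrt[OF t b] s(1)]) (use t in simp)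
  show "\<And>y. y * a = a * y \<Longrightarrow> y * psqrt t a = psqrt t a * y"
    by (rule psqrt_commute[OF t b])
qed

text \<open>For \<open>d = c - v\<close> the positive elements \<open>d * c * d\<close> and
  \<open>d * v * d\<close> add up to \<open>d * (c * c - v * v) = 0\<close>, so both vanish. Their
  difference is the cube of \<open>d\<close>; thus \<open>d\<close> is hermitian and nilpotent,
  hence 0.\<close>

lemma positive_sqrt_unique:
  fixes v c :: "'a::cstar_algebra"
  assumes v: "is_positive v" and c: "is_positive c" and comm: "v * c = c * v" and sq: "v * v = c * c"
  shows "v = c"
proof -
  define d where "d = c - v"
  have d: "star d = d" "d * c = c * d" "d * v = v * d"
    unfolding d_def
    by (simp_all add: star_diff positive_hermitian[OF v] positive_hermitian[OF c]
        left_diff_distrib right_diff_distrib comm)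
  have sandwich: "is_positive (d * a * d)" if a: "is_positive a" "d * a = a * d" for a
  proof -
    define e where "e = psqrt (norm a + 1) a"
    have lt: "norm a < norm a + 1" by simp
    have e: "star e = e" "e * e = a" "d * e = e * d"
      unfolding e_def
      by (rule positive_sqrt(1)[OF a(1) lt] positive_sqrt(2)[OF a(1) lt]
          positive_sqrt(4)[OF a(1) lt a(2)])+
    have "d * a * d = (d * e) * (e * d)" unfolding e(2)[symmetric] by (simp only: mult.assoc)
    hence "d * a * d = (e * d) * (e * d)" by (simp only: e(3))
    moreover have "star (e * d) = e * d" by (simp only: star_mult e(1,3) d(1))
    ultimately show ?thesis unfolding is_positive_def by blast
  qed
  have "d * c * d + d * v * d = d * ((c + v) * d)" by (simp add: algebra_simps)
  also have "(c + v) * d = 0"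
    unfolding d_def by (simp add: distrib_left distrib_right left_diff_distrib right_diff_distrib comm sq)
  finally have "d * v * d = - (d * c * d)" by (simp add: eq_neg_iff_add_eq_0 add.commute)
  hence 0: "d * c * d = 0" using positive_antisym sandwich v c d by metis
  hence "d * v * d = 0" using \<open>d * v * d = - (d * c * d)\<close> by simp
  have "d * d * d = d * c * d - d * v * d" by (subst (2) d_def) (simp add: algebra_simps)
  hence "(d * d) * (d * d) = 0" using 0 \<open>d * v * d = 0\<close> by (simp flip: mult.assoc)
  hence "d * d = 0" using star_mult_self_eq_0[of "d * d"] d by (simp add: star_mult)
  hence "d = 0" using star_mult_self_eq_0[of d] d by simp
  thus ?thesis by (simp add: d_def)
qed

text \<open>
  With \<open>v = y y\<^sup>*\<close> and \<open>w = - y\<^sup>* y\<close> both positive, \<open>v y = - y w\<close> gives \<open>v\<^sup>2 y = y w\<^sup>2\<close>, hence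
  \<open>v y = y w\<close> by taking square roots.
\<close>

lemma star_mult_self_not_negative:
  fixes y :: "'a::cstar_algebra"
  assumes "is_positive (- (star y * y))"
  shows "y = 0"
proof -
  define w where "w = - (star y * y)"
  define v where "v = y * star y"
  have w: "is_positive w" using assms by (simp add: w_def)
  define a where "a = (1/2) *\<^sub>C (y + star y)"
  define b where "b = (\<i>/2) *\<^sub>C (star y - y)"
  have ib: "\<i> *\<^sub>C b = (1/2) *\<^sub>C (y - star y)"
    by (simp add: b_def scaleC_scaleC cvs.scale_right_diff_distrib)
  have half: "(1/2) *\<^sub>C z + (1/2) *\<^sub>C z = z" for z :: 'a
    by (simp add: scaleC_one flip: scaleC_add_left)
  have ya: "y = a + \<i> *\<^sub>C b"
    unfolding ib a_def using half[of y] half[of "star y"]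
    by (simp add: scaleC_add_right cvs.scale_right_diff_distrib algebra_simps)
  have sa: "star y = a - \<i> *\<^sub>C b"
    unfolding ib a_def using half[of y] half[of "star y"]
    by (simp add: scaleC_add_right cvs.scale_right_diff_distrib algebra_simps)
  have ab: "star a = a" "star b = b"
    by (simp_all add: a_def b_def star_scaleC star_add star_diff star_star add.commute
        cvs.scale_right_diff_distrib)
  \<comment> \<open>In terms of the Cartesian parts \<open>a\<close> and \<open>b\<close> of
    \<open>y\<close>, the sum \<open>y * star y + star y * y\<close> is visibly positive; this is
    how positivity passes from \<open>w\<close> to \<open>v\<close>.\<close>
  have "v + star y * y = 2 *\<^sub>R (a * a + b * b)"
    unfolding v_def sa unfolding ya
    by (simp add: algebra_simps mult_scaleC_left mult_scaleC_right scaleC_scaleC scaleC_minus1 scaleR_2)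
  hence "v = w + 2 *\<^sub>R (a * a + b * b)" by (simp add: w_def algebra_simps)
  moreover have "is_positive (a * a)" "is_positive (b * b)" using ab unfolding is_positive_def by blast+
  ultimately have v: "is_positive v" using w by (auto intro!: is_positive_add positive_scaleR)
  have vy: "v * y = - (y * w)" by (simp add: v_def w_def mult.assoc)
  have "v * v * y = v * - (y * w)" by (simp only: mult.assoc vy)
  also have "\<dots> = - (v * y * w)" by (simp only: mult_minus_right mult.assoc)
  also have "\<dots> = y * (w * w)" by (simp only: vy) (simp add: mult.assoc)
  finally have vvy: "y * (w * w) = v * v * y" by (rule sym)
  have pp: "is_positive (v * v)" "is_positive (w * w)"
    using v w positive_hermitian unfolding is_positive_def by blast+
  define t where "t = norm (v * v) + norm (w * w) + 1"
  have t: "t > 0" "norm (v * v) < t" "norm (w * w) < t"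
    unfolding t_def using norm_ge_zero[of "v * v"] norm_ge_zero[of "w * w"] by linarith+
  have root: "psqrt t (x * x) = x" if "is_positive x" "is_positive (x * x)" "norm (x * x) < t" for x :: 'a
  proof (rule positive_sqrt_unique)
    show "is_positive (psqrt t (x * x))" by (rule positive_sqrt(3)[OF that(2,3)])
    show "is_positive x" by (rule that(1))
    show "psqrt t (x * x) * x = x * psqrt t (x * x)"
      by (rule positive_sqrt(4)[OF that(2,3), symmetric]) (simp only: mult.assoc)
    show "psqrt t (x * x) * psqrt t (x * x) = x * x" by (rule positive_sqrt(2)[OF that(2,3)])
  qed
  have "y * psqrt t (w * w) = psqrt t (v * v) * y"
    by (rule psqrt_intertwine[OF t(1)]) (use pp t vvy in \<open>auto intro!: positive_norm_le\<close>)
  hence "y * w = v * y" using root pp v w t by simp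
  hence "y * w = - (y * w)" using vy by simp
  hence "2 *\<^sub>R (y * w) = 0" by (simp add: scaleR_2 eq_neg_iff_add_eq_0)
  hence yw: "y * w = 0" by simp
  have "w * w = - (star y * (y * w))" by (subst (1) w_def) (simp add: mult.assoc)
  hence "w = 0" using yw star_mult_self_eq_0[of w] positive_hermitian[OF w] by simp
  thus ?thesis using star_mult_self_eq_0[of y] by (simp add: w_def)
qed

text \<open>The witness is \<open>k = \<bar>r\<bar> - r\<close>, with \<open>g = sqrt \<bar>r\<bar> k\<close>; then \<open>r k = - \<bar>r\<bar> k\<close>.\<close>

lemma negative_part:
  fixes r :: "'a::cstar_algebra"
  assumes r: "star r = r"
  obtains k g where "star k = k" "star g = g" "k * r * k = - (star g * g)" "g = 0 \<Longrightarrow> is_positive r"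
    "\<And>c. r * c = 0 \<Longrightarrow> g * c = 0"
    "\<And>D. closed_subalgebra D \<Longrightarrow> r \<in> D \<Longrightarrow> k \<in> D"
proof -
  have rr: "is_positive (r * r)" using r unfolding is_positive_def by blast
  define t where "t = norm (r * r) + 1"
  define m where "m = psqrt t (r * r)"
  have m: "star m = m" "m * m = r * r" "is_positive m" "r * m = m * r"
    unfolding m_def
    by (rule positive_sqrt(1,2,3)[OF rr] positive_sqrt(4)[OF rr], simp_all add: t_def mult.assoc)+
  define e where "e = psqrt (norm m + 1) m"
  have e: "star e = e" "e * e = m" "r * e = e * r" "m * e = e * m"
    unfolding e_def
    by (rule positive_sqrt(1,2)[OF m(3)] positive_sqrt(4)[OF m(3)], simp_all add: m(4))+
  define k where "k = m - r"
  define g where "g = e * k"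
  have k: "star k = k" by (simp add: k_def star_diff r m)
  have mk: "m * k = - (r * k)" unfolding k_def using m by (simp add: algebra_simps)
  have "star g * g = k * (e * e) * k" by (simp only: g_def star_mult k e(1) mult.assoc)
  also have "\<dots> = - (k * r * k)" by (simp only: e mult.assoc mk) simp
  finally have 1: "k * r * k = - (star g * g)" by simp
  have 2: "is_positive r" if "g = 0"
  proof -
    have "m * k = 0" using that e(2) by (metis g_def mult.assoc mult_zero_right)
    hence "k * k = 0" using mk by (subst (1) k_def) (simp add: algebra_simps)
    hence "k = 0" using k star_mult_self_eq_0[of k] by simp
    thus ?thesis using m(3) by (simp add: k_def)
  qed
  have "k * e = e * k" unfolding k_def using e by (simp add: algebra_simps)
  hence 5: "star g = g" by (simp add: g_def star_mult k e)
  have mc: "m * c = 0" if "r * c = 0" for c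
  proof (rule star_mult_self_eq_0)
    have "star (m * c) * (m * c) = star c * (m * m) * c" by (simp only: star_mult m(1) mult.assoc)
    also have "\<dots> = 0" by (simp only: m(2) mult.assoc that) simp
    finally show "star (m * c) * (m * c) = 0" .
  qed
  have 3: "k * c = 0" if "r * c = 0" for c
    using that mc[OF that] by (simp add: k_def algebra_simps)
  have 4: "k \<in> D" if D: "closed_subalgebra D" "r \<in> D" for D
  proof -
    have "t > 0" unfolding t_def using norm_ge_zero[of "r * r"] by linarith
    moreover have "norm (t *\<^sub>R 1 - r * r) \<le> t"
      by (rule positive_norm_le[OF rr]) (simp add: t_def)
    moreover have "r * r \<in> D" using D by (simp add: closed_subalgebra_def)
    ultimately have "m \<in> D" unfolding m_def using D(1) by (intro psqrt_in_closed_subalgebra)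
    thus ?thesis unfolding k_def using D by (intro closed_subalgebra_diff)
  qed
  show ?thesis
    by (rule that[of k g]) (use 1 2 3 4 5 k in \<open>auto simp: g_def mult.assoc\<close>)
qed

text \<open>For \<open>k\<close> and \<open>g\<close> from the negative part of
  \<open>star x * x\<close>, the element \<open>star (x * k) * (x * k) = - (star g * g)\<close> is
  negative, so \<open>star_mult_self_not_negative\<close> gives \<open>x * k = 0\<close> and then
  \<open>g = 0\<close>.\<close>

lemma positive_star_mult_self: "is_positive (star x * (x::'a::cstar_algebra))"
proof -
  have "star (star x * x) = star x * x" by (simp add: star_mult star_star)
  then obtain k g where k: "star k = k" and g: "star g = g" "k * (star x * x) * k = - (star g * g)"
    "g = 0 \<Longrightarrow> is_positive (star x * x)"
    by (rule negative_part) blast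
  have "star (x * k) * (x * k) = - (star g * g)"
    using g(2) by (simp add: star_mult k mult.assoc)
  moreover have "is_positive (star g * g)" using g(1) unfolding is_positive_def by metis
  ultimately have "x * k = 0" by (intro star_mult_self_not_negative) simp
  hence "star g * g = 0" using g(2) by (simp add: mult.assoc)
  hence "g = 0" by (rule star_mult_self_eq_0)
  thus ?thesis by (rule g(3))
qed

lemma positive_iff_star_mult_self: "is_positive a \<longleftrightarrow> (\<exists>x. a = star x * (x::'a::cstar_algebra))"
  using positive_star_mult_self by (metis is_positive_def)

lemma positive_conj:
  assumes "is_positive (b::'a::cstar_algebra)"
  shows "is_positive (star z * b * z)"
proof -
  from assms obtain s where "star s = s" "b = s * s" by (auto simp: is_positive_def)
  hence "star z * b * z = star (s * z) * (s * z)" by (simp add: star_mult mult.assoc)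
  thus ?thesis using positive_star_mult_self by metis
qed

text \<open>
  The hypothesis is positivity of \<open>\<langle>x - r y c, x - r y c\<rangle>\<close> for a Hilbert module over the algebra,
  where \<open>a = \<langle>x, x\<rangle>\<close>, \<open>b = \<langle>y, y\<rangle>\<close> and \<open>c = \<langle>y, x\<rangle>\<close>.
\<close>

lemma cstar_Cauchy_Schwarz:
  fixes a b c :: "'a::cstar_algebra"
  assumes b: "is_positive b"
    and abc: "\<And>r::real. is_positive (a - (2 * r) *\<^sub>R (star c * c) + r\<^sup>2 *\<^sub>R (star c * b * c))"
  shows "(norm c)\<^sup>2 \<le> norm a * norm b"
proof -
  \<comment> \<open>Taking \<open>r = 1/t\<close> and adding \<open>(1/t)\<^sup>2\<close> times the
    positive element \<open>star c * (t - b) * c\<close> cancels the term in \<open>b\<close>, so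
    that \<open>a\<close> minus \<open>1/t\<close> times \<open>star c * c\<close> is positive. A
    \<open>t\<close> above \<open>norm b\<close> permits the division; letting it tend to
    \<open>norm b\<close> gives the sharp bound.\<close>
  have le: "(norm c)\<^sup>2 \<le> norm a * t" if t: "norm b < t" for t
  proof -
    have t0: "t > 0" using t norm_ge_zero[of b] by linarith
    have "is_positive (star c * (t *\<^sub>R 1 - b) * c)"
      by (rule positive_conj, rule positive_norm_diff) (use b t in \<open>auto simp: positive_hermitian\<close>)
    hence "is_positive ((1/t)\<^sup>2 *\<^sub>R (star c * (t *\<^sub>R 1 - b) * c))" by (rule positive_scaleR) simp
    from is_positive_add[OF abc[of "1/t"] this]
    moreover have "star c * (t *\<^sub>R 1 - b) * c = t *\<^sub>R (star c * c) - star c * b * c"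
      by (simp add: left_diff_distrib right_diff_distrib)
    moreover have "(1/t)\<^sup>2 *\<^sub>R (t *\<^sub>R (star c * c)) = (1/t) *\<^sub>R (star c * c)"
      using t0 by (simp add: power2_eq_square)
    moreover have "(2 * (1/t)) *\<^sub>R (star c * c) = (1/t) *\<^sub>R (star c * c) + (1/t) *\<^sub>R (star c * c)"
      by (simp flip: scaleR_add_left)
    ultimately have "is_positive (a - (1/t) *\<^sub>R (star c * c))"
      by (simp only: scaleR_right_diff_distrib) (simp add: algebra_simps)
    hence "norm ((1/t) *\<^sub>R (star c * c)) \<le> norm a"
      using t0 by (intro positive_norm_mono positive_scaleR positive_star_mult_self) auto
    thus ?thesis using t0 by (simp add: norm_star_mult field_simps)
  qed
  show ?thesis
  proof (rule tendsto_le[of "at_right (norm b)"])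
    show "((\<lambda>t. norm a * t) \<longlongrightarrow> norm a * norm b) (at_right (norm b))"
      by (intro tendsto_intros)
    show "\<forall>\<^sub>F t in at_right (norm b). (norm c)\<^sup>2 \<le> norm a * t"
      using le by (auto simp: eventually_at_right_less eventually_at_filter)
  qed auto
qed

section \<open>Operator norms\<close>

definition op_norm :: "('r \<Rightarrow> 'x \<Rightarrow> 'x) \<Rightarrow> ('x \<Rightarrow> real) \<Rightarrow> 'r \<Rightarrow> real" where
  "op_norm act N r = Inf {C. 0 \<le> C \<and> (\<forall>x. N (act r x) \<le> C * N x)}"

text \<open>The common setting of block matrices acting on columns and of \<open>H\<close> acting on
  itself by left multiplication. The points carry no linear structure, since for block matrices they
  are vectors of varying length; sums and scalars concern the operators only.\<close>

locale op_rep =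
  fixes act :: "'r::complex_star_algebra \<Rightarrow> 'x \<Rightarrow> 'x" and N :: "'x \<Rightarrow> real"
  assumes N_nonneg: "0 \<le> N x"
    and act_mult: "act (r * s) x = act r (act s x)"
    and N_act_add: "N (act (r + s) x) \<le> N (act r x) + N (act s x)"
    and N_act_scaleC: "N (act (c *\<^sub>C r) x) = cmod c * N (act r x)"
    and N_act_star: "(N (act r x))\<^sup>2 \<le> N x * N (act (star r * r) x)"
    and N_act_bounded: "\<exists>C\<ge>0. \<forall>x. N (act r x) \<le> C * N x"
begin

lemma op_norm_nonneg: "0 \<le> op_norm act N r"
  unfolding op_norm_def using N_act_bounded[of r] by (intro cInf_greatest) auto

lemma op_norm_least: "0 \<le> C \<Longrightarrow> (\<And>x. N (act r x) \<le> C * N x) \<Longrightarrow> op_norm act N r \<le> C"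
  unfolding op_norm_def by (rule cInf_lower) (auto intro: bdd_belowI[of _ 0])

lemma op_norm_bound: "N (act r x) \<le> op_norm act N r * N x"
proof (cases "N x = 0")
  case True
  then show ?thesis using N_act_bounded[of r] by (metis mult_zero_right)
next
  case False
  hence pos: "N x > 0" using N_nonneg[of x] by simp
  have "N (act r x) / N x \<le> op_norm act N r"
    unfolding op_norm_def using N_act_bounded[of r] pos
    by (intro cInf_greatest) (auto simp: divide_le_eq)
  thus ?thesis using pos by (simp add: divide_le_eq)
qed

text \<open>The half of the C*-identity that comes from the Cauchy-Schwarz assumption
  \<open>N_act_star\<close>. It implies \<open>op_norm_star_le\<close>, and with that the other half
  follows from submultiplicativity.\<close>

lemma op_norm_square_le: "(op_norm act N r)\<^sup>2 \<le> op_norm act N (star r * r)"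
proof -
  have "op_norm act N r \<le> sqrt (op_norm act N (star r * r))"
  proof (rule op_norm_least)
    fix x
    have "(N (act r x))\<^sup>2 \<le> N x * (op_norm act N (star r * r) * N x)"
      using N_act_star[of r x] mult_left_mono[OF op_norm_bound[of "star r * r" x] N_nonneg[of x]]
      by linarith
    also have "\<dots> = (sqrt (op_norm act N (star r * r)) * N x)\<^sup>2"
      by (simp add: power_mult_distrib op_norm_nonneg power2_eq_square mult_ac)
    finally show "N (act r x) \<le> sqrt (op_norm act N (star r * r)) * N x"
      by (rule power2_le_imp_le) (simp add: op_norm_nonneg N_nonneg)
  qed (simp add: op_norm_nonneg)
  thus ?thesis by (metis op_norm_nonneg real_le_lsqrt real_sqrt_le_iff real_sqrt_pow2 power_mono)
qed

lemma op_norm_mult: "op_norm act N (r * s) \<le> op_norm act N r * op_norm act N s"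
proof (rule op_norm_least)
  fix x
  have "N (act (r * s) x) \<le> op_norm act N r * N (act s x)"
    unfolding act_mult by (rule op_norm_bound)
  also have "\<dots> \<le> op_norm act N r * (op_norm act N s * N x)"
    by (intro mult_left_mono op_norm_bound op_norm_nonneg)
  finally show "N (act (r * s) x) \<le> op_norm act N r * op_norm act N s * N x"
    by (simp add: mult.assoc)
qed (simp add: op_norm_nonneg)

lemma op_norm_star_le: "op_norm act N (star r) \<le> op_norm act N r"
proof (cases "op_norm act N (star r) = 0")
  case False
  have "(op_norm act N (star r))\<^sup>2 \<le> op_norm act N r * op_norm act N (star r)"
    using op_norm_square_le[of "star r"] op_norm_mult[of r "star r"] by (simp add: star_star)
  thus ?thesis using False op_norm_nonneg[of "star r"] by (simp add: power2_eq_square)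
qed (simp add: op_norm_nonneg)

lemma op_norm_scaleC: "op_norm act N (c *\<^sub>C r) = cmod c * op_norm act N r"
proof -
  have le: "op_norm act N (d *\<^sub>C s) \<le> cmod d * op_norm act N s" for d s
    by (rule op_norm_least)
      (simp_all add: op_norm_nonneg N_act_scaleC mult.assoc mult_left_mono op_norm_bound)
  show ?thesis
  proof (cases "c = 0")
    case True
    thus ?thesis using le[of 0 r] op_norm_nonneg[of "c *\<^sub>C r"] by simp
  next
    case False
    have "op_norm act N r \<le> cmod (inverse c) * op_norm act N (c *\<^sub>C r)"
      using le[of "inverse c" "c *\<^sub>C r"] False by (simp add: scaleC_scaleC scaleC_one)
    hence "cmod c * op_norm act N r \<le> op_norm act N (c *\<^sub>C r)"
      using False by (simp add: norm_inverse norm_divide field_simps)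
    thus ?thesis using le[of c r] by simp
  qed
qed

lemma cstar_seminorm_op_norm: "cstar_seminorm (op_norm act N)"
  unfolding cstar_seminorm_def
proof (intro conjI allI)
  fix r s
  show "op_norm act N (r + s) \<le> op_norm act N r + op_norm act N s"
    by (rule op_norm_least)
      (auto simp: op_norm_nonneg distrib_right
        intro!: order_trans[OF N_act_add] add_mono op_norm_bound)
  show "op_norm act N (star r * r) = (op_norm act N r)\<^sup>2"
    using op_norm_square_le[of r] op_norm_mult[of "star r" r]
      mult_right_mono[OF op_norm_star_le[of r] op_norm_nonneg[of r]]
    by (simp add: power2_eq_square)
qed (rule op_norm_scaleC op_norm_mult)+

end


section \<open>Matrices over a C*-algebra\<close>

definition vinner :: "nat \<Rightarrow> (nat \<Rightarrow> 'b::cstar_algebra) \<Rightarrow> (nat \<Rightarrow> 'b) \<Rightarrow> 'b" where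
  "vinner n \<xi> \<eta> = (\<Sum>i<n. star (\<xi> i) * \<eta> i)"

definition vnorm :: "nat \<Rightarrow> (nat \<Rightarrow> 'b::cstar_algebra) \<Rightarrow> real" where
  "vnorm n \<xi> = sqrt (norm (vinner n \<xi> \<xi>))"

definition mat_vec :: "nat \<Rightarrow> (nat \<Rightarrow> nat \<Rightarrow> 'b::cstar_algebra) \<Rightarrow> (nat \<Rightarrow> 'b) \<Rightarrow> nat \<Rightarrow> 'b" where
  "mat_vec n f \<xi> i = (\<Sum>j<n. f i j * \<xi> j)"

lemma vnorm_nonneg: "0 \<le> vnorm n \<xi>"
  by (simp add: vnorm_def)

lemma vnorm_square: "(vnorm n \<xi>)\<^sup>2 = norm (vinner n \<xi> \<xi>)"
  by (simp add: vnorm_def)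

lemma positive_vinner: "is_positive (vinner n \<xi> \<xi>)"
  unfolding vinner_def by (intro is_positive_sum positive_star_mult_self)

lemma star_vinner: "star (vinner n \<xi> \<eta>) = vinner n \<eta> \<xi>"
  by (simp add: vinner_def star_sum star_mult star_star)

lemma vinner_add_left: "vinner n (\<lambda>i. \<xi> i + \<zeta> i) \<eta> = vinner n \<xi> \<eta> + vinner n \<zeta> \<eta>"
  by (simp add: vinner_def star_add distrib_right sum.distrib)

lemma vinner_add_right: "vinner n \<eta> (\<lambda>i. \<xi> i + \<zeta> i) = vinner n \<eta> \<xi> + vinner n \<eta> \<zeta>"
  by (simp add: vinner_def distrib_left sum.distrib)

lemma vinner_diff_left: "vinner n (\<lambda>i. \<xi> i - \<zeta> i) \<eta> = vinner n \<xi> \<eta> - vinner n \<zeta> \<eta>"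
  by (simp add: vinner_def star_diff left_diff_distrib sum_subtractf)

lemma vinner_diff_right: "vinner n \<eta> (\<lambda>i. \<xi> i - \<zeta> i) = vinner n \<eta> \<xi> - vinner n \<eta> \<zeta>"
  by (simp add: vinner_def right_diff_distrib sum_subtractf)

lemma vinner_mult_right: "vinner n \<eta> (\<lambda>i. \<xi> i * z) = vinner n \<eta> \<xi> * z"
  by (simp add: vinner_def sum_distrib_right mult.assoc)

lemma vinner_mult_left: "vinner n (\<lambda>i. \<eta> i * z) \<xi> = star z * vinner n \<eta> \<xi>"
  by (simp add: vinner_def sum_distrib_left mult.assoc star_mult)

lemma norm_vinner_le: "norm (vinner n \<xi> \<eta>) \<le> vnorm n \<xi> * vnorm n \<eta>"
proof -
  define c where "c = vinner n \<xi> \<eta>"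
  have sc: "vinner n \<eta> \<xi> = star c" by (simp add: c_def star_vinner)
  have "(norm c)\<^sup>2 \<le> norm (vinner n \<eta> \<eta>) * norm (vinner n \<xi> \<xi>)"
  proof (rule cstar_Cauchy_Schwarz[OF positive_vinner])
    fix r :: real
    define \<zeta> where "\<zeta> i = \<eta> i - \<xi> i * (r *\<^sub>R c)" for i
    have "vinner n \<zeta> \<zeta> = vinner n \<eta> \<eta> - (2 * r) *\<^sub>R (star c * c) +
        r\<^sup>2 *\<^sub>R (star c * vinner n \<xi> \<xi> * c)"
      unfolding \<zeta>_def vinner_diff_left vinner_diff_right vinner_mult_left vinner_mult_right sc
        c_def[symmetric]
      by (simp add: star_scaleR power2_eq_square mult.assoc scaleR_2 right_diff_distrib
          flip: scaleR_scaleR)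
    thus "is_positive (vinner n \<eta> \<eta> - (2 * r) *\<^sub>R (star c * c) +
        r\<^sup>2 *\<^sub>R (star c * vinner n \<xi> \<xi> * c))"
      using positive_vinner[of n \<zeta>] by simp
  qed
  hence "(norm c)\<^sup>2 \<le> (vnorm n \<xi> * vnorm n \<eta>)\<^sup>2"
    by (simp add: power_mult_distrib vnorm_square mult.commute)
  thus ?thesis unfolding c_def[symmetric]
    by (rule power2_le_imp_le) (simp add: vnorm_nonneg)
qed

lemma vnorm_add: "vnorm n (\<lambda>i. \<xi> i + \<eta> i) \<le> vnorm n \<xi> + vnorm n \<eta>"
proof (rule power2_le_imp_le)
  have "(vnorm n (\<lambda>i. \<xi> i + \<eta> i))\<^sup>2 =
      norm (vinner n \<xi> \<xi> + vinner n \<eta> \<xi> + (vinner n \<xi> \<eta> + vinner n \<eta> \<eta>))"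
    unfolding vnorm_square vinner_add_left vinner_add_right by (simp add: add_ac)
  also have "\<dots> \<le> norm (vinner n \<xi> \<xi>) + norm (vinner n \<eta> \<xi>) +
      (norm (vinner n \<xi> \<eta>) + norm (vinner n \<eta> \<eta>))"
    by (intro norm_triangle_mono order_refl)
  also have "\<dots> \<le> (vnorm n \<xi>)\<^sup>2 + vnorm n \<eta> * vnorm n \<xi> +
      (vnorm n \<xi> * vnorm n \<eta> + (vnorm n \<eta>)\<^sup>2)"
    by (intro add_mono norm_vinner_le) (simp_all add: vnorm_square)
  also have "\<dots> = (vnorm n \<xi> + vnorm n \<eta>)\<^sup>2"
    by (simp add: power2_eq_square algebra_simps)
  finally show "(vnorm n (\<lambda>i. \<xi> i + \<eta> i))\<^sup>2 \<le> (vnorm n \<xi> + vnorm n \<eta>)\<^sup>2" .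
qed (simp add: vnorm_nonneg)

lemma vnorm_scaleC: "vnorm n (\<lambda>i. c *\<^sub>C \<xi> i) = cmod c * vnorm n \<xi>"
proof -
  have "vinner n (\<lambda>i. c *\<^sub>C \<xi> i) (\<lambda>i. c *\<^sub>C \<xi> i) = (cnj c * c) *\<^sub>C vinner n \<xi> \<xi>"
    by (simp add: vinner_def star_scaleC mult_scaleC_left mult_scaleC_right scaleC_scaleC
        cvs.scale_sum_right mult.commute)
  thus ?thesis
    by (simp add: vnorm_def norm_scaleC norm_mult real_sqrt_mult)
qed

lemma norm_le_vnorm: "i < n \<Longrightarrow> norm (\<xi> i) \<le> vnorm n \<xi>"
proof (rule power2_le_imp_le)
  assume "i < n"
  hence "vinner n \<xi> \<xi> - star (\<xi> i) * \<xi> i = (\<Sum>k\<in>{..<n}-{i}. star (\<xi> k) * \<xi> k)"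
    unfolding vinner_def by (subst sum.remove[of _ i]) auto
  hence "norm (star (\<xi> i) * \<xi> i) \<le> norm (vinner n \<xi> \<xi>)"
    by (intro positive_norm_mono positive_star_mult_self)
      (auto intro: is_positive_sum positive_star_mult_self)
  thus "(norm (\<xi> i))\<^sup>2 \<le> (vnorm n \<xi>)\<^sup>2" by (simp add: norm_star_mult vnorm_square)
qed (rule vnorm_nonneg)

lemma vnorm_le_sum: "vnorm n \<xi> \<le> (\<Sum>i<n. norm (\<xi> i))"
proof (induction n)
  case (Suc n)
  have "norm (vinner (Suc n) \<xi> \<xi>) \<le> norm (vinner n \<xi> \<xi>) + norm (star (\<xi> n) * \<xi> n)"
    by (simp add: vinner_def norm_triangle_ineq)
  hence "(vnorm (Suc n) \<xi>)\<^sup>2 \<le> (vnorm n \<xi>)\<^sup>2 + (norm (\<xi> n))\<^sup>2"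
    by (simp add: vnorm_square norm_star_mult)
  also have "\<dots> \<le> (vnorm n \<xi> + norm (\<xi> n))\<^sup>2"
    by (simp add: power2_sum vnorm_nonneg)
  finally have "vnorm (Suc n) \<xi> \<le> vnorm n \<xi> + norm (\<xi> n)"
    by (rule power2_le_imp_le) (simp add: vnorm_nonneg)
  with Suc show ?case by simp
qed (simp add: vnorm_def vinner_def)

lemma vinner_mat_vec:
  "vinner n \<xi> (mat_vec n f \<eta>) = vinner n (mat_vec n (\<lambda>i j. star (f j i)) \<xi>) \<eta>"
proof -
  have "vinner n \<xi> (mat_vec n f \<eta>) = (\<Sum>i<n. \<Sum>j<n. star (\<xi> i) * f i j * \<eta> j)"
    by (simp add: vinner_def mat_vec_def sum_distrib_left mult.assoc)
  also have "\<dots> = (\<Sum>j<n. \<Sum>i<n. star (\<xi> i) * f i j * \<eta> j)"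
    by (rule sum.swap)
  also have "\<dots> = vinner n (mat_vec n (\<lambda>i j. star (f j i)) \<xi>) \<eta>"
    by (simp add: vinner_def mat_vec_def star_sum star_mult star_star sum_distrib_right)
  finally show ?thesis .
qed

text \<open>The constant is chosen before the size: this is boundedness in the product of all matrix
  algebras, not merely in each factor.\<close>

definition bounded_blocks :: "(nat \<Rightarrow> nat \<Rightarrow> nat \<Rightarrow> 'b::cstar_algebra) \<Rightarrow> bool" where
  "bounded_blocks X \<longleftrightarrow> (\<exists>C\<ge>0. \<forall>n \<xi>. vnorm n (mat_vec n (X n) \<xi>) \<le> C * vnorm n \<xi>)"

lemma bounded_blocks_add:
  assumes "bounded_blocks X" "bounded_blocks Y"
  shows "bounded_blocks (\<lambda>n i j. X n i j + Y n i j)"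
proof -
  from assms obtain C D where CD: "C \<ge> 0" "D \<ge> 0"
    "\<And>n \<xi>. vnorm n (mat_vec n (X n) \<xi>) \<le> C * vnorm n \<xi>"
    "\<And>n \<xi>. vnorm n (mat_vec n (Y n) \<xi>) \<le> D * vnorm n \<xi>"
    unfolding bounded_blocks_def by metis
  have "vnorm n (mat_vec n (\<lambda>i j. X n i j + Y n i j) \<xi>) \<le> (C + D) * vnorm n \<xi>" for n \<xi>
  proof -
    have "mat_vec n (\<lambda>i j. X n i j + Y n i j) \<xi> = (\<lambda>i. mat_vec n (X n) \<xi> i + mat_vec n (Y n) \<xi> i)"
      by (simp add: fun_eq_iff mat_vec_def distrib_right sum.distrib)
    thus ?thesis
      using vnorm_add[of n "mat_vec n (X n) \<xi>" "mat_vec n (Y n) \<xi>"] CD(3,4)[of n \<xi>]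
      by (simp add: distrib_right)
  qed
  thus ?thesis unfolding bounded_blocks_def using CD(1,2) by (intro exI[of _ "C + D"]) auto
qed

lemma mat_vec_scaleC: "mat_vec n (\<lambda>i j. c *\<^sub>C f i j) \<xi> = (\<lambda>i. c *\<^sub>C mat_vec n f \<xi> i)"
  by (simp add: fun_eq_iff mat_vec_def mult_scaleC_left cvs.scale_sum_right)

lemma bounded_blocks_scaleC:
  assumes "bounded_blocks X"
  shows "bounded_blocks (\<lambda>n i j. c *\<^sub>C X n i j)"
proof -
  from assms obtain C where C: "C \<ge> 0" "\<And>n \<xi>. vnorm n (mat_vec n (X n) \<xi>) \<le> C * vnorm n \<xi>"
    unfolding bounded_blocks_def by metis
  have "vnorm n (mat_vec n (\<lambda>i j. c *\<^sub>C X n i j) \<xi>) \<le> (cmod c * C) * vnorm n \<xi>" for n \<xi>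
    unfolding mat_vec_scaleC vnorm_scaleC using mult_left_mono[OF C(2), of "cmod c"]
    by (simp add: mult.assoc)
  thus ?thesis unfolding bounded_blocks_def using C(1) by (intro exI[of _ "cmod c * C"]) auto
qed

lemma mat_vec_mult:
  "mat_vec n (\<lambda>i j. \<Sum>k<n. f i k * g k j) \<xi> = mat_vec n f (mat_vec n g \<xi>)"
proof
  fix i
  have "mat_vec n (\<lambda>i j. \<Sum>k<n. f i k * g k j) \<xi> i = (\<Sum>j<n. \<Sum>k<n. f i k * g k j * \<xi> j)"
    by (simp add: mat_vec_def sum_distrib_right)
  also have "\<dots> = (\<Sum>k<n. \<Sum>j<n. f i k * g k j * \<xi> j)" by (rule sum.swap)
  also have "\<dots> = mat_vec n f (mat_vec n g \<xi>) i"
    by (simp add: mat_vec_def sum_distrib_left mult.assoc)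
  finally show "mat_vec n (\<lambda>i j. \<Sum>k<n. f i k * g k j) \<xi> i = mat_vec n f (mat_vec n g \<xi>) i" .
qed

lemma bounded_blocks_mult:
  assumes "bounded_blocks X" "bounded_blocks Y"
  shows "bounded_blocks (\<lambda>n i j. \<Sum>k<n. X n i k * Y n k j)"
proof -
  from assms obtain C D where CD: "C \<ge> 0" "D \<ge> 0"
    "\<And>n \<xi>. vnorm n (mat_vec n (X n) \<xi>) \<le> C * vnorm n \<xi>"
    "\<And>n \<xi>. vnorm n (mat_vec n (Y n) \<xi>) \<le> D * vnorm n \<xi>"
    unfolding bounded_blocks_def by metis
  have "vnorm n (mat_vec n (\<lambda>i j. \<Sum>k<n. X n i k * Y n k j) \<xi>) \<le> (C * D) * vnorm n \<xi>" for n \<xi>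
    unfolding mat_vec_mult
    using CD(3)[of n "mat_vec n (Y n) \<xi>"] mult_left_mono[OF CD(4)[of n \<xi>] CD(1)]
    by (simp add: mult.assoc)
  thus ?thesis unfolding bounded_blocks_def using CD(1,2) by (intro exI[of _ "C * D"]) auto
qed

lemma bounded_blocks_star:
  assumes "bounded_blocks X"
  shows "bounded_blocks (\<lambda>n i j. star (X n j i))"
proof -
  from assms obtain C where C: "C \<ge> 0" "\<And>n \<xi>. vnorm n (mat_vec n (X n) \<xi>) \<le> C * vnorm n \<xi>"
    unfolding bounded_blocks_def by metis
  have "vnorm n (mat_vec n (\<lambda>i j. star (X n j i)) \<xi>) \<le> C * vnorm n \<xi>" for n \<xi>
  proof -
    define \<eta> where "\<eta> = mat_vec n (\<lambda>i j. star (X n j i)) \<xi>"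
    have "(vnorm n \<eta>)\<^sup>2 = norm (vinner n \<xi> (mat_vec n (X n) \<eta>))"
      unfolding vnorm_square vinner_mat_vec by (simp add: \<eta>_def)
    also have "\<dots> \<le> vnorm n \<xi> * vnorm n (mat_vec n (X n) \<eta>)" by (rule norm_vinner_le)
    also have "\<dots> \<le> vnorm n \<xi> * (C * vnorm n \<eta>)"
      by (intro mult_left_mono C vnorm_nonneg)
    finally have "vnorm n \<eta> * vnorm n \<eta> \<le> (C * vnorm n \<xi>) * vnorm n \<eta>"
      by (simp add: power2_eq_square mult_ac)
    thus ?thesis unfolding \<eta>_def[symmetric]
      using vnorm_nonneg[of n \<eta>] C(1) vnorm_nonneg[of n \<xi>]
      by (cases "vnorm n \<eta> = 0") auto
  qed
  thus ?thesis unfolding bounded_blocks_def using C(1) by blast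
qed

text \<open>
  No type can depend on the size \<open>n\<close>, so the matrix algebras of all sizes are combined into
  their \<open>\<ell>\<^sup>\<infinity>\<close>-product, which is again a C*-algebra; \<open>block X n\<close> is the component of size \<open>n\<close>.
\<close>

typedef (overloaded) 'b block_matrix =
  "{X :: nat \<Rightarrow> nat \<Rightarrow> nat \<Rightarrow> 'b::cstar_algebra.
     (\<forall>n i j. n \<le> i \<or> n \<le> j \<longrightarrow> X n i j = 0) \<and> bounded_blocks X}"
  morphisms block Abs_block_matrix
  by (rule exI[of _ "\<lambda>_ _ _. 0"])
    (auto simp: bounded_blocks_def mat_vec_def vnorm_def vinner_def intro!: exI[of _ 0])

setup_lifting type_definition_block_matrix

lemma block_eq_0: "n \<le> i \<or> n \<le> j \<Longrightarrow> block X n i j = 0"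
  using block[of X] by blast

lemma bounded_block: "bounded_blocks (block X)"
  using block[of X] by blast

lemma block_matrix_eqI: "(\<And>n i j. i < n \<Longrightarrow> j < n \<Longrightarrow> block X n i j = block Y n i j) \<Longrightarrow> X = Y"
  by (subst block_inject[symmetric]) (metis block_eq_0 ext not_le)

instantiation block_matrix :: (cstar_algebra) complex_star_algebra
begin

lift_definition zero_block_matrix :: "'a block_matrix" is "\<lambda>_ _ _. 0"
  by (auto simp: bounded_blocks_def mat_vec_def vnorm_def vinner_def intro!: exI[of _ 0])

lift_definition one_block_matrix :: "'a block_matrix" is
  "\<lambda>n i j. if i = j \<and> i < n then 1 else 0"
proof
  have "vnorm n (mat_vec n (\<lambda>i j. if i = j \<and> i < n then 1 else 0) \<xi>) = vnorm n \<xi>"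
    for n and \<xi> :: "nat \<Rightarrow> 'a"
    unfolding vnorm_def vinner_def mat_vec_def
    by (intro arg_cong[of _ _ sqrt] arg_cong[of _ _ norm] sum.cong)
      (auto simp: if_distrib[of "\<lambda>x. x * _"] cong: if_cong)
  thus "bounded_blocks (\<lambda>n i j. if i = j \<and> i < n then 1 else 0 :: 'a)"
    unfolding bounded_blocks_def by (intro exI[of _ 1]) simp
qed auto

lift_definition plus_block_matrix :: "'a block_matrix \<Rightarrow> 'a block_matrix \<Rightarrow> 'a block_matrix" is
  "\<lambda>X Y n i j. X n i j + Y n i j"
  by (auto intro: bounded_blocks_add)

lift_definition scaleC_block_matrix :: "complex \<Rightarrow> 'a block_matrix \<Rightarrow> 'a block_matrix" is
  "\<lambda>c X n i j. c *\<^sub>C X n i j"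
  by (auto intro: bounded_blocks_scaleC)

lift_definition times_block_matrix :: "'a block_matrix \<Rightarrow> 'a block_matrix \<Rightarrow> 'a block_matrix" is
  "\<lambda>X Y n i j. \<Sum>k<n. X n i k * Y n k j"
  by (auto intro: bounded_blocks_mult)

lift_definition star_block_matrix :: "'a block_matrix \<Rightarrow> 'a block_matrix" is
  "\<lambda>X n i j. star (X n j i)"
  by (auto intro: bounded_blocks_star)

definition uminus_block_matrix :: "'a block_matrix \<Rightarrow> 'a block_matrix" where
  "uminus_block_matrix X = (-1) *\<^sub>C X"

definition minus_block_matrix :: "'a block_matrix \<Rightarrow> 'a block_matrix \<Rightarrow> 'a block_matrix" where
  "minus_block_matrix X Y = X + - Y"

instance
proof
  fix X Y Z :: "'a block_matrix" and c d :: complex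
  show "X + Y + Z = X + (Y + Z)" by transfer (simp add: add.assoc)
  show "X + Y = Y + X" by transfer (simp add: add.commute)
  show "0 + X = X" by transfer simp
  show "- X + X = 0" unfolding uminus_block_matrix_def by transfer (simp add: scaleC_minus1)
  show "X - Y = X + - Y" by (rule minus_block_matrix_def)
  show "c *\<^sub>C (X + Y) = c *\<^sub>C X + c *\<^sub>C Y" by transfer (simp add: scaleC_add_right)
  show "(c + d) *\<^sub>C X = c *\<^sub>C X + d *\<^sub>C X" by transfer (simp add: scaleC_add_left)
  show "c *\<^sub>C d *\<^sub>C X = (c * d) *\<^sub>C X" by transfer (simp add: scaleC_scaleC)
  show "1 *\<^sub>C X = X" by transfer (simp add: scaleC_one)
  show "X * Y * Z = X * (Y * Z)"
  proof transfer
    fix X Y Z :: "nat \<Rightarrow> nat \<Rightarrow> nat \<Rightarrow> 'a"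
    have "(\<Sum>k<n. (\<Sum>l<n. X n i l * Y n l k) * Z n k j) = (\<Sum>k<n. X n i k * (\<Sum>l<n. Y n k l * Z n l j))"
      for n i j
      using mat_vec_mult[of n "X n" "Y n" "\<lambda>k. Z n k j"]
      by (simp add: mat_vec_def fun_eq_iff)
    thus "(\<lambda>n i j. \<Sum>k<n. (\<Sum>l<n. X n i l * Y n l k) * Z n k j) =
        (\<lambda>n i j. \<Sum>k<n. X n i k * (\<Sum>l<n. Y n k l * Z n l j))" by simp
  qed
  show "1 * X = X"
  proof (rule block_matrix_eqI)
    fix n i j :: nat assume "i < n" "j < n"
    thus "block (1 * X) n i j = block X n i j"
      by (simp add: times_block_matrix.rep_eq one_block_matrix.rep_eq
          if_distrib[of "\<lambda>x. x * _"] cong: if_cong)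
  qed
  show "X * 1 = X"
  proof (rule block_matrix_eqI)
    fix n i j :: nat assume "i < n" "j < n"
    moreover have "(\<Sum>k<n. block X n i k * (if k = j \<and> k < n then 1 else 0)) =
        (\<Sum>k<n. if k = j then block X n i k else 0)"
      by (rule sum.cong) auto
    ultimately show "block (X * 1) n i j = block X n i j"
      by (simp add: times_block_matrix.rep_eq one_block_matrix.rep_eq)
  qed
  show "(X + Y) * Z = X * Z + Y * Z" by transfer (simp add: distrib_right sum.distrib)
  show "X * (Y + Z) = X * Y + X * Z" by transfer (simp add: distrib_left sum.distrib)
  show "(0::'a block_matrix) \<noteq> 1"
  proof
    assume "(0::'a block_matrix) = 1"
    hence "block (0::'a block_matrix) 1 0 0 = block (1::'a block_matrix) 1 0 0" by simp
    thus False by (simp add: zero_block_matrix.rep_eq one_block_matrix.rep_eq)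
  qed
  show "(c *\<^sub>C X) * Y = c *\<^sub>C (X * Y)"
    by transfer (simp add: mult_scaleC_left cvs.scale_sum_right)
  show "X * (c *\<^sub>C Y) = c *\<^sub>C (X * Y)"
    by transfer (simp add: mult_scaleC_right cvs.scale_sum_right)
  show "star (star X) = X" by transfer (simp add: star_star)
  show "star (X + Y) = star X + star Y" by transfer (simp add: star_add)
  show "star (c *\<^sub>C X) = cnj c *\<^sub>C star X" by transfer (simp add: star_scaleC)
  show "star (X * Y) = star Y * star X" by transfer (simp add: star_sum star_mult)
qed

end

lemma block_simps:
  "block 0 n i j = 0"
  "block (X + Y) n i j = block X n i j + block Y n i j"
  "block (X - Y) n i j = block X n i j - block Y n i j"
  "block (c *\<^sub>C X) n i j = c *\<^sub>C block X n i j"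
  "block (X * Y) n i j = (\<Sum>k<n. block X n i k * block Y n k j)"
  "block (star X) n i j = star (block X n j i)"
proof -
  show "block (X - Y) n i j = block X n i j - block Y n i j"
  proof -
    have "X - Y = X + (-1) *\<^sub>C Y"
      by (simp only: minus_block_matrix_def uminus_block_matrix_def)
    hence "block (X - Y) n i j = block X n i j + (-1) *\<^sub>C block Y n i j"
      by (simp only: plus_block_matrix.rep_eq scaleC_block_matrix.rep_eq)
    thus ?thesis by (simp add: scaleC_minus1)
  qed
qed (simp_all add: zero_block_matrix.rep_eq plus_block_matrix.rep_eq scaleC_block_matrix.rep_eq
      times_block_matrix.rep_eq star_block_matrix.rep_eq)

lemma block_1: "i < n \<Longrightarrow> block 1 n i j = (if i = j then 1 else 0)"
  by (simp add: one_block_matrix.rep_eq)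

lemma block_sum: "block (sum f I) n i j = (\<Sum>k\<in>I. block (f k) n i j)"
  by (induction I rule: infinite_finite_induct) (simp_all add: block_simps)

section \<open>Norm and completeness of the product of matrix algebras\<close>

definition block_act ::
  "'b::cstar_algebra block_matrix \<Rightarrow> nat \<times> (nat \<Rightarrow> 'b) \<Rightarrow> nat \<times> (nat \<Rightarrow> 'b)" where
  "block_act X = (\<lambda>(n, \<xi>). (n, mat_vec n (block X n) \<xi>))"

definition block_vnorm :: "nat \<times> (nat \<Rightarrow> 'b::cstar_algebra) \<Rightarrow> real" where
  "block_vnorm = (\<lambda>(n, \<xi>). vnorm n \<xi>)"

global_interpretation block: op_rep block_act block_vnorm
proof
  fix x :: "nat \<times> (nat \<Rightarrow> 'a)" and r s :: "'a block_matrix" and c :: complex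
  obtain n \<xi> where x: "x = (n, \<xi>)" by force
  show "0 \<le> block_vnorm x" by (simp add: block_vnorm_def x vnorm_nonneg)
  show "block_act (r * s) x = block_act r (block_act s x)"
    by (simp add: block_act_def x times_block_matrix.rep_eq mat_vec_mult)
  have "mat_vec n (block (r + s) n) \<xi> = (\<lambda>i. mat_vec n (block r n) \<xi> i + mat_vec n (block s n) \<xi> i)"
    by (simp add: fun_eq_iff mat_vec_def block_simps distrib_right sum.distrib)
  thus "block_vnorm (block_act (r + s) x) \<le> block_vnorm (block_act r x) + block_vnorm (block_act s x)"
    by (simp add: block_act_def block_vnorm_def x vnorm_add)
  show "block_vnorm (block_act (c *\<^sub>C r) x) = cmod c * block_vnorm (block_act r x)"
    by (simp add: block_act_def block_vnorm_def x scaleC_block_matrix.rep_eq mat_vec_scaleC vnorm_scaleC)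
  define \<eta> where "\<eta> = mat_vec n (block r n) \<xi>"
  have "(vnorm n \<eta>)\<^sup>2 = norm (vinner n \<eta> (mat_vec n (block r n) \<xi>))"
    by (simp add: \<eta>_def vnorm_square)
  also have "\<dots> = norm (vinner n (mat_vec n (block (star r * r) n) \<xi>) \<xi>)"
    unfolding vinner_mat_vec
    by (simp add: \<eta>_def times_block_matrix.rep_eq star_block_matrix.rep_eq mat_vec_mult)
  also have "\<dots> \<le> vnorm n \<xi> * vnorm n (mat_vec n (block (star r * r) n) \<xi>)"
    using norm_vinner_le by (metis mult.commute)
  finally show "(block_vnorm (block_act r x))\<^sup>2 \<le> block_vnorm x * block_vnorm (block_act (star r * r) x)"
    by (simp add: block_act_def block_vnorm_def x \<eta>_def)
  show "\<exists>C\<ge>0. \<forall>x. block_vnorm (block_act r x) \<le> C * block_vnorm x"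
    using bounded_block[of r] unfolding bounded_blocks_def
    by (auto simp: block_act_def block_vnorm_def)
qed

abbreviation block_norm :: "'b::cstar_algebra block_matrix \<Rightarrow> real" where
  "block_norm \<equiv> op_norm block_act block_vnorm"

lemma sum_eq_single:
  "finite I \<Longrightarrow> k \<in> I \<Longrightarrow> (\<And>i. i \<in> I \<Longrightarrow> i \<noteq> k \<Longrightarrow> f i = 0) \<Longrightarrow> sum f I = f k"
  by (simp add: sum.remove)

lemma vnorm_block_le: "vnorm n (mat_vec n (block X n) \<xi>) \<le> block_norm X * vnorm n \<xi>"
  using block.op_norm_bound[of X "(n, \<xi>)"] by (simp add: block_act_def block_vnorm_def)

lemma block_norm_least:
  "0 \<le> C \<Longrightarrow> (\<And>n \<xi>. vnorm n (mat_vec n (block X n) \<xi>) \<le> C * vnorm n \<xi>) \<Longrightarrow> block_norm X \<le> C"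
  by (rule block.op_norm_least) (auto simp: block_act_def block_vnorm_def)

lemma norm_block_le: "norm (block X n i j) \<le> block_norm X"
proof (cases "i < n \<and> j < n")
  case True
  define \<xi> :: "nat \<Rightarrow> 'a" where "\<xi> k = of_bool (k = j)" for k
  have "vinner n \<xi> \<xi> = star (\<xi> j) * \<xi> j"
    unfolding vinner_def by (rule sum_eq_single[of _ j]) (use True in \<open>auto simp: \<xi>_def\<close>)
  hence 1: "vnorm n \<xi> = 1" by (simp add: vnorm_def \<xi>_def star_1)
  have "mat_vec n (block X n) \<xi> i = block X n i j * \<xi> j"
    unfolding mat_vec_def by (rule sum_eq_single[of _ j]) (use True in \<open>auto simp: \<xi>_def\<close>)
  hence 2: "mat_vec n (block X n) \<xi> i = block X n i j" by (simp add: \<xi>_def)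
  have "norm (block X n i j) \<le> vnorm n (mat_vec n (block X n) \<xi>)"
    unfolding 2[symmetric] by (rule norm_le_vnorm) (use True in blast)
  also have "\<dots> \<le> block_norm X * vnorm n \<xi>" by (rule vnorm_block_le)
  finally show ?thesis by (simp only: 1 mult_1_right)
next
  case False
  hence "block X n i j = 0" by (intro block_eq_0) auto
  thus ?thesis using block.op_norm_nonneg[of X] by simp
qed

lemma block_norm_cstar:
  "block_norm (X + Y) \<le> block_norm X + block_norm Y"
  "block_norm (c *\<^sub>C X) = cmod c * block_norm X"
  "block_norm (X * Y) \<le> block_norm X * block_norm Y"
  "block_norm (star X * X) = (block_norm X)\<^sup>2"
  using block.cstar_seminorm_op_norm unfolding cstar_seminorm_def by blast+

instantiation block_matrix :: (cstar_algebra) real_normed_vector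
begin

definition norm_block_matrix :: "'a block_matrix \<Rightarrow> real" where
  "norm_block_matrix = block_norm"

definition scaleR_block_matrix :: "real \<Rightarrow> 'a block_matrix \<Rightarrow> 'a block_matrix" where
  "scaleR_block_matrix r X = complex_of_real r *\<^sub>C X"

definition dist_block_matrix :: "'a block_matrix \<Rightarrow> 'a block_matrix \<Rightarrow> real" where
  "dist_block_matrix X Y = norm (X - Y)"

definition sgn_block_matrix :: "'a block_matrix \<Rightarrow> 'a block_matrix" where
  "sgn_block_matrix X = inverse (norm X) *\<^sub>R X"

definition uniformity_block_matrix :: "('a block_matrix \<times> 'a block_matrix) filter" where
  "uniformity_block_matrix = (INF e\<in>{0<..}. principal {(X, Y). dist X Y < e})"

definition open_block_matrix :: "'a block_matrix set \<Rightarrow> bool" where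
  "open_block_matrix U \<longleftrightarrow> (\<forall>X\<in>U. eventually (\<lambda>(X', Y). X' = X \<longrightarrow> Y \<in> U) uniformity)"

instance
proof
  fix X Y :: "'a block_matrix" and r s :: real and U :: "'a block_matrix set"
  show "dist X Y = norm (X - Y)" by (rule dist_block_matrix_def)
  show "sgn X = inverse (norm X) *\<^sub>R X" by (rule sgn_block_matrix_def)
  show "uniformity = (INF e\<in>{0<..}. principal {(X, Y). dist X Y < (e::real)} :: ('a block_matrix \<times> _) filter)"
    by (rule uniformity_block_matrix_def)
  show "open U = (\<forall>X\<in>U. eventually (\<lambda>(X', Y). X' = X \<longrightarrow> Y \<in> U) uniformity)"
    by (rule open_block_matrix_def)
  show "r *\<^sub>R (X + Y) = r *\<^sub>R X + r *\<^sub>R Y" by (simp add: scaleR_block_matrix_def scaleC_add_right)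
  show "(r + s) *\<^sub>R X = r *\<^sub>R X + s *\<^sub>R X" by (simp add: scaleR_block_matrix_def scaleC_add_left)
  show "r *\<^sub>R s *\<^sub>R X = (r * s) *\<^sub>R X" by (simp add: scaleR_block_matrix_def scaleC_scaleC)
  show "1 *\<^sub>R X = X" by (simp add: scaleR_block_matrix_def scaleC_one)
  show "norm (X + Y) \<le> norm X + norm Y" unfolding norm_block_matrix_def by (rule block_norm_cstar)
  show "norm (r *\<^sub>R X) = \<bar>r\<bar> * norm X"
    by (simp add: scaleR_block_matrix_def norm_block_matrix_def block_norm_cstar)
  show "norm X = 0 \<longleftrightarrow> X = 0"
  proof
    assume "norm X = 0"
    hence "norm (block X n i j) \<le> 0" for n i j
      using norm_block_le[of X n i j] by (simp only: norm_block_matrix_def)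
    hence "block X n i j = 0" for n i j by simp
    thus "X = 0" by (intro block_matrix_eqI) (simp only: block_simps)
  next
    assume "X = 0"
    hence "X = 0 *\<^sub>C X" by simp
    thus "norm X = 0" using block_norm_cstar(2)[of 0 X] by (simp add: norm_block_matrix_def)
  qed
qed

end

instance block_matrix :: (cstar_algebra) real_normed_algebra_1
proof
  fix X Y :: "'a block_matrix" and r :: real
  show "r *\<^sub>R X * Y = r *\<^sub>R (X * Y)" by (simp add: scaleR_block_matrix_def mult_scaleC_left)
  show "X * r *\<^sub>R Y = r *\<^sub>R (X * Y)" by (simp add: scaleR_block_matrix_def mult_scaleC_right)
  show "norm (X * Y) \<le> norm X * norm Y" unfolding norm_block_matrix_def by (rule block_norm_cstar)
  have "norm (1::'a block_matrix) * norm (1::'a block_matrix) = norm (1::'a block_matrix) * 1"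
    using block_norm_cstar(4)[of "1::'a block_matrix", symmetric]
    by (simp only: norm_block_matrix_def star_1 mult_1_left mult_1_right power2_eq_square)
  moreover have "norm (1::'a block_matrix) \<noteq> 0" unfolding norm_eq_zero by (rule one_neq_zero)
  ultimately show "norm (1::'a block_matrix) = 1" by (simp only: mult_cancel_left) blast
qed

text \<open>The entries converge. For a fixed vector \<open>vnorm\<close> involves only finitely
  many of them, so the Cauchy estimate survives the limit in \<open>k\<close> with one constant for
  all sizes and vectors.\<close>

instance block_matrix :: (cstar_algebra) banach
proof
  fix X :: "nat \<Rightarrow> 'a block_matrix"
  assume cauchy: "Cauchy X"
  have small: "\<exists>M. \<forall>m\<ge>M. \<forall>k\<ge>M. block_norm (X m - X k) < e" if "e > 0" for e
    using cauchy that unfolding Cauchy_def dist_block_matrix_def norm_block_matrix_def by blast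
  define L where "L n i j = lim (\<lambda>m. block (X m) n i j)" for n i j
  have L: "(\<lambda>m. block (X m) n i j) \<longlonglongrightarrow> L n i j" for n i j
  proof -
    have "Cauchy (\<lambda>m. block (X m) n i j)"
    proof (rule CauchyI)
      fix e :: real assume "e > 0"
      then obtain M where M: "\<forall>m\<ge>M. \<forall>k\<ge>M. block_norm (X m - X k) < e" using small by blast
      have "norm (block (X m) n i j - block (X k) n i j) < e" if "m \<ge> M" "k \<ge> M" for m k
        using norm_block_le[of "X m - X k" n i j] M that by (fastforce simp: block_simps)
      thus "\<exists>M. \<forall>m\<ge>M. \<forall>k\<ge>M. norm (block (X m) n i j - block (X k) n i j) < e" by blast
    qed
    thus ?thesis unfolding L_def Cauchy_convergent_iff convergent_LIMSEQ_iff .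
  qed
  have lim_vnorm: "(\<lambda>k. vnorm n (mat_vec n (\<lambda>i j. block (X m) n i j - block (X k) n i j) \<xi>))
      \<longlonglongrightarrow> vnorm n (mat_vec n (\<lambda>i j. block (X m) n i j - L n i j) \<xi>)" for m n \<xi>
    unfolding vnorm_def vinner_def mat_vec_def
    by (intro tendsto_real_sqrt tendsto_norm tendsto_sum tendsto_mult
        bounded_linear.tendsto[OF bounded_linear_star] tendsto_diff tendsto_const L)
  have close: "\<exists>M. \<forall>m\<ge>M. \<forall>n \<xi>.
      vnorm n (mat_vec n (\<lambda>i j. block (X m) n i j - L n i j) \<xi>) \<le> e * vnorm n \<xi>" if e: "e > 0" for e
  proof -
    obtain M where M: "\<forall>m\<ge>M. \<forall>k\<ge>M. block_norm (X m - X k) < e" using small[OF e] by blast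
    have "vnorm n (mat_vec n (\<lambda>i j. block (X m) n i j - L n i j) \<xi>) \<le> e * vnorm n \<xi>"
      if m: "m \<ge> M" for m n \<xi>
    proof (rule LIMSEQ_le_const2[OF lim_vnorm], intro exI[of _ M] allI impI)
      fix k assume "k \<ge> M"
      have "mat_vec n (\<lambda>i j. block (X m) n i j - block (X k) n i j) \<xi> = mat_vec n (block (X m - X k) n) \<xi>"
        by (simp add: mat_vec_def fun_eq_iff block_simps)
      thus "vnorm n (mat_vec n (\<lambda>i j. block (X m) n i j - block (X k) n i j) \<xi>) \<le> e * vnorm n \<xi>"
        using vnorm_block_le[of n "X m - X k" \<xi>] M m \<open>k \<ge> M\<close>
          mult_right_mono[of "block_norm (X m - X k)" e "vnorm n \<xi>"] vnorm_nonneg[of n \<xi>]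
        by (smt (verit, best))
    qed
    thus ?thesis by blast
  qed
  obtain M where M: "\<forall>m\<ge>M. \<forall>n \<xi>.
      vnorm n (mat_vec n (\<lambda>i j. block (X m) n i j - L n i j) \<xi>) \<le> 1 * vnorm n \<xi>"
    using close[of 1] by auto
  have "bounded_blocks (\<lambda>n i j. block (X M) n i j - L n i j)"
    unfolding bounded_blocks_def using M by (intro exI[of _ 1]) auto
  \<comment> \<open>Boundedness of \<open>L\<close> is read off from
    \<open>L = X M - (X M - L)\<close>.\<close>
  from bounded_blocks_scaleC[OF this, of "-1"] bounded_block[of "X M"]
  have "bounded_blocks (\<lambda>n i j. block (X M) n i j + (-1) *\<^sub>C (block (X M) n i j - L n i j))"
    by (intro bounded_blocks_add)
  hence "bounded_blocks L" by (simp add: scaleC_minus1)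
  moreover have "L n i j = 0" if "n \<le> i \<or> n \<le> j" for n i j
    using L[of n i j] that by (simp add: block_eq_0 LIMSEQ_const_iff)
  ultimately have "L \<in> {X. (\<forall>n i j. n \<le> i \<or> n \<le> j \<longrightarrow> X n i j = 0) \<and> bounded_blocks X}" by blast
  then obtain Y where Y: "block Y = L" using Abs_block_matrix_inverse by blast
  have "X \<longlonglongrightarrow> Y"
  proof (rule metric_LIMSEQ_I)
    fix e :: real assume e: "e > 0"
    obtain M where M: "\<forall>m\<ge>M. \<forall>n \<xi>.
        vnorm n (mat_vec n (\<lambda>i j. block (X m) n i j - L n i j) \<xi>) \<le> (e / 2) * vnorm n \<xi>"
      using close[of "e / 2"] e by auto
    have "block_norm (X m - Y) \<le> e / 2" if "m \<ge> M" for m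
    proof (rule block_norm_least)
      fix n \<xi>
      have "mat_vec n (block (X m - Y) n) \<xi> = mat_vec n (\<lambda>i j. block (X m) n i j - L n i j) \<xi>"
        by (simp add: mat_vec_def fun_eq_iff block_simps Y)
      thus "vnorm n (mat_vec n (block (X m - Y) n) \<xi>) \<le> e / 2 * vnorm n \<xi>" using M that by simp
    qed (use e in simp)
    thus "\<exists>no. \<forall>n\<ge>no. dist (X n) Y < e"
      using e by (intro exI[of _ M]) (fastforce simp: dist_block_matrix_def norm_block_matrix_def)
  qed
  thus "convergent X" by (rule convergentI)
qed

instance block_matrix :: (cstar_algebra) cstar_algebra
proof
  fix X :: "'a block_matrix" and r :: real and c :: complex
  show "r *\<^sub>R X = complex_of_real r *\<^sub>C X" by (rule scaleR_block_matrix_def)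
  show "norm (c *\<^sub>C X) = cmod c * norm X" unfolding norm_block_matrix_def by (rule block_norm_cstar)
  show "norm (star X * X) = (norm X)\<^sup>2" unfolding norm_block_matrix_def by (rule block_norm_cstar)
qed

section \<open>Matrices of one size inside the product\<close>

lemma bounded_linear_block: "bounded_linear (\<lambda>X :: 'b::cstar_algebra block_matrix. block X n i j)"
  by (rule bounded_linear_intro[of _ 1])
    (use norm_block_le[of _ n i j] in
      \<open>simp_all add: block_simps scaleR_block_matrix_def norm_block_matrix_def scaleR_scaleC\<close>)

lemma vnorm_single_block:
  "vnorm n (mat_vec n (\<lambda>i j. if n = N \<and> i < n \<and> j < n then f i j else 0) \<xi>) \<le>
    (\<Sum>i<N. \<Sum>j<N. norm (f i j)) * vnorm n \<xi>" (is "vnorm n ?v \<le> _")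
proof (cases "n = N")
  case True
  have "vnorm n ?v \<le> (\<Sum>i<n. norm (?v i))" by (rule vnorm_le_sum)
  also have "\<dots> \<le> (\<Sum>i<n. \<Sum>j<n. norm (f i j) * vnorm n \<xi>)"
    unfolding mat_vec_def
    by (intro sum_mono sum_norm_le order_trans[OF norm_mult_ineq] mult_mono norm_le_vnorm)
      (use True in auto)
  finally show ?thesis by (simp add: True sum_distrib_right)
next
  case False
  thus ?thesis by (simp add: mat_vec_def vnorm_def vinner_def sum_nonneg)
qed

text \<open>The \<open>N\<close> by \<open>N\<close> matrices as one factor of the product. The
  embedding is not unital: the unit of the product has an identity block in every size.\<close>

lift_definition single_block :: "nat \<Rightarrow> (nat \<Rightarrow> nat \<Rightarrow> 'b::cstar_algebra) \<Rightarrow> 'b block_matrix" is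
  "\<lambda>N f n i j. if n = N \<and> i < n \<and> j < n then f i j else 0"
proof
  fix N :: nat and f :: "nat \<Rightarrow> nat \<Rightarrow> 'b"
  show "bounded_blocks (\<lambda>n i j. if n = N \<and> i < n \<and> j < n then f i j else 0)"
    unfolding bounded_blocks_def using vnorm_single_block[where N = N and f = f]
    by (intro exI[of _ "\<Sum>i<N. \<Sum>j<N. norm (f i j)"] conjI allI sum_nonneg) auto
qed auto

lemma block_single_block:
  "block (single_block N f) n i j = (if n = N \<and> i < n \<and> j < n then f i j else 0)"
  by (simp add: single_block.rep_eq)

lemma norm_single_block: "norm (single_block N f) \<le> (\<Sum>i<N. \<Sum>j<N. norm (f i j))"
  unfolding norm_block_matrix_def
  by (rule block_norm_least) (simp_all add: single_block.rep_eq vnorm_single_block sum_nonneg)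

lemma tendsto_single_block:
  assumes "\<And>i j. i < N \<Longrightarrow> j < N \<Longrightarrow> (\<lambda>k. f k i j) \<longlonglongrightarrow> g i j"
  shows "(\<lambda>k. single_block N (f k)) \<longlonglongrightarrow> single_block N g"
proof (rule LIM_zero_cancel, rule Lim_null_comparison)
  have "single_block N (f k) - single_block N g = single_block N (\<lambda>i j. f k i j - g i j)" for k
    by (rule block_matrix_eqI) (simp add: block_simps block_single_block)
  thus "\<forall>\<^sub>F k in sequentially. norm (single_block N (f k) - single_block N g) \<le>
      (\<Sum>i<N. \<Sum>j<N. norm (f k i j - g i j))"
    using norm_single_block by (intro always_eventually allI) simp
  have "(\<lambda>k. \<Sum>i<N. \<Sum>j<N. norm (f k i j - g i j)) \<longlonglongrightarrow> (\<Sum>i<N. \<Sum>j<N. norm (g i j - g i j))"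
    by (intro tendsto_sum tendsto_norm tendsto_diff tendsto_const assms) auto
  thus "(\<lambda>k. \<Sum>i<N. \<Sum>j<N. norm (f k i j - g i j)) \<longlonglongrightarrow> 0" by simp
qed

lemma positive_single_block_gram:
  "is_positive (single_block n (\<lambda>i j. \<Sum>r\<in>R. star (z r i) * z r j))"
proof -
  have *: "is_positive (single_block n (\<lambda>i j. star (w i) * w j))" for w :: "nat \<Rightarrow> 'a"
  proof -
    \<comment> \<open>The row vector \<open>w\<close>, stored as row 0 of a square matrix.\<close>
    define Y where "Y = single_block n (\<lambda>i j. if i = 0 then w j else 0)"
    have "single_block n (\<lambda>i j. star (w i) * w j) = star Y * Y"
    proof (rule block_matrix_eqI)
      fix m i j :: nat assume ij: "i < m" "j < m"
      have "(\<Sum>k<m. star (block Y m k i) * block Y m k j) =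
          (\<Sum>k<m. if k = 0 then star (block Y m 0 i) * block Y m 0 j else 0)"
        by (rule sum.cong) (auto simp: Y_def block_single_block)
      thus "block (single_block n (\<lambda>i j. star (w i) * w j)) m i j = block (star Y * Y) m i j"
        using ij by (simp add: block_simps) (auto simp: Y_def block_single_block)
    qed
    thus ?thesis using positive_star_mult_self by metis
  qed
  have "single_block n (\<lambda>i j. \<Sum>r\<in>R. star (z r i) * z r j) =
      (\<Sum>r\<in>R. single_block n (\<lambda>i j. star (z r i) * z r j))"
    by (rule block_matrix_eqI) (simp add: block_sum block_single_block)
  thus ?thesis by (simp add: is_positive_sum *)
qed

lemma closed_subalgebra_block:
  assumes D: "closed_subalgebra D"
  shows "closed_subalgebra {X. \<forall>i<n. \<forall>j<n. block X n i j \<in> D}"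
  unfolding closed_subalgebra_def
proof (intro conjI ballI)
  have cl: "closed D" and su: "csubspace D" and 1: "1 \<in> D" and
    mu: "\<And>x y. x \<in> D \<Longrightarrow> y \<in> D \<Longrightarrow> x * y \<in> D"
    using D by (auto simp: closed_subalgebra_def)
  have "closed ((\<lambda>X. block X n i j) -` D)" for i j
    by (rule closed_vimage[OF cl linear_continuous_on[OF bounded_linear_block]])
  moreover have "{X. \<forall>i<n. \<forall>j<n. block X n i j \<in> D} = (\<Inter>i<n. \<Inter>j<n. (\<lambda>X. block X n i j) -` D)"
    by auto
  ultimately show "closed {X. \<forall>i<n. \<forall>j<n. block X n i j \<in> D}" by auto
  show "csubspace {X. \<forall>i<n. \<forall>j<n. block X n i j \<in> D}"
    using su by (auto simp: cvs.subspace_def block_simps)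
  show "1 \<in> {X. \<forall>i<n. \<forall>j<n. block X n i j \<in> D}"
    using 1 cvs.subspace_0[OF su] by (auto simp: block_1)
  show "X * Y \<in> {X. \<forall>i<n. \<forall>j<n. block X n i j \<in> D}"
    if "X \<in> {X. \<forall>i<n. \<forall>j<n. block X n i j \<in> D}" "Y \<in> {X. \<forall>i<n. \<forall>j<n. block X n i j \<in> D}" for X Y
    using that by (auto simp: block_simps intro!: cvs.subspace_sum[OF su] mu)
qed

text \<open>The square root of \<open>X\<close> is a limit of polynomials in \<open>X\<close>, so
  its block of size \<open>n\<close> keeps its entries in \<open>D\<close>. Thus positivity over the
  whole C*-algebra already yields a factorisation over \<open>D\<close>.\<close>

lemma positive_block_factor:
  assumes X: "is_positive X" and D: "closed_subalgebra D"
    and XD: "\<And>i j. i < n \<Longrightarrow> j < n \<Longrightarrow> block X n i j \<in> D"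
  obtains y where "\<And>i j. i < n \<Longrightarrow> j < n \<Longrightarrow> y i j \<in> D"
    "\<And>i j. block X n i j = (\<Sum>k<n. star (y k i) * y k j)"
proof -
  define t where "t = norm X + 1"
  have t: "norm X < t" "t > 0" using norm_ge_zero[of X] by (auto simp: t_def intro: add_nonneg_pos)
  define Y where "Y = psqrt t X"
  have "X = star Y * Y"
    unfolding Y_def by (simp add: positive_sqrt(1,2)[OF X t(1)])
  hence "block X n i j = (\<Sum>k<n. star (block Y n k i) * block Y n k j)" for i j
    by (simp add: block_simps)
  moreover have "Y \<in> {X. \<forall>i<n. \<forall>j<n. block X n i j \<in> D}"
    unfolding Y_def
    by (rule psqrt_in_closed_subalgebra[OF t(2) _ closed_subalgebra_block[OF D]])
      (use X t(1) XD in \<open>auto intro: positive_norm_le\<close>)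
  ultimately show ?thesis using that by blast
qed

section \<open>Slices of tensors\<close>

lemma clinear_add: "clinear f \<Longrightarrow> f (x + y) = f x + f y"
  and clinear_scaleC: "clinear f \<Longrightarrow> f (c *\<^sub>C x) = c *\<^sub>C f x"
  by (simp_all add: clinear_iff)

lemma clinear_0: "clinear f \<Longrightarrow> f 0 = 0"
  using clinear_scaleC[of f 0 0] by simp

lemma clinear_sum: "clinear f \<Longrightarrow> f (sum g I) = (\<Sum>i\<in>I. f (g i))"
  by (induction I rule: infinite_finite_induct)
    (simp_all add: clinear_0[of f] clinear_add[of f])

lemma clinear_diff: "clinear f \<Longrightarrow> f (x - y) = f x - f y"
  using clinear_add[of f "x - y" y] by simp

lemma clinear_functional_scaleC: "clinear f \<Longrightarrow> f (c *\<^sub>C x) = c * (f x :: complex)"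
  using clinear_scaleC[of f c x] by (simp add: scaleC_complex_def)

lemma clinear_functional_separates_subspace:
  assumes M: "csubspace M" and x: "x \<notin> M"
  obtains f :: "'a::complex_vector \<Rightarrow> complex" where "clinear f" "\<forall>y\<in>M. f y = 0" "f x = 1"
proof -
  interpret vector_space_pair "scaleC :: complex \<Rightarrow> 'a \<Rightarrow> 'a"
    "scaleC :: complex \<Rightarrow> complex \<Rightarrow> complex" ..
  obtain B where B: "B \<subseteq> M" "cvs.independent B" "M \<subseteq> cspan B"
    by (rule cvs.maximal_independent_subset)
  have span: "cspan B = M" using cvs.span_minimal[OF B(1) M] B(3) by (rule subset_antisym)
  have "cvs.independent (insert x B)"
    using x B(2) unfolding span[symmetric] by (rule cvs.independent_insertI)
  from linear_independent_extend[OF this, of "\<lambda>y. if y = x then 1 else 0"]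
  obtain f :: "'a \<Rightarrow> complex" where f: "clinear f" "\<forall>y\<in>insert x B. f y = (if y = x then 1 else 0)"
    by (elim exE conjE)
  have fB: "f y = 0" if "y \<in> B" for y
  proof -
    have "y \<noteq> x" using that B(1) x by blast
    thus ?thesis using f(2) that by simp
  qed
  show ?thesis
  proof (rule that[OF f(1)])
    show "f x = 1" using f(2) by simp
    show "\<forall>y\<in>M. f y = 0"
      using linear_eq_0_on_span[OF f(1) fB, of B] span by simp
  qed
qed

lemma clinear_functional_eqI:
  assumes "\<And>f :: 'a::complex_vector \<Rightarrow> complex. clinear f \<Longrightarrow> f x = f y"
  shows "x = y"
proof (rule ccontr)
  assume "x \<noteq> y"
  then obtain f :: "'a \<Rightarrow> complex" where "clinear f" "f (x - y) = 1"
    using clinear_functional_separates[of "x - y"] by auto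
  thus False using assms[of f] clinear_diff[of f x y] by simp
qed

text \<open>The map \<open>f \<otimes> id\<close>, with \<open>\<complex> \<otimes> V\<close>
  identified with \<open>V\<close>; likewise \<open>slice_right\<close> is
  \<open>id \<otimes> f\<close>.\<close>

definition slice_left ::
  "('a::complex_vector \<Rightarrow> complex) \<Rightarrow> ('a, 'b::complex_vector) tensor \<Rightarrow> 'b" where
  "slice_left f = tensor_lift (\<lambda>a b. f a *\<^sub>C b)"

definition slice_right ::
  "('b::complex_vector \<Rightarrow> complex) \<Rightarrow> ('a::complex_vector, 'b) tensor \<Rightarrow> 'a" where
  "slice_right f = tensor_lift (\<lambda>a b. f b *\<^sub>C a)"

lemma cbilinear_slices:
  assumes "clinear f"
  shows "cbilinear (\<lambda>a b. f a *\<^sub>C b)" "cbilinear (\<lambda>a b. f b *\<^sub>C a)"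
  by (simp_all add: cbilinear_iff clinear_add[OF assms] clinear_functional_scaleC[OF assms]
      scaleC_add_left scaleC_add_right scaleC_scaleC mult.commute)

lemma clinear_slice_left: "clinear f \<Longrightarrow> clinear (slice_left f)"
  and clinear_slice_right: "clinear f \<Longrightarrow> clinear (slice_right f)"
  unfolding slice_left_def slice_right_def
  by (rule clinear_tensor_lift, erule cbilinear_slices)+

lemma slice_left_tensor: "clinear f \<Longrightarrow> slice_left f (a \<otimes>\<^sub>t b) = f a *\<^sub>C b"
  unfolding slice_left_def
  by (rule tensor_lift_tensor, rule cbilinear_csemibilinear, erule cbilinear_slices)

lemma slice_right_tensor: "clinear f \<Longrightarrow> slice_right f (a \<otimes>\<^sub>t b) = f b *\<^sub>C a"
  unfolding slice_right_def
  by (rule tensor_lift_tensor, rule cbilinear_csemibilinear, erule cbilinear_slices)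

lemma slice_left_sum:
  "clinear f \<Longrightarrow> slice_left f (\<Sum>i\<in>I. a i \<otimes>\<^sub>t b i) = (\<Sum>i\<in>I. f (a i) *\<^sub>C b i)"
  by (simp only: clinear_sum[OF clinear_slice_left] slice_left_tensor)

lemma slice_right_sum:
  "clinear f \<Longrightarrow> slice_right f (\<Sum>i\<in>I. a i \<otimes>\<^sub>t b i) = (\<Sum>i\<in>I. f (b i) *\<^sub>C a i)"
  by (simp only: clinear_sum[OF clinear_slice_right] slice_right_tensor)

lemmas slice_simps =
  clinear_add[OF clinear_slice_left] clinear_add[OF clinear_slice_right]
  clinear_scaleC[OF clinear_slice_left] clinear_scaleC[OF clinear_slice_right]
  clinear_0[OF clinear_slice_left] clinear_0[OF clinear_slice_right]
  slice_left_tensor slice_right_tensor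

text \<open>Both sides are the value of \<open>f \<otimes> g\<close> at \<open>t\<close>.\<close>

lemma slices_commute:
  assumes "clinear f" "clinear g"
  shows "f (slice_right g t) = g (slice_left f t)"
  by (induction t rule: tensor_induct)
    (simp_all add: assms slice_simps assms[THEN clinear_0] assms[THEN clinear_add]
      assms[THEN clinear_functional_scaleC])

lemma tensor_0_left [simp]: "0 \<otimes>\<^sub>t b = 0" and tensor_0_right [simp]: "a \<otimes>\<^sub>t 0 = 0"
  using tensor_scale_left[of 0 0 b] tensor_scale_right[of a 0 0] by simp_all

lemma tensor_subspace_induct [consumes 1, case_names zero add]:
  assumes "t \<in> tensor_subspace V W" and "P 0"
    and "\<And>c v w t. v \<in> V \<Longrightarrow> w \<in> W \<Longrightarrow> P t \<Longrightarrow> P (c *\<^sub>C (v \<otimes>\<^sub>t w) + t)"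
  shows "P t"
  using assms(1) unfolding tensor_subspace_def
  by (induction rule: cvs.span_induct_alt) (use assms(2,3) in auto)

lemma slice_in_tensor_subspace:
  assumes "t \<in> tensor_subspace V W" "clinear f"
  shows "csubspace W \<Longrightarrow> slice_left f t \<in> W" "csubspace V \<Longrightarrow> slice_right f t \<in> V"
  using assms(1)
  by (induction rule: tensor_subspace_induct)
    (simp_all add: assms(2) slice_simps cvs.subspace_0 cvs.subspace_add cvs.subspace_scale)

lemma slice_cong:
  assumes "t \<in> tensor_subspace V W" "clinear f" "clinear g"
  shows "(\<And>v. v \<in> V \<Longrightarrow> f v = g v) \<Longrightarrow> slice_left f t = slice_left g t"
    "(\<And>w. w \<in> W \<Longrightarrow> f w = g w) \<Longrightarrow> slice_right f t = slice_right g t"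
  using assms(1)
  by (induction rule: tensor_subspace_induct) (simp_all add: assms(2,3) slice_simps)

lemma clinear_zero: "clinear (\<lambda>_. 0)"
  by (simp add: clinear_iff)

lemma slice_zero: "slice_left (\<lambda>_. 0) t = 0" "slice_right (\<lambda>_. 0) t = 0"
  by (induction t rule: tensor_induct) (simp_all add: slice_simps clinear_zero)

lemma csubspace_tensor_subspace: "csubspace (tensor_subspace V W)"
  unfolding tensor_subspace_def by (rule cvs.subspace_span)

lemma tensor_in_tensor_subspace: "v \<in> V \<Longrightarrow> w \<in> W \<Longrightarrow> v \<otimes>\<^sub>t w \<in> tensor_subspace V W"
  unfolding tensor_subspace_def by (rule cvs.span_base) blast

lemma tensor_subspace_mono: "V \<subseteq> V' \<Longrightarrow> W \<subseteq> W' \<Longrightarrow> tensor_subspace V W \<subseteq> tensor_subspace V' W'"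
  unfolding tensor_subspace_def by (rule cvs.span_mono) blast

lemma tensor_basis_expansion:
  fixes B :: "'b::complex_vector set" and t :: "('a::complex_vector, 'b) tensor"
  assumes B: "cvs.independent B" "cspan B = UNIV"
  obtains F where "finite F" "F \<subseteq> B"
    "t = (\<Sum>b\<in>F. slice_right (\<lambda>x. cvs.representation B x b) t \<otimes>\<^sub>t b)"
proof -
  define r where "r b = (\<lambda>x. cvs.representation B x b)" for b
  have r: "clinear (r b)" for b
    unfolding clinear_iff r_def using B
    by (simp add: cvs.representation_add cvs.representation_scale scaleC_complex_def)
  \<comment> \<open>Quantifying over all larger index sets \<open>G\<close> lets the expansions of
    two summands be added over a common one.\<close>
  have "\<exists>F. finite F \<and> F \<subseteq> B \<and> (\<forall>G. finite G \<longrightarrow> F \<subseteq> G \<longrightarrow> G \<subseteq> B \<longrightarrow> t = (\<Sum>b\<in>G. slice_right (r b) t \<otimes>\<^sub>t b))"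
  proof (induction t rule: tensor_induct)
    case zero
    show ?case by (intro exI[of _ "{}"]) (simp add: slice_simps r)
  next
    case (add x y t)
    then obtain F where F: "finite F" "F \<subseteq> B"
      "\<And>G. finite G \<Longrightarrow> F \<subseteq> G \<Longrightarrow> G \<subseteq> B \<Longrightarrow> t = (\<Sum>b\<in>G. slice_right (r b) t \<otimes>\<^sub>t b)" by blast
    define E where "E = {b. cvs.representation B y b \<noteq> 0}"
    have E: "finite E" "E \<subseteq> B"
      unfolding E_def by (auto simp: cvs.finite_representation cvs.representation_ne_zero)
    show ?case
    proof (intro exI[of _ "F \<union> E"] conjI allI impI)
      fix G assume G: "finite G" "F \<union> E \<subseteq> G" "G \<subseteq> B"
      have "y = (\<Sum>b\<in>E. r b y *\<^sub>C b)"
        using cvs.sum_nonzero_representation_eq[OF B(1), of y] B(2) by (simp add: E_def r_def)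
      also have "\<dots> = (\<Sum>b\<in>G. r b y *\<^sub>C b)"
        by (rule sum.mono_neutral_left) (use G in \<open>auto simp: E_def r_def\<close>)
      finally have y: "y = (\<Sum>b\<in>G. r b y *\<^sub>C b)" .
      have "x \<otimes>\<^sub>t y = (\<Sum>b\<in>G. x \<otimes>\<^sub>t (r b y *\<^sub>C b))"
      proof -
        have "clinear (\<lambda>y. x \<otimes>\<^sub>t y)" using cbilinear_tensor unfolding cbilinear_def by blast
        from clinear_sum[OF this, of "\<lambda>b. r b y *\<^sub>C b" G] y show ?thesis by simp
      qed
      moreover have "t = (\<Sum>b\<in>G. slice_right (r b) t \<otimes>\<^sub>t b)" using F(3) G by blast
      ultimately have "x \<otimes>\<^sub>t y + t = (\<Sum>b\<in>G. x \<otimes>\<^sub>t (r b y *\<^sub>C b)) + (\<Sum>b\<in>G. slice_right (r b) t \<otimes>\<^sub>t b)"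
        by (simp only:)
      also have "\<dots> = (\<Sum>b\<in>G. slice_right (r b) (x \<otimes>\<^sub>t y + t) \<otimes>\<^sub>t b)"
        by (simp add: slice_simps r tensor_add_left tensor_scale_left tensor_scale_right sum.distrib)
      finally show "x \<otimes>\<^sub>t y + t = (\<Sum>b\<in>G. slice_right (r b) (x \<otimes>\<^sub>t y + t) \<otimes>\<^sub>t b)" .
    qed (use F E in auto)
  qed
  then obtain F where F: "finite F" "F \<subseteq> B" "t = (\<Sum>b\<in>F. slice_right (r b) t \<otimes>\<^sub>t b)" by blast
  show ?thesis by (rule that[OF F(1,2)]) (use F(3) in \<open>simp add: r_def\<close>)
qed

text \<open>Expand the second leg along a basis extending a basis \<open>B0\<close> of
  \<open>D\<close>. The coefficients lie in \<open>D\<close> by \<open>right\<close>. At a basis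
  vector outside \<open>B0\<close> the coefficient vanishes: by \<open>slices_commute\<close>, every
  functional sends it to the coordinate there of an element of \<open>D\<close>.\<close>

lemma tensor_subspace_if_slices:
  fixes t :: "('a::complex_vector, 'a) tensor"
  assumes D: "csubspace D"
    and left: "\<And>f. clinear f \<Longrightarrow> slice_left f t \<in> D"
    and right: "\<And>f. clinear f \<Longrightarrow> slice_right f t \<in> D"
  shows "t \<in> tensor_subspace D D"
proof -
  obtain B0 where B0: "B0 \<subseteq> D" "cvs.independent B0" "D \<subseteq> cspan B0"
    by (rule cvs.maximal_independent_subset)
  have span: "cspan B0 = D" using cvs.span_minimal[OF B0(1) D] B0(3) by (rule subset_antisym)
  obtain B where B: "B0 \<subseteq> B" "B \<subseteq> UNIV" "cvs.independent B" "UNIV \<subseteq> cspan B"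
    by (rule cvs.maximal_independent_subset_extend[OF subset_UNIV B0(2)])
  have UN: "cspan B = UNIV" using B(4) by (rule top.extremum_uniqueI)
  define r where "r b = (\<lambda>x. cvs.representation B x b)" for b
  have r: "clinear (r b)" for b
    unfolding clinear_iff r_def using B(3) UN
    by (simp add: cvs.representation_add cvs.representation_scale scaleC_complex_def)
  obtain F where F: "finite F" "F \<subseteq> B" "t = (\<Sum>b\<in>F. slice_right (r b) t \<otimes>\<^sub>t b)"
    unfolding r_def by (rule tensor_basis_expansion[OF B(3) UN])
  have zero: "slice_right (r b) t = 0" if b: "b \<in> B" "b \<notin> B0" for b
  proof (rule clinear_functional_eqI)
    fix f :: "'a \<Rightarrow> complex" assume f: "clinear f"
    have "slice_left f t \<in> cspan B0" using left[OF f] span by simp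
    hence "r b (slice_left f t) = cvs.representation B0 (slice_left f t) b"
      unfolding r_def using cvs.representation_extend[OF B(3) _ B(1)] by simp
    also have "\<dots> = 0" using cvs.representation_ne_zero[of B0 "slice_left f t" b] b(2) by metis
    finally show "f (slice_right (r b) t) = f 0"
      by (simp add: slices_commute[OF f r] clinear_0[OF f])
  qed
  have "slice_right (r b) t \<otimes>\<^sub>t b \<in> tensor_subspace D D" if "b \<in> F" for b
  proof (cases "b \<in> B0")
    case True
    thus ?thesis using right[OF r] B0(1) by (intro tensor_in_tensor_subspace) auto
  next
    case False
    hence "slice_right (r b) t \<otimes>\<^sub>t b = 0" using zero[of b] F(2) that by auto
    thus ?thesis by (simp only: cvs.subspace_0[OF csubspace_tensor_subspace])
  qed
  hence "(\<Sum>b\<in>F. slice_right (r b) t \<otimes>\<^sub>t b) \<in> tensor_subspace D D"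
    by (intro cvs.subspace_sum[OF csubspace_tensor_subspace])
  thus ?thesis using F(3) by simp
qed

section \<open>Unitary comodules\<close>

lemma sum_lessThan_add:
  "(\<Sum>k<n + m. f k) = (\<Sum>k<n. f k) + (\<Sum>k<m. f (n + k :: nat) :: 'a::comm_monoid_add)"
  by (induction m) (simp_all add: add.assoc)

context cqg_algebra
begin

definition unitary_comod :: "nat \<Rightarrow> (nat \<Rightarrow> nat \<Rightarrow> 'a) \<Rightarrow> bool" where
  "unitary_comod n u \<longleftrightarrow> (\<forall>i<n. \<forall>j<n.
     \<Delta> (u i j) = (\<Sum>k<n. u i k \<otimes>\<^sub>t u k j) \<and> \<epsilon> (u i j) = (if i = j then 1 else 0) \<and>
     (\<Sum>k<n. star (u k i) * u k j) = (if i = j then 1 else 0) \<and>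
     (\<Sum>k<n. u i k * star (u j k)) = (if i = j then 1 else 0))"

lemma unitary_comodD:
  assumes "unitary_comod n u" "i < n" "j < n"
  shows "\<Delta> (u i j) = (\<Sum>k<n. u i k \<otimes>\<^sub>t u k j)" "\<epsilon> (u i j) = (if i = j then 1 else 0)"
    "(\<Sum>k<n. star (u k i) * u k j) = (if i = j then 1 else 0)"
    "(\<Sum>k<n. u i k * star (u j k)) = (if i = j then 1 else 0)"
  using assms unfolding unitary_comod_def by blast+

lemma comult_mult: "\<Delta> (x * y) = \<Delta> x * \<Delta> y" and comult_star: "\<Delta> (star x) = star (\<Delta> x)"
  using star_hom_comult unfolding star_hom_def by blast+

lemma counit_mult: "\<epsilon> (x * y) = \<epsilon> x * \<epsilon> y" and counit_star: "\<epsilon> (star x) = cnj (\<epsilon> x)"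
  and counit_1: "\<epsilon> 1 = 1"
  using star_hom_counit unfolding star_hom_def star_complex_def by blast+

lemma slice_counit: "slice_left \<epsilon> (\<Delta> x) = x" "slice_right \<epsilon> (\<Delta> x) = x"
  using counit_left counit_right by (simp_all add: slice_left_def slice_right_def)

lemma span_unitary_comod: "cspan {u i j | n u i j. unitary_comod n u \<and> i < n \<and> j < n} = UNIV"
proof -
  have "\<Union> {elements_mat u | n u. unitary_comodule_mat \<Delta> \<epsilon> n u}
      \<subseteq> {u i j | n u i j. unitary_comod n u \<and> i < n \<and> j < n}"
  proof
    fix x assume "x \<in> \<Union> {elements_mat u | n u. unitary_comodule_mat \<Delta> \<epsilon> n u}"
    then obtain n u where u: "unitary_comodule_mat \<Delta> \<epsilon> n u" and x: "x \<in> elements_mat u" by blast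
    have c: "u \<in> carrier_mat n n"
      and com: "\<And>i j. i < n \<Longrightarrow> j < n \<Longrightarrow> \<Delta> (u $$ (i, j)) = (\<Sum>k<n. u $$ (i, k) \<otimes>\<^sub>t u $$ (k, j)) \<and>
                  \<epsilon> (u $$ (i, j)) = (if i = j then 1 else 0)"
      and un: "mat_star u * u = 1\<^sub>m n" "u * mat_star u = 1\<^sub>m n"
      using u unfolding unitary_comodule_mat_def comodule_mat_def by blast+
    define w where "w i j = u $$ (i, j)" for i j
    have "unitary_comod n w"
      unfolding unitary_comod_def
    proof (intro allI impI conjI)
      fix i j assume ij: "i < n" "j < n"
      show "\<Delta> (w i j) = (\<Sum>k<n. w i k \<otimes>\<^sub>t w k j)" "\<epsilon> (w i j) = (if i = j then 1 else 0)"
        using com[OF ij] by (simp_all add: w_def)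
      have "(mat_star u * u) $$ (i, j) = (\<Sum>k<n. star (w k i) * w k j)"
        using c ij by (auto simp: mat_star_def scalar_prod_def w_def lessThan_atLeast0 intro!: sum.cong)
      thus "(\<Sum>k<n. star (w k i) * w k j) = (if i = j then 1 else 0)"
        using ij by (simp add: un)
      have "(u * mat_star u) $$ (i, j) = (\<Sum>k<n. w i k * star (w j k))"
        using c ij by (auto simp: mat_star_def scalar_prod_def w_def lessThan_atLeast0 intro!: sum.cong)
      thus "(\<Sum>k<n. w i k * star (w j k)) = (if i = j then 1 else 0)"
        using ij by (simp add: un)
    qed
    moreover obtain i j where "i < n" "j < n" "x = w i j"
      using x c unfolding elements_mat_def w_def by auto
    ultimately show "x \<in> {u i j | n u i j. unitary_comod n u \<and> i < n \<and> j < n}" by blast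
  qed
  from cvs.span_mono[OF this] show ?thesis
    using span_unitary_coefficients by blast
qed

section \<open>Direct sums and coefficient spaces\<close>

definition direct_sum ::
  "nat \<Rightarrow> (nat \<Rightarrow> nat \<Rightarrow> 'a) \<Rightarrow> (nat \<Rightarrow> nat \<Rightarrow> 'a) \<Rightarrow> nat \<Rightarrow> nat \<Rightarrow> 'a" where
  "direct_sum n u v i j =
     (if i < n \<and> j < n then u i j else if n \<le> i \<and> n \<le> j then v (i - n) (j - n) else 0)"

lemma direct_sum_simps:
  "i < n \<Longrightarrow> j < n \<Longrightarrow> direct_sum n u v i j = u i j"
  "direct_sum n u v (n + i) (n + j) = v i j"
  "i < n \<Longrightarrow> direct_sum n u v i (n + j) = 0"
  "j < n \<Longrightarrow> direct_sum n u v (n + i) j = 0"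
  by (simp_all add: direct_sum_def)

lemma unitary_comod_direct_sum:
  assumes u: "unitary_comod n u" and v: "unitary_comod m v"
  shows "unitary_comod (n + m) (direct_sum n u v)"
  unfolding unitary_comod_def
proof (intro allI impI)
  fix i j assume ij: "i < n + m" "j < n + m"
  have split: "k < n \<or> (\<exists>k'<m. k = n + k')" if "k < n + m" for k
    using that by (metis add_less_cancel_left le_add_diff_inverse not_le)
  note [simp] = sum_lessThan_add direct_sum_simps clinear_0[OF clinear_comult] clinear_0[OF clinear_counit]
    unitary_comodD[OF u] unitary_comodD[OF v]
  show "\<Delta> (direct_sum n u v i j) = (\<Sum>k<n + m. direct_sum n u v i k \<otimes>\<^sub>t direct_sum n u v k j) \<and>
      \<epsilon> (direct_sum n u v i j) = (if i = j then 1 else 0) \<and>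
      (\<Sum>k<n + m. star (direct_sum n u v k i) * direct_sum n u v k j) = (if i = j then 1 else 0) \<and>
      (\<Sum>k<n + m. direct_sum n u v i k * star (direct_sum n u v j k)) = (if i = j then 1 else 0)"
    using split[OF ij(1)] split[OF ij(2)] by (elim disjE exE conjE) simp_all
qed

text \<open>Direct sums merge coefficients of different comodules into one, with the vectors
  concatenated; mixed terms meet the zero blocks. Because the weights have rank one,
  \<open>star y * y\<close> leads to the rank one matrix \<open>cnj (a i) * a k\<close> in
  \<open>phi_positive\<close>.\<close>

lemma matrix_coefficient:
  obtains n u a b where "unitary_comod n u" "y = (\<Sum>i<n. \<Sum>j<n. (a i * b j) *\<^sub>C u i j)"
proof -
  have "y \<in> cspan {u i j | n u i j. unitary_comod n u \<and> i < n \<and> j < n}"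
    by (simp add: span_unitary_comod)
  hence "\<exists>n u a b. unitary_comod n u \<and> y = (\<Sum>i<n. \<Sum>j<n. (a i * b j) *\<^sub>C u i j)"
  proof (induction rule: cvs.span_induct_alt)
    case base
    show ?case by (rule exI[of _ 0]) (simp add: unitary_comod_def)
  next
    case (step c x y)
    from step(1) obtain n u i0 j0 where u: "unitary_comod n u" "i0 < n" "j0 < n" and x: "x = u i0 j0"
      by blast
    from step(2) obtain m v a b where v: "unitary_comod m v"
      and y: "y = (\<Sum>i<m. \<Sum>j<m. (a i * b j) *\<^sub>C v i j)" by (elim exE conjE)
    define a' where "a' i = (if i < n then (if i = i0 then c else 0) else a (i - n))" for i
    define b' where "b' i = (if i < n then (if i = j0 then 1 else 0) else b (i - n))" for i
    have "(\<Sum>i<n. \<Sum>j<n. (a' i * b' j) *\<^sub>C u i j) = (\<Sum>j<n. (a' i0 * b' j) *\<^sub>C u i0 j)"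
      by (rule sum_eq_single[of _ i0]) (use u(2) in \<open>auto simp: a'_def\<close>)
    also have "\<dots> = (a' i0 * b' j0) *\<^sub>C u i0 j0"
      by (rule sum_eq_single[of _ j0]) (use u(3) in \<open>auto simp: b'_def\<close>)
    also have "\<dots> = c *\<^sub>C x" using u by (simp add: a'_def b'_def x)
    finally have x': "(\<Sum>i<n. \<Sum>j<n. (a' i * b' j) *\<^sub>C u i j) = c *\<^sub>C x" .
    have ab: "a' (n + i) = a i" "b' (n + i) = b i" for i by (simp_all add: a'_def b'_def)
    have "(\<Sum>i<n + m. \<Sum>j<n + m. (a' i * b' j) *\<^sub>C direct_sum n u v i j) =
        (\<Sum>i<n. \<Sum>j<n. (a' i * b' j) *\<^sub>C u i j) + (\<Sum>i<m. \<Sum>j<m. (a i * b j) *\<^sub>C v i j)"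
      by (simp add: sum_lessThan_add direct_sum_simps ab)
    hence "c *\<^sub>C x + y = (\<Sum>i<n + m. \<Sum>j<n + m. (a' i * b' j) *\<^sub>C direct_sum n u v i j)"
      unfolding x' y[symmetric] by (rule sym)
    with unitary_comod_direct_sum[OF u(1) v] show ?case
      by (intro exI[of _ "n + m"] exI[of _ "direct_sum n u v"] exI[of _ a'] exI[of _ b'] conjI)
  qed
  thus ?thesis by (elim exE conjE) (rule that)
qed

definition coeffs :: "nat \<Rightarrow> (nat \<Rightarrow> nat \<Rightarrow> 'a) \<Rightarrow> 'a set" where
  "coeffs n u = cspan {u i j | i j. i < n \<and> j < n}"

lemma csubspace_coeffs: "csubspace (coeffs n u)"
  unfolding coeffs_def by (rule cvs.subspace_span)

lemma in_coeffs: "i < n \<Longrightarrow> j < n \<Longrightarrow> u i j \<in> coeffs n u"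
  unfolding coeffs_def by (rule cvs.span_base) blast

lemma common_unitary_comod:
  assumes "finite X"
  obtains n u where "unitary_comod n u" "X \<subseteq> coeffs n u"
proof -
  have "\<exists>n u. unitary_comod n u \<and> X \<subseteq> coeffs n u"
    using assms
  proof (induction X)
    case empty
    show ?case by (rule exI[of _ 0]) (simp add: unitary_comod_def)
  next
    case (insert x X)
    then obtain n u where u: "unitary_comod n u" "X \<subseteq> coeffs n u" by blast
    obtain m v a b where v: "unitary_comod m v" "x = (\<Sum>i<m. \<Sum>j<m. (a i * b j) *\<^sub>C v i j)"
      by (rule matrix_coefficient)
    define w where "w = direct_sum n u v"
    have "coeffs n u \<subseteq> coeffs (n + m) w"
      unfolding coeffs_def
    proof (rule cvs.span_mono, rule subsetI)
      fix y assume "y \<in> {u i j | i j. i < n \<and> j < n}"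
      then obtain i j where "i < n" "j < n" "y = u i j" by blast
      hence "i < n + m" "j < n + m" "y = w i j" by (simp_all add: w_def direct_sum_simps)
      thus "y \<in> {w i j | i j. i < n + m \<and> j < n + m}" by blast
    qed
    moreover have "v i j \<in> coeffs (n + m) w" if "i < m" "j < m" for i j
      using in_coeffs[of "n + i" "n + m" "n + j" w] that by (simp add: w_def direct_sum_simps)
    hence "x \<in> coeffs (n + m) w"
      unfolding v(2) by (intro cvs.subspace_sum cvs.subspace_scale csubspace_coeffs) auto
    ultimately show ?case
      using unitary_comod_direct_sum[OF u(1) v(1)] u(2) unfolding w_def by blast
  qed
  thus ?thesis using that by blast
qed

text \<open>By the antipode axiom \<open>S u\<close> is a left inverse of the matrix
  \<open>u\<close>, while the adjoint of \<open>u\<close> is a right inverse; so they agree.\<close>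

lemma antipode_entry:
  assumes u: "unitary_comod n u" and im: "i < n" "m < n"
  shows "S (u i m) = star (u m i)"
proof -
  have B: "cbilinear (\<lambda>a b. S a * b)"
    using clinear_antipode
    by (simp add: cbilinear_iff clinear_iff distrib_left distrib_right mult_scaleC_left mult_scaleC_right)
  have inv: "(\<Sum>k<n. S (u i k) * u k j) = (if i = j then 1 else 0)" if "j < n" for j
  proof -
    have "(\<Sum>k<n. S (u i k) * u k j) = tensor_lift (\<lambda>a b. S a * b) (\<Delta> (u i j))"
      unfolding unitary_comodD(1)[OF u im(1) that] clinear_sum[OF clinear_tensor_lift[OF B]]
        tensor_lift_tensor[OF cbilinear_csemibilinear[OF B]] ..
    also have "\<dots> = (if i = j then 1 else 0)"
      unfolding antipode_left unitary_comodD(2)[OF u im(1) that] by (simp add: scaleC_one)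
    finally show ?thesis .
  qed
  have "S (u i m) = (\<Sum>k<n. S (u i k) * (if k = m then 1 else 0))"
    by (subst sum_eq_single[of _ m]) (use im in auto)
  also have "\<dots> = (\<Sum>k<n. S (u i k) * (\<Sum>j<n. u k j * star (u m j)))"
    by (rule sum.cong) (use unitary_comodD(4)[OF u _ im(2)] in auto)
  also have "\<dots> = (\<Sum>k<n. \<Sum>j<n. S (u i k) * u k j * star (u m j))"
    by (simp add: sum_distrib_left mult.assoc)
  also have "\<dots> = (\<Sum>j<n. \<Sum>k<n. S (u i k) * u k j * star (u m j))"
    by (rule sum.swap)
  also have "\<dots> = (\<Sum>j<n. (if i = j then 1 else 0) * star (u m j))"
    by (rule sum.cong) (simp_all add: inv flip: sum_distrib_right)
  also have "\<dots> = star (u m i)"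
    by (subst sum_eq_single[of _ i]) (use im in auto)
  finally show ?thesis .
qed

text \<open>
  On the matrix coefficients of \<open>u\<close> this is \<open>f(u\<^sub>i\<^sub>j) \<mapsto> cnj (f(u\<^sub>j\<^sub>i))\<close>, the adjoint in the
  *-algebra of all matrices \<open>(f(u\<^sub>i\<^sub>j))\<close>.
\<close>

definition functional_adj :: "('a \<Rightarrow> complex) \<Rightarrow> 'a \<Rightarrow> complex" where
  "functional_adj f x = cnj (f (star (S x)))"

lemma clinear_functional_adj:
  assumes "clinear f"
  shows "clinear (functional_adj f)"
  unfolding clinear_iff functional_adj_def
  by (simp add: clinear_add[OF clinear_antipode] clinear_scaleC[OF clinear_antipode] star_add
      star_scaleC clinear_add[OF assms] clinear_functional_scaleC[OF assms] scaleC_complex_def)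

lemma functional_adj_entry:
  "unitary_comod n u \<Longrightarrow> i < n \<Longrightarrow> m < n \<Longrightarrow> functional_adj f (u i m) = cnj (f (u m i))"
  by (simp add: functional_adj_def antipode_entry star_star)

text \<open>
  The coefficient coalgebra of \<open>u\<close> is dual to the matrices \<open>(f(u\<^sub>i\<^sub>j))\<close>; the Hilbert-Schmidt inner
  product of these matrices identifies the two.
\<close>

definition dual_coeff :: "nat \<Rightarrow> (nat \<Rightarrow> nat \<Rightarrow> 'a) \<Rightarrow> ('a \<Rightarrow> complex) \<Rightarrow> 'a" where
  "dual_coeff n u f = (\<Sum>i<n. \<Sum>j<n. cnj (f (u i j)) *\<^sub>C u i j)"

lemma dual_coeff_in_coeffs: "dual_coeff n u f \<in> coeffs n u"
  unfolding dual_coeff_def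
  by (intro cvs.subspace_sum cvs.subspace_scale csubspace_coeffs in_coeffs) auto

text \<open>\<open>f (dual_coeff n u f)\<close> is the sum of the squares of the
  \<open>cmod (f (u i j))\<close>. This definiteness is what every complement argument on
  coefficient spaces rests on.\<close>

lemma dual_coeff_eq_0:
  assumes f: "clinear f" and 0: "f (dual_coeff n u f) = 0" and ij: "i < n" "j < n"
  shows "f (u i j) = 0"
proof -
  have "f (dual_coeff n u f) = (\<Sum>i<n. \<Sum>j<n. of_real ((cmod (f (u i j)))\<^sup>2))"
    unfolding dual_coeff_def clinear_sum[OF f] clinear_functional_scaleC[OF f]
    by (intro sum.cong refl) (subst complex_norm_square, rule mult.commute)
  also have "\<dots> = of_real (\<Sum>i<n. \<Sum>j<n. (cmod (f (u i j)))\<^sup>2)" by simp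
  finally have eq: "f (dual_coeff n u f) = of_real (\<Sum>i<n. \<Sum>j<n. (cmod (f (u i j)))\<^sup>2)" .
  have "(\<Sum>i<n. \<Sum>j<n. (cmod (f (u i j)))\<^sup>2) = 0"
    by (rule of_real_eq_0_iff[THEN iffD1]) (rule eq[symmetric, unfolded 0])
  hence "(\<Sum>j<n. (cmod (f (u i j)))\<^sup>2) = 0"
    using ij by (subst (asm) sum_nonneg_eq_0_iff) (auto intro: sum_nonneg)
  hence "(cmod (f (u i j)))\<^sup>2 = 0"
    using ij by (subst (asm) sum_nonneg_eq_0_iff) auto
  thus ?thesis by simp
qed

text \<open>For the Hilbert-Schmidt product of functionals, composing with the slice by
  \<open>g\<close> is adjoint to composing with the slice by \<open>functional_adj g\<close>. This
  lets annihilators inherit invariance under slices.\<close>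

lemma slice_left_dual_coeff:
  assumes u: "unitary_comod n u" and f: "clinear f" and g: "clinear g"
  shows "slice_left g (\<Delta> (dual_coeff n u f)) =
    dual_coeff n u (\<lambda>y. f (slice_left (functional_adj g) (\<Delta> y)))"
proof -
  have "slice_left g (\<Delta> (dual_coeff n u f)) =
      (\<Sum>k<n. \<Sum>l<n. cnj (f (u k l)) *\<^sub>C slice_left g (\<Delta> (u k l)))"
    unfolding dual_coeff_def
    by (simp add: clinear_sum[OF clinear_comult] clinear_scaleC[OF clinear_comult]
        clinear_sum[OF clinear_slice_left[OF g]] slice_simps g)
  also have "\<dots> = (\<Sum>k<n. \<Sum>l<n. \<Sum>m<n. (cnj (f (u k l)) * g (u k m)) *\<^sub>C u m l)"
    by (intro sum.cong refl)
      (simp add: unitary_comodD(1)[OF u] slice_left_sum[OF g] cvs.scale_sum_right scaleC_scaleC)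
  also have "\<dots> = (\<Sum>k<n. \<Sum>m<n. \<Sum>l<n. (cnj (f (u k l)) * g (u k m)) *\<^sub>C u m l)"
    by (intro sum.cong refl sum.swap)
  also have "\<dots> = (\<Sum>m<n. \<Sum>k<n. \<Sum>l<n. (cnj (f (u k l)) * g (u k m)) *\<^sub>C u m l)"
    by (rule sum.swap)
  also have "\<dots> = (\<Sum>m<n. \<Sum>l<n. \<Sum>k<n. (cnj (f (u k l)) * g (u k m)) *\<^sub>C u m l)"
    by (intro sum.cong refl sum.swap)
  also have "\<dots> = dual_coeff n u (\<lambda>y. f (slice_left (functional_adj g) (\<Delta> y)))"
    unfolding dual_coeff_def
    by (intro sum.cong refl)
      (simp add: unitary_comodD(1)[OF u] slice_left_sum[OF clinear_functional_adj[OF g]]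
        clinear_sum[OF f] clinear_functional_scaleC[OF f] functional_adj_entry[OF u]
        cvs.scale_sum_left mult.commute)
  finally show ?thesis .
qed

lemma slice_right_dual_coeff:
  assumes u: "unitary_comod n u" and f: "clinear f" and g: "clinear g"
  shows "slice_right g (\<Delta> (dual_coeff n u f)) =
    dual_coeff n u (\<lambda>y. f (slice_right (functional_adj g) (\<Delta> y)))"
proof -
  have "slice_right g (\<Delta> (dual_coeff n u f)) =
      (\<Sum>k<n. \<Sum>l<n. cnj (f (u k l)) *\<^sub>C slice_right g (\<Delta> (u k l)))"
    unfolding dual_coeff_def
    by (simp add: clinear_sum[OF clinear_comult] clinear_scaleC[OF clinear_comult]
        clinear_sum[OF clinear_slice_right[OF g]] slice_simps g)
  also have "\<dots> = (\<Sum>k<n. \<Sum>l<n. \<Sum>m<n. (cnj (f (u k l)) * g (u m l)) *\<^sub>C u k m)"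
    by (intro sum.cong refl)
      (simp add: unitary_comodD(1)[OF u] slice_right_sum[OF g] cvs.scale_sum_right scaleC_scaleC)
  also have "\<dots> = (\<Sum>k<n. \<Sum>m<n. \<Sum>l<n. (cnj (f (u k l)) * g (u m l)) *\<^sub>C u k m)"
    by (intro sum.cong refl sum.swap)
  also have "\<dots> = dual_coeff n u (\<lambda>y. f (slice_right (functional_adj g) (\<Delta> y)))"
    unfolding dual_coeff_def
    by (intro sum.cong refl)
      (simp add: unitary_comodD(1)[OF u] slice_right_sum[OF clinear_functional_adj[OF g]]
        clinear_sum[OF f] clinear_functional_scaleC[OF f] functional_adj_entry[OF u]
        cvs.scale_sum_left mult.commute)
  finally show ?thesis .
qed

lemma csubspace_dual_coeff:
  "csubspace {dual_coeff n u f | f. clinear f \<and> (\<forall>y\<in>M. f y = 0)}" (is "csubspace ?D")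
  unfolding cvs.subspace_def
proof (intro conjI ballI allI)
  have "0 = dual_coeff n u (\<lambda>_. 0)" by (simp add: dual_coeff_def)
  thus "0 \<in> ?D" using clinear_zero by blast
  fix x y c assume "x \<in> ?D" "y \<in> ?D"
  then obtain f g where fg: "clinear f" "clinear g" "x = dual_coeff n u f" "y = dual_coeff n u g"
    "\<forall>y\<in>M. f y = 0" "\<forall>y\<in>M. g y = 0" by blast
  have "x + y = dual_coeff n u (\<lambda>z. f z + g z)"
    by (simp add: fg dual_coeff_def scaleC_add_left sum.distrib)
  moreover have "clinear (\<lambda>z. f z + g z)"
    using fg(1,2) by (simp add: clinear_iff scaleC_add_right)
  moreover have "\<forall>y\<in>M. f y + g y = 0" using fg(5,6) by simp
  ultimately show "x + y \<in> ?D" by blast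
  have "c *\<^sub>C x = dual_coeff n u (\<lambda>z. cnj c * f z)"
    by (simp add: fg dual_coeff_def cvs.scale_sum_right scaleC_scaleC)
  moreover have "clinear (\<lambda>z. cnj c * f z)"
    using fg(1) by (simp add: clinear_iff distrib_left scaleC_complex_def)
  moreover have "\<forall>y\<in>M. cnj c * f y = 0" using fg(5) by simp
  ultimately show "c *\<^sub>C x \<in> ?D" by blast
qed

text \<open>Otherwise some functional \<open>f\<close> kills all dual coefficients but not some
  \<open>u i j\<close>. It then kills its own dual coefficient, which \<open>dual_coeff_eq_0\<close>
  excludes.\<close>

lemma coeff_eq_dual_coeff:
  assumes "x \<in> coeffs n u"
  obtains f where "clinear f" "x = dual_coeff n u f"
proof -
  \<comment> \<open>The empty set of conditions brings the full range under
    \<open>csubspace_dual_coeff\<close>.\<close>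
  define R where "R = {dual_coeff n u f | f. clinear f \<and> (\<forall>y\<in>{}. f y = 0)}"
  have R: "csubspace R" unfolding R_def by (rule csubspace_dual_coeff)
  have "u i j \<in> R" if ij: "i < n" "j < n" for i j
  proof (rule ccontr)
    assume "u i j \<notin> R"
    obtain f :: "'a \<Rightarrow> complex" where f: "clinear f" "\<forall>y\<in>R. f y = 0" "f (u i j) = 1"
      by (rule clinear_functional_separates_subspace[OF R \<open>u i j \<notin> R\<close>])
    have "dual_coeff n u f \<in> R" using f(1) by (auto simp: R_def)
    with f(2) have "f (dual_coeff n u f) = 0" by blast
    from dual_coeff_eq_0[OF f(1) this ij] f(3) show False by simp
  qed
  hence "{u i j | i j. i < n \<and> j < n} \<subseteq> R" by blast
  hence "coeffs n u \<subseteq> R" unfolding coeffs_def by (rule cvs.span_minimal[OF _ R])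
  thus ?thesis using assms that unfolding R_def by blast
qed


subsection \<open>Cosemisimplicity\<close>

lemma comodule_mat_star:
  assumes u: "unitary_comod n u" and ij: "i < n" "j < n"
  shows "\<Delta> (star (u i j)) = (\<Sum>k<n. star (u i k) \<otimes>\<^sub>t star (u k j))"
    "\<epsilon> (star (u i j)) = (if i = j then 1 else 0)"
  using unitary_comodD(1,2)[OF u ij]
  by (simp_all add: comult_star counit_star star_sum star_tensor_pure)

lemma subcoalgebraD: "subcoalgebra \<Delta> C \<Longrightarrow> csubspace C"
  "subcoalgebra \<Delta> C \<Longrightarrow> x \<in> C \<Longrightarrow> \<Delta> x \<in> tensor_subspace C C"
  by (simp_all add: subcoalgebra_def image_subset_iff)

lemma subcoalgebra_cspan_Union:
  assumes "\<And>C. C \<in> K \<Longrightarrow> subcoalgebra \<Delta> C"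
  shows "subcoalgebra \<Delta> (cspan (\<Union>K))"
  unfolding subcoalgebra_def
proof (intro conjI image_subsetI)
  fix x assume "x \<in> cspan (\<Union>K)"
  thus "\<Delta> x \<in> tensor_subspace (cspan (\<Union>K)) (cspan (\<Union>K))"
  proof (induction rule: cvs.span_induct_alt)
    case base
    show ?case
      by (simp only: clinear_0[OF clinear_comult] cvs.subspace_0[OF csubspace_tensor_subspace])
  next
    case (step c x y)
    then obtain C where C: "C \<in> K" "x \<in> C" by blast
    have "C \<subseteq> cspan (\<Union>K)" using C(1) cvs.span_superset[of "\<Union>K"] by blast
    hence "\<Delta> x \<in> tensor_subspace (cspan (\<Union>K)) (cspan (\<Union>K))"
      using subcoalgebraD(2)[OF assms[OF C(1)] C(2)] tensor_subspace_mono by blast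
    thus ?case
      by (simp only: clinear_add[OF clinear_comult] clinear_scaleC[OF clinear_comult])
        (intro cvs.subspace_add cvs.subspace_scale csubspace_tensor_subspace step.IH)
  qed
qed (rule cvs.subspace_span)

text \<open>The orthogonal complement of \<open>M\<close> in the coefficient coalgebra of
  \<open>u\<close>. By \<open>tensor_subspace_if_slices\<close> a subcoalgebra is recognised by
  invariance under slices, and \<open>M\<close> passes this invariance to its annihilator by
  adjointness.\<close>

lemma subcoalgebra_annihilator:
  assumes u: "unitary_comod n u" and M: "subcoalgebra \<Delta> M"
  shows "subcoalgebra \<Delta> {dual_coeff n u f | f. clinear f \<and> (\<forall>y\<in>M. f y = 0)}" (is "subcoalgebra \<Delta> ?D")
  unfolding subcoalgebra_def
proof (intro conjI image_subsetI)
  show D: "csubspace ?D" by (rule csubspace_dual_coeff)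
  fix x assume "x \<in> ?D"
  then obtain f where f: "clinear f" "\<forall>y\<in>M. f y = 0" and x: "x = dual_coeff n u f" by blast
  show "\<Delta> x \<in> tensor_subspace ?D ?D"
  proof (rule tensor_subspace_if_slices[OF D])
    fix g :: "'a \<Rightarrow> complex" assume g: "clinear g"
    note adj = clinear_functional_adj[OF g]
    have comp: "clinear (\<lambda>y. f (h (\<Delta> y)))" if "clinear h" for h
      unfolding clinear_iff
      by (simp add: clinear_add[OF clinear_comult] clinear_scaleC[OF clinear_comult]
          clinear_add[OF that] clinear_scaleC[OF that] clinear_add[OF f(1)] clinear_scaleC[OF f(1)])
    have "\<forall>y\<in>M. f (slice_left (functional_adj g) (\<Delta> y)) = 0"
      using f(2) slice_in_tensor_subspace(1)[OF subcoalgebraD(2)[OF M] adj subcoalgebraD(1)[OF M]] by blast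
    thus "slice_left g (\<Delta> x) \<in> ?D"
      unfolding x slice_left_dual_coeff[OF u f(1) g] using comp[OF clinear_slice_left[OF adj]] by blast
    have "\<forall>y\<in>M. f (slice_right (functional_adj g) (\<Delta> y)) = 0"
      using f(2) slice_in_tensor_subspace(2)[OF subcoalgebraD(2)[OF M] adj subcoalgebraD(1)[OF M]] by blast
    thus "slice_right g (\<Delta> x) \<in> ?D"
      unfolding x slice_right_dual_coeff[OF u f(1) g] using comp[OF clinear_slice_right[OF adj]] by blast
  qed
qed

text \<open>A nonzero subcoalgebra of least dimension inside \<open>D\<close> is simple. Dimension
  is the size of a basis, finite here because everything lies in the span of
  \<open>X\<close>.\<close>

lemma simple_subcoalgebra_exists:
  assumes D: "subcoalgebra \<Delta> D" "D \<noteq> {0}" and fin: "finite X" "D \<subseteq> cspan X"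
  obtains C where "simple_subcoalgebra \<Delta> C" "C \<subseteq> D"
proof -
  define Q where "Q B \<longleftrightarrow> cvs.independent B \<and> cspan B \<noteq> {0} \<and> cspan B \<subseteq> D \<and> subcoalgebra \<Delta> (cspan B)" for B
  have basis: "\<exists>B. cvs.independent B \<and> cspan B = E" if "csubspace E" for E :: "'a set"
  proof -
    obtain B where B: "B \<subseteq> E" "cvs.independent B" "E \<subseteq> cspan B"
      by (rule cvs.maximal_independent_subset)
    thus ?thesis using cvs.span_minimal[OF B(1) that] by blast
  qed
  obtain B0 where "Q B0" unfolding Q_def using basis[OF subcoalgebraD(1)[OF D(1)]] D by blast
  then obtain B where B: "Q B" and least: "\<And>B'. Q B' \<Longrightarrow> card B \<le> card B'"
    using exists_least_iff[of "\<lambda>k. \<exists>B. Q B \<and> card B = k"] by (metis not_le)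
  have finB: "finite B"
    using cvs.independent_span_bound[OF fin(1), of B] B fin(2) cvs.span_superset[of B]
    unfolding Q_def by blast
  have "simple_subcoalgebra \<Delta> (cspan B)"
    unfolding simple_subcoalgebra_def
  proof (intro conjI allI impI)
    fix E assume E: "subcoalgebra \<Delta> E \<and> E \<subseteq> cspan B"
    show "E = {0} \<or> E = cspan B"
    proof (rule ccontr)
      assume contra: "\<not> (E = {0} \<or> E = cspan B)"
      obtain B' where B': "cvs.independent B'" "cspan B' = E"
        using basis[OF subcoalgebraD(1)] E by blast
      have "Q B'" using B B' E contra unfolding Q_def by blast
      hence le: "card B \<le> card B'" by (rule least)
      obtain x where x: "x \<in> cspan B" "x \<notin> cspan B'" using contra E B'(2) by blast
      have sub: "insert x B' \<subseteq> cspan B"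
        using x(1) B'(2) E cvs.span_superset[of B'] by blast
      have "cvs.independent (insert x B')" by (rule cvs.independent_insertI[OF x(2) B'(1)])
      hence "finite (insert x B') \<and> card (insert x B') \<le> card B"
        by (rule cvs.independent_span_bound[OF finB _ sub])
      moreover have "x \<notin> B'" using x(2) cvs.span_superset[of B'] by blast
      ultimately have "Suc (card B') \<le> card B" by (metis card_insert_disjoint finite_insert)
      thus False using le by simp
    qed
  qed (use B in \<open>auto simp: Q_def\<close>)
  moreover have "cspan B \<subseteq> D" using B unfolding Q_def by blast
  ultimately show ?thesis by (rule that)
qed

text \<open>Cosemisimplicity. Were some \<open>u i j\<close> outside \<open>M\<close>, the
  complement of \<open>M\<close> in the coefficients of \<open>u\<close> would contain a simple
  subcoalgebra, which also lies in \<open>M\<close>. But an element \<open>dual_coeff n u g\<close>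
  of the complement that belongs to \<open>M\<close> is killed by \<open>g\<close>, hence is
  0.\<close>

lemma subcoalgebra_eq_UNIV:
  assumes M: "subcoalgebra \<Delta> M" and simple: "\<And>C. simple_subcoalgebra \<Delta> C \<Longrightarrow> C \<subseteq> M"
  shows "M = UNIV"
proof -
  have "u i j \<in> M" if u: "unitary_comod n u" and ij: "i < n" "j < n" for n u i j
  proof (rule ccontr)
    assume "u i j \<notin> M"
    obtain f :: "'a \<Rightarrow> complex" where f: "clinear f" "\<forall>y\<in>M. f y = 0" "f (u i j) = 1"
      by (rule clinear_functional_separates_subspace[OF subcoalgebraD(1)[OF M] \<open>u i j \<notin> M\<close>])
    define D where "D = {dual_coeff n u f | f. clinear f \<and> (\<forall>y\<in>M. f y = 0)}"
    have "dual_coeff n u f \<noteq> 0"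
    proof
      assume "dual_coeff n u f = 0"
      hence "f (dual_coeff n u f) = 0" using clinear_0[OF f(1)] by simp
      from dual_coeff_eq_0[OF f(1) this ij] f(3) show False by simp
    qed
    moreover have "dual_coeff n u f \<in> D" unfolding D_def using f(1,2) by blast
    ultimately have D0: "D \<noteq> {0}" by blast
    have D: "subcoalgebra \<Delta> D" unfolding D_def by (rule subcoalgebra_annihilator[OF u M])
    have "finite {u i j | i j. i < n \<and> j < n}"
      by (rule finite_subset[of _ "(\<lambda>(i, j). u i j) ` ({..<n} \<times> {..<n})"]) auto
    moreover have "D \<subseteq> coeffs n u"
      unfolding D_def using dual_coeff_in_coeffs by blast
    hence "D \<subseteq> cspan {u i j | i j. i < n \<and> j < n}" by (simp only: coeffs_def)
    ultimately obtain C where C: "simple_subcoalgebra \<Delta> C" "C \<subseteq> D"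
      by (rule simple_subcoalgebra_exists[OF D D0])
    have "C \<subseteq> {0}"
    proof
      fix x assume x: "x \<in> C"
      then obtain g where g: "clinear g" "\<forall>y\<in>M. g y = 0" "x = dual_coeff n u g"
        using C(2) unfolding D_def by blast
      have "x \<in> M" using simple[OF C(1)] x by blast
      hence "g (dual_coeff n u g) = 0" using g(2) unfolding g(3) by blast
      from dual_coeff_eq_0[OF g(1) this] show "x \<in> {0}" by (simp add: g(3) dual_coeff_def)
    qed
    moreover have "0 \<in> C"
      using C(1) by (auto simp: simple_subcoalgebra_def subcoalgebra_def intro: cvs.subspace_0)
    ultimately have "C = {0}" by blast
    thus False using C(1) by (simp add: simple_subcoalgebra_def)
  qed
  hence "cspan {u i j | n u i j. unitary_comod n u \<and> i < n \<and> j < n} \<subseteq> M"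
    by (intro cvs.span_minimal[OF _ subcoalgebraD(1)[OF M]]) blast
  thus ?thesis unfolding span_unitary_comod by (rule top.extremum_uniqueI)
qed

section \<open>The involution on subcoalgebras\<close>

lemma star_tensor_subspace:
  "t \<in> tensor_subspace V W \<Longrightarrow> star t \<in> tensor_subspace (star ` V) (star ` W :: 'a set)"
proof (induction rule: tensor_subspace_induct)
  case zero
  show ?case by (simp add: cvs.subspace_0[OF csubspace_tensor_subspace])
next
  case (add c v w t)
  show ?case
    unfolding star_add star_scaleC star_tensor_pure
    by (intro cvs.subspace_add cvs.subspace_scale csubspace_tensor_subspace add.IH
        tensor_in_tensor_subspace imageI add.hyps)
qed

lemma star_image_star_image: "star ` star ` C = (C :: 'a set)"
  by (simp add: image_image star_star)

lemma subcoalgebra_star: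
  assumes C: "subcoalgebra \<Delta> C"
  shows "subcoalgebra \<Delta> (star ` C)"
  unfolding subcoalgebra_def
proof (intro conjI image_subsetI)
  note sub = subcoalgebraD(1)[OF C]
  show "csubspace (star ` C)"
    unfolding cvs.subspace_def
  proof (intro conjI ballI allI)
    show "0 \<in> star ` C" using cvs.subspace_0[OF sub] star_0 by (metis imageI)
    fix x y c assume "x \<in> star ` C" "y \<in> star ` C"
    then obtain a b where ab: "a \<in> C" "b \<in> C" "x = star a" "y = star b" by blast
    have "x + y = star (a + b)" "c *\<^sub>C x = star (cnj c *\<^sub>C a)"
      by (simp_all add: ab star_add star_scaleC)
    thus "x + y \<in> star ` C" "c *\<^sub>C x \<in> star ` C"
      using cvs.subspace_add[OF sub ab(1,2)] cvs.subspace_scale[OF sub ab(1)] by blast+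
  qed
  fix y assume "y \<in> star ` C"
  then obtain x where x: "x \<in> C" and y: "y = star x" by blast
  show "\<Delta> y \<in> tensor_subspace (star ` C) (star ` C)"
    unfolding y comult_star by (rule star_tensor_subspace[OF subcoalgebraD(2)[OF C x]])
qed

text \<open>The involution is an inclusion-preserving bijection on subcoalgebras. This will make
  \<open>A'\<close> stable under \<open>star\<close>, so that \<open>p\<close> commutes with
  \<open>star\<close>.\<close>

lemma simple_subcoalgebra_star:
  assumes C: "simple_subcoalgebra \<Delta> C"
  shows "simple_subcoalgebra \<Delta> (star ` C)"
  unfolding simple_subcoalgebra_def
proof (intro conjI allI impI)
  have C': "subcoalgebra \<Delta> C" "C \<noteq> {0}" and min: "\<And>D. subcoalgebra \<Delta> D \<Longrightarrow> D \<subseteq> C \<Longrightarrow> D = {0} \<or> D = C"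
    using C unfolding simple_subcoalgebra_def by blast+
  show "subcoalgebra \<Delta> (star ` C)" by (rule subcoalgebra_star[OF C'(1)])
  show "star ` C \<noteq> {0}"
  proof
    assume "star ` C = {0}"
    hence "star ` star ` C = star ` {0}" by (rule arg_cong)
    thus False using C'(2) by (simp add: star_image_star_image)
  qed
  fix D assume D: "subcoalgebra \<Delta> D \<and> D \<subseteq> star ` C"
  have "star ` D \<subseteq> C" using D image_mono[of D "star ` C" star] by (simp only: star_image_star_image)
  with min[OF subcoalgebra_star] D have "star ` D = {0} \<or> star ` D = C" by blast
  thus "D = {0} \<or> D = star ` C"
  proof
    assume "star ` D = {0}"
    hence "star ` star ` D = star ` {0}" by (rule arg_cong)
    thus ?thesis by (simp add: star_image_star_image)
  next
    assume "star ` D = C"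
    hence "star ` star ` D = star ` C" by (rule arg_cong)
    thus ?thesis by (simp only: star_image_star_image) simp
  qed
qed

end

section \<open>The expectation\<close>

lemma clinear_comp: "clinear f \<Longrightarrow> clinear g \<Longrightarrow> clinear (\<lambda>x. f (g x))"
  by (simp add: clinear_iff)

locale cqg_expectation = cqg_algebra \<Delta> \<epsilon> S
  for \<Delta> :: "'a::complex_star_algebra \<Rightarrow> ('a, 'a) tensor" and \<epsilon> :: "'a \<Rightarrow> complex" and S :: "'a \<Rightarrow> 'a" +
  fixes A :: "'a set" and p :: "'a \<Rightarrow> 'a"
  assumes cqg_subalgebra: "cqg_subalgebra \<Delta> S A" and is_expectation: "is_expectation \<Delta> A p"
begin

lemma subcoalgebra_A: "subcoalgebra \<Delta> A" and one_in_A: "1 \<in> A"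
  and mult_in_A: "x \<in> A \<Longrightarrow> y \<in> A \<Longrightarrow> x * y \<in> A"
  and star_in_A: "x \<in> A \<Longrightarrow> star x \<in> A"
  and antipode_in_A: "x \<in> A \<Longrightarrow> S x \<in> A"
  using cqg_subalgebra by (simp_all add: cqg_subalgebra_def image_subset_iff)

lemmas csubspace_A = subcoalgebraD(1)[OF subcoalgebra_A]

lemma clinear_p: "clinear p" and p_in_A: "p x \<in> A" and p_A: "x \<in> A \<Longrightarrow> p x = x"
  using is_expectation by (simp_all add: is_expectation_def image_subset_iff)

definition A' :: "'a set" where
  "A' = cspan (\<Union> {C. simple_subcoalgebra \<Delta> C \<and> \<not> C \<subseteq> A})"

lemma csubspace_A': "csubspace A'"
  unfolding A'_def by (rule cvs.subspace_span)

lemma subcoalgebra_A': "subcoalgebra \<Delta> A'"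
  unfolding A'_def by (rule subcoalgebra_cspan_Union) (simp add: simple_subcoalgebra_def)

lemma p_A': "x \<in> A' \<Longrightarrow> p x = 0"
  unfolding A'_def
proof (induction rule: cvs.span_induct_alt)
  case base
  show ?case by (rule clinear_0[OF clinear_p])
next
  case (step c x y)
  from step(1) obtain C where "simple_subcoalgebra \<Delta> C \<and> \<not> C \<subseteq> A" "x \<in> C" by auto
  hence "p x = 0" using is_expectation by (simp add: is_expectation_def)
  thus ?case using step by (simp add: clinear_add[OF clinear_p] clinear_scaleC[OF clinear_p])
qed

lemma A_inter_A': "x \<in> A \<Longrightarrow> x \<in> A' \<Longrightarrow> x = 0"
  using p_A p_A' by metis

text \<open>The sum of \<open>A\<close> and \<open>A'\<close> is a subcoalgebra containing every
  simple one, hence everything by cosemisimplicity.\<close>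

lemma decomposition:
  obtains a b where "a \<in> A" "b \<in> A'" "x = a + b"
proof -
  define K where "K = {C. simple_subcoalgebra \<Delta> C \<and> \<not> C \<subseteq> A}"
  have "cspan (\<Union>(insert A K)) = UNIV"
  proof (rule subcoalgebra_eq_UNIV)
    show "subcoalgebra \<Delta> (cspan (\<Union>(insert A K)))"
      by (rule subcoalgebra_cspan_Union)
        (auto simp: K_def simple_subcoalgebra_def subcoalgebra_A)
    show "C \<subseteq> cspan (\<Union>(insert A K))" if "simple_subcoalgebra \<Delta> C" for C
    proof -
      have "C \<subseteq> \<Union>(insert A K)" using that by (cases "C \<subseteq> A") (auto simp: K_def)
      thus ?thesis using cvs.span_superset by (rule subset_trans)
    qed
  qed
  moreover have "\<Union>(insert A K) = A \<union> \<Union>K" by blast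
  ultimately have "x \<in> cspan (A \<union> \<Union>K)" by simp
  hence "x \<in> {a + b | a b. a \<in> cspan A \<and> b \<in> cspan (\<Union>K)}" by (simp only: cvs.span_Un)
  then obtain a b where ab: "a \<in> cspan A" "b \<in> cspan (\<Union>K)" "x = a + b" by blast
  have "a \<in> A" using ab(1) unfolding iffD2[OF cvs.span_eq_iff csubspace_A] .
  moreover have "b \<in> A'" using ab(2) by (simp only: A'_def K_def)
  ultimately show ?thesis using ab(3) by (rule that)
qed

definition phi :: "'a \<Rightarrow> complex" where
  "phi x = \<epsilon> (p x)"

lemma clinear_phi: "clinear phi"
  unfolding phi_def by (rule clinear_comp[OF clinear_counit clinear_p])

lemma phi_A: "x \<in> A \<Longrightarrow> phi x = \<epsilon> x" and phi_A': "x \<in> A' \<Longrightarrow> phi x = 0"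
  and phi_p: "phi (p x) = phi x"
  by (simp_all add: phi_def p_A p_A' p_in_A clinear_0[OF clinear_counit])

lemma phi_1: "phi 1 = 1"
  by (simp add: phi_A one_in_A counit_1)

text \<open>Since \<open>\<Delta>\<close> maps \<open>A\<close> and \<open>A'\<close> into their own
  tensor squares, slicing by \<open>phi\<close> is slicing by the counit on \<open>A\<close> and by
  0 on \<open>A'\<close>. The left slice serves for coactions, the right one for Gram
  matrices.\<close>

lemma p_slice: "slice_left phi (\<Delta> x) = p x" "slice_right phi (\<Delta> x) = p x"
proof -
  obtain a b where ab: "a \<in> A" "b \<in> A'" "x = a + b" by (rule decomposition)
  have a: "slice_left phi (\<Delta> a) = a" "slice_right phi (\<Delta> a) = a"
    using slice_cong[OF subcoalgebraD(2)[OF subcoalgebra_A ab(1)] clinear_phi clinear_counit] phi_A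
    by (simp_all add: slice_counit)
  have b: "slice_left phi (\<Delta> b) = 0" "slice_right phi (\<Delta> b) = 0"
    using slice_cong[OF subcoalgebraD(2)[OF subcoalgebra_A' ab(2)] clinear_phi clinear_zero] phi_A'
    by (simp_all add: slice_zero)
  show "slice_left phi (\<Delta> x) = p x" "slice_right phi (\<Delta> x) = p x"
    by (simp_all add: ab(3) clinear_add[OF clinear_comult] clinear_add[OF clinear_p]
        slice_simps clinear_phi a b p_A[OF ab(1)] p_A'[OF ab(2)])
qed

lemma star_in_A': "x \<in> A' \<Longrightarrow> star x \<in> A'"
  unfolding A'_def
proof (induction rule: cvs.span_induct_alt)
  case base
  show ?case by (simp add: cvs.span_zero)
next
  case (step c x y)
  then obtain C where C: "simple_subcoalgebra \<Delta> C" "\<not> C \<subseteq> A" "x \<in> C" by blast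
  have "\<not> star ` C \<subseteq> A"
  proof
    assume "star ` C \<subseteq> A"
    hence "star ` star ` C \<subseteq> A" using star_in_A by blast
    thus False using C(2) by (simp only: star_image_star_image)
  qed
  hence "star x \<in> \<Union> {C. simple_subcoalgebra \<Delta> C \<and> \<not> C \<subseteq> A}"
    using simple_subcoalgebra_star[OF C(1)] C(3) by blast
  from cvs.span_add[OF cvs.span_scale[OF cvs.span_base[OF this]] step(2)]
  show ?case by (simp only: star_add star_scaleC)
qed

lemma p_star: "p (star x) = star (p x)"
proof -
  obtain a b where ab: "a \<in> A" "b \<in> A'" "x = a + b" by (rule decomposition)
  show ?thesis
    by (simp add: ab(3) star_add clinear_add[OF clinear_p] p_A p_A' ab(1,2) star_in_A star_in_A')
qed

lemma phi_star: "phi (star x) = cnj (phi x)"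
  by (simp add: phi_def p_star counit_star)

lemma p_entry:
  assumes u: "unitary_comod n u" and ij: "i < n" "j < n"
  shows "p (u i j) = (\<Sum>k<n. phi (u i k) *\<^sub>C u k j)" "p (u i j) = (\<Sum>k<n. phi (u k j) *\<^sub>C u i k)"
  using p_slice[of "u i j"]
  by (simp_all add: unitary_comodD(1)[OF u ij] slice_left_sum slice_right_sum clinear_phi)

text \<open>\<open>phi\<close> is idempotent for convolution because composing it with
  \<open>p\<close> does not change it.\<close>

lemma phi_idempotent:
  assumes u: "unitary_comod n u" and ij: "i < n" "j < n"
  shows "(\<Sum>k<n. phi (u i k) * phi (u k j)) = phi (u i j)"
proof -
  have "phi (u i j) = phi (\<Sum>k<n. phi (u i k) *\<^sub>C u k j)"
    unfolding p_entry(1)[OF u ij, symmetric] by (rule phi_p[symmetric])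
  thus ?thesis
    by (simp add: clinear_sum[OF clinear_phi] clinear_functional_scaleC[OF clinear_phi])
qed

lemma slice_left_mult:
  "slice_left phi (t * (x \<otimes>\<^sub>t y)) = slice_left (\<lambda>a. phi (a * x)) t * y"
proof -
  have lin: "clinear (\<lambda>a. phi (a * x))"
    by (simp add: clinear_iff distrib_right mult_scaleC_left clinear_add[OF clinear_phi]
        clinear_scaleC[OF clinear_phi])
  show ?thesis
    by (induction t rule: tensor_induct)
      (simp_all add: slice_simps clinear_phi lin distrib_right times_tensor_pure mult_scaleC_left)
qed

text \<open>
  For fixed \<open>i\<close>, \<open>j\<close> and with \<open>t = p(u)\<close>, the element \<open>\<Sum>k. p (c t\<^sub>i\<^sub>k) S(t\<^sub>k\<^sub>j)\<close> belongs to \<open>A\<close> because its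
  factors do, and to \<open>A'\<close> because it is a slice of \<open>\<Delta> c\<close>. Hence it vanishes, and multiplying by
  \<open>t\<^sub>j\<^sub>l\<close> undoes the antipode.
\<close>

lemma p_mult_A'_entry:
  assumes u: "unitary_comod n u" and c: "c \<in> A'" and il: "i < n" "l < n"
  shows "p (c * p (u i l)) = 0"
proof -
  \<comment> \<open>\<open>P\<close> is an idempotent matrix with \<open>t = P u = u P\<close>, so
    the identity \<open>t S(t) = S(t) t = P\<close> takes the place of invertibility.\<close>
  define P where "P a b = phi (u a b)" for a b
  define t where "t a b = p (u a b)" for a b
  have t1: "t a b = (\<Sum>r<n. P a r *\<^sub>C u r b)" and t2: "t a b = (\<Sum>r<n. P r b *\<^sub>C u a r)"
    if "a < n" "b < n" for a b
    unfolding t_def P_def using p_entry[OF u that] by simp_all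
  have PP: "(\<Sum>k<n. P a k * P k b) = P a b" if "a < n" "b < n" for a b
    unfolding P_def by (rule phi_idempotent[OF u that])
  have St1: "S (t k j) = (\<Sum>s<n. P k s *\<^sub>C star (u j s))" and St2: "S (t k j) = (\<Sum>s<n. P s j *\<^sub>C star (u s k))"
    if "k < n" "j < n" for k j
  proof -
    show "S (t k j) = (\<Sum>s<n. P k s *\<^sub>C star (u j s))"
      unfolding t1[OF that] clinear_sum[OF clinear_antipode] clinear_scaleC[OF clinear_antipode]
      by (rule sum.cong) (use that antipode_entry[OF u] in auto)
    show "S (t k j) = (\<Sum>s<n. P s j *\<^sub>C star (u s k))"
      unfolding t2[OF that] clinear_sum[OF clinear_antipode] clinear_scaleC[OF clinear_antipode]
      by (rule sum.cong) (use that antipode_entry[OF u] in auto)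
  qed
  have collapse: "(\<Sum>k<n. (\<Sum>r<n. x r *\<^sub>C f r k) * (\<Sum>s<n. y s *\<^sub>C g s k)) = (\<Sum>r<n. x r * y r) *\<^sub>C 1"
    if fg: "\<And>r s. r < n \<Longrightarrow> s < n \<Longrightarrow> (\<Sum>k<n. f r k * g s k) = (if r = s then 1 else 0)"
    for x y :: "nat \<Rightarrow> complex" and f g :: "nat \<Rightarrow> nat \<Rightarrow> 'a"
  proof -
    have "(\<Sum>k<n. (\<Sum>r<n. x r *\<^sub>C f r k) * (\<Sum>s<n. y s *\<^sub>C g s k)) =
        (\<Sum>k<n. \<Sum>r<n. \<Sum>s<n. (y s * x r) *\<^sub>C (f r k * g s k))"
      by (simp add: sum_product mult_scaleC_left mult_scaleC_right scaleC_scaleC)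
    also have "\<dots> = (\<Sum>r<n. \<Sum>k<n. \<Sum>s<n. (y s * x r) *\<^sub>C (f r k * g s k))" by (rule sum.swap)
    also have "\<dots> = (\<Sum>r<n. \<Sum>s<n. \<Sum>k<n. (y s * x r) *\<^sub>C (f r k * g s k))"
      by (intro sum.cong refl sum.swap)
    also have "\<dots> = (\<Sum>r<n. \<Sum>s<n. (y s * x r) *\<^sub>C (if r = s then 1 else 0))"
      by (intro sum.cong refl) (simp add: fg flip: cvs.scale_sum_right)
    also have "\<dots> = (\<Sum>r<n. (x r * y r) *\<^sub>C 1)"
      by (intro sum.cong refl, subst sum_eq_single) (auto simp: mult.commute)
    also have "\<dots> = (\<Sum>r<n. x r * y r) *\<^sub>C 1" by (simp only: cvs.scale_sum_left)
    finally show ?thesis .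
  qed
  have tS: "(\<Sum>k<n. t m k * S (t k j)) = P m j *\<^sub>C 1" if mj: "m < n" "j < n" for m j
  proof -
    have "(\<Sum>k<n. t m k * S (t k j)) =
        (\<Sum>k<n. (\<Sum>r<n. P m r *\<^sub>C u r k) * (\<Sum>s<n. P s j *\<^sub>C star (u s k)))"
      by (intro sum.cong refl arg_cong2[of _ _ _ _ "(*)"] t1 St2) (use mj in auto)
    also have "\<dots> = (\<Sum>r<n. P m r * P r j) *\<^sub>C 1"
      by (rule collapse) (rule unitary_comodD(4)[OF u])
    finally show ?thesis by (simp add: PP mj)
  qed
  have St: "(\<Sum>j<n. S (t k j) * t j m) = P k m *\<^sub>C 1" if km: "k < n" "m < n" for k m
  proof -
    have "(\<Sum>j<n. S (t k j) * t j m) =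
        (\<Sum>j<n. (\<Sum>s<n. P k s *\<^sub>C star (u j s)) * (\<Sum>r<n. P r m *\<^sub>C u j r))"
      by (intro sum.cong refl arg_cong2[of _ _ _ _ "(*)"] t2 St1) (use km in auto)
    also have "\<dots> = (\<Sum>r<n. P k r * P r m) *\<^sub>C 1"
      by (rule collapse) (rule unitary_comodD(3)[OF u])
    finally show ?thesis by (simp add: PP km)
  qed
  have comult_t: "\<Delta> (t i k) = (\<Sum>m<n. u i m \<otimes>\<^sub>t t m k)" if k: "k < n" for k
  proof -
    have "\<Delta> (t i k) = (\<Sum>s<n. P s k *\<^sub>C (\<Sum>m<n. u i m \<otimes>\<^sub>t u m s))"
      unfolding t2[OF il(1) k] clinear_sum[OF clinear_comult] clinear_scaleC[OF clinear_comult]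
      by (rule sum.cong) (use unitary_comodD(1)[OF u il(1)] in auto)
    also have "\<dots> = (\<Sum>s<n. \<Sum>m<n. u i m \<otimes>\<^sub>t (P s k *\<^sub>C u m s))"
      by (simp add: cvs.scale_sum_right tensor_scale_right)
    also have "\<dots> = (\<Sum>m<n. \<Sum>s<n. u i m \<otimes>\<^sub>t (P s k *\<^sub>C u m s))" by (rule sum.swap)
    also have "\<dots> = (\<Sum>m<n. u i m \<otimes>\<^sub>t t m k)"
    proof (rule sum.cong)
      fix m assume "m \<in> {..<n}"
      hence m: "m < n" by simp
      have lin: "clinear (\<lambda>y. u i m \<otimes>\<^sub>t y)"
        using cbilinear_tensor unfolding cbilinear_def by blast
      show "(\<Sum>s<n. u i m \<otimes>\<^sub>t (P s k *\<^sub>C u m s)) = u i m \<otimes>\<^sub>t t m k"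
        unfolding t2[OF m k] by (rule clinear_sum[OF lin, symmetric])
    qed simp
    finally show ?thesis .
  qed
  define c' where "c' m = slice_left (\<lambda>a. phi (a * u i m)) (\<Delta> c)" for m
  have c'A: "c' m \<in> A'" for m
    unfolding c'_def
  proof (rule slice_in_tensor_subspace(1)[OF subcoalgebraD(2)[OF subcoalgebra_A' c] _ csubspace_A'])
    show "clinear (\<lambda>a. phi (a * u i m))"
      by (simp add: clinear_iff distrib_right mult_scaleC_left clinear_add[OF clinear_phi]
          clinear_scaleC[OF clinear_phi])
  qed
  have pc: "p (c * t i k) = (\<Sum>m<n. c' m * t m k)" if k: "k < n" for k
  proof -
    have "p (c * t i k) = slice_left phi (\<Delta> (c * t i k))" by (rule p_slice(1)[symmetric])
    also have "\<dots> = slice_left phi (\<Sum>m<n. \<Delta> c * (u i m \<otimes>\<^sub>t t m k))"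
      by (simp only: comult_mult comult_t[OF k] sum_distrib_left)
    also have "\<dots> = (\<Sum>m<n. c' m * t m k)"
      by (simp only: clinear_sum[OF clinear_slice_left[OF clinear_phi]] slice_left_mult c'_def)
    finally show ?thesis .
  qed
  have zero: "(\<Sum>k<n. p (c * t i k) * S (t k j)) = 0" if j: "j < n" for j
  proof (rule A_inter_A')
    show "(\<Sum>k<n. p (c * t i k) * S (t k j)) \<in> A"
      by (intro cvs.subspace_sum csubspace_A mult_in_A antipode_in_A p_in_A) (simp add: t_def p_in_A)
    have "(\<Sum>k<n. p (c * t i k) * S (t k j)) = (\<Sum>k<n. \<Sum>m<n. c' m * (t m k * S (t k j)))"
      by (rule sum.cong) (auto simp: pc sum_distrib_right mult.assoc)
    also have "\<dots> = (\<Sum>m<n. \<Sum>k<n. c' m * (t m k * S (t k j)))" by (rule sum.swap)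
    also have "\<dots> = (\<Sum>m<n. P m j *\<^sub>C c' m)"
      by (rule sum.cong) (auto simp: tS j mult_scaleC_right simp flip: sum_distrib_left)
    also have "\<dots> \<in> A'" by (intro cvs.subspace_sum cvs.subspace_scale csubspace_A' c'A)
    finally show "(\<Sum>k<n. p (c * t i k) * S (t k j)) \<in> A'" .
  qed
  \<comment> \<open>\<open>S(t) t\<close> is \<open>P\<close> and not the identity matrix, so
    cancelling the antipode needs \<open>t = t P\<close>.\<close>
  have "t i l = (\<Sum>k<n. P k l *\<^sub>C t i k)"
  proof -
    have "(\<Sum>k<n. P k l *\<^sub>C t i k) = (\<Sum>k<n. \<Sum>s<n. (P s k * P k l) *\<^sub>C u i s)"
      by (rule sum.cong) (use il in \<open>auto simp: t2 cvs.scale_sum_right scaleC_scaleC mult.commute\<close>)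
    also have "\<dots> = (\<Sum>s<n. \<Sum>k<n. (P s k * P k l) *\<^sub>C u i s)" by (rule sum.swap)
    also have "\<dots> = (\<Sum>s<n. P s l *\<^sub>C u i s)"
      by (rule sum.cong) (use il in \<open>auto simp: PP simp flip: cvs.scale_sum_left\<close>)
    finally show ?thesis using t2[OF il] by simp
  qed
  hence "p (c * t i l) = (\<Sum>k<n. p (c * t i k) * (P k l *\<^sub>C 1))"
    by (simp add: sum_distrib_left mult_scaleC_right clinear_sum[OF clinear_p] clinear_scaleC[OF clinear_p])
  also have "\<dots> = (\<Sum>k<n. \<Sum>j<n. p (c * t i k) * S (t k j) * t j l)"
    by (rule sum.cong) (use il St in \<open>auto simp: mult.assoc simp flip: sum_distrib_left\<close>)
  also have "\<dots> = (\<Sum>j<n. \<Sum>k<n. p (c * t i k) * S (t k j) * t j l)" by (rule sum.swap)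
  also have "\<dots> = 0"
    by (rule sum.neutral) (use zero in \<open>auto simp flip: sum_distrib_right\<close>)
  finally show ?thesis by (simp add: t_def)
qed

lemma p_mult_right:
  assumes a: "a \<in> A"
  shows "p (x * a) = p x * a"
proof -
  obtain y c where yc: "y \<in> A" "c \<in> A'" "x = y + c" by (rule decomposition)
  obtain n u f g where u: "unitary_comod n u" "a = (\<Sum>i<n. \<Sum>j<n. (f i * g j) *\<^sub>C u i j)"
    by (rule matrix_coefficient)
  \<comment> \<open>Replacing \<open>a\<close> by \<open>p a\<close> expresses it through the
    entries \<open>p (u i j)\<close>, whose products with \<open>c\<close> are covered by
    \<open>p_mult_A'_entry\<close>.\<close>
  have "a = p a" using p_A[OF a] by simp
  also have "\<dots> = (\<Sum>i<n. \<Sum>j<n. (f i * g j) *\<^sub>C p (u i j))"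
    unfolding u(2) by (simp add: clinear_sum[OF clinear_p] clinear_scaleC[OF clinear_p])
  finally have "p (c * a) = (\<Sum>i<n. \<Sum>j<n. (f i * g j) *\<^sub>C p (c * p (u i j)))"
    by (simp add: sum_distrib_left mult_scaleC_right clinear_sum[OF clinear_p] clinear_scaleC[OF clinear_p])
  also have "\<dots> = 0" by (intro sum.neutral ballI) (simp add: p_mult_A'_entry[OF u(1) yc(2)])
  finally have "p (c * a) = 0" .
  thus ?thesis
    by (simp add: yc(3) distrib_right clinear_add[OF clinear_p] p_A p_A' yc(1,2) a mult_in_A)
qed

lemma p_mult_left:
  assumes a: "a \<in> A"
  shows "p (a * x) = a * p x"
proof -
  have "star (p (a * x)) = p (star x * star a)" by (simp add: star_mult flip: p_star)
  also have "\<dots> = star (a * p x)"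
    by (simp only: p_mult_right[OF star_in_A[OF a]] p_star star_mult)
  finally show ?thesis by (metis star_star)
qed

lemma phi_mult_left: "a \<in> A \<Longrightarrow> phi (a * x) = \<epsilon> a * phi x"
  and phi_mult_right: "a \<in> A \<Longrightarrow> phi (x * a) = phi x * \<epsilon> a"
  by (simp_all add: phi_def p_mult_left p_mult_right counit_mult)

end

section \<open>Positivity of the expectation composed with the counit\<close>

context cqg_algebra
begin

text \<open>
  Writing \<open>w\<^sub>i\<^sub>j = \<Sum>k l. c\<^sub>i\<^sub>j\<^sub>k\<^sub>l v\<^sub>k\<^sub>l\<close> with the coefficients provided by \<open>dual_coeff\<close>
  makes \<open>c\<close> an intertwiner \<open>w c = c v\<close> (the coefficients are orthogonal to all relations between
  the \<open>v\<^sub>k\<^sub>l\<close>); hence \<open>w (c c\<^sup>*) w\<^sup>* = c c\<^sup>*\<close>, that is, \<open>w\<close> is unitarizable.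
\<close>

lemma comodule_invariant_form:
  assumes comult: "\<And>i j. i < N \<Longrightarrow> j < N \<Longrightarrow> \<Delta> (w i j) = (\<Sum>k<N. w i k \<otimes>\<^sub>t w k j)"
    and counit: "\<And>i j. i < N \<Longrightarrow> j < N \<Longrightarrow> \<epsilon> (w i j) = (if i = j then 1 else 0)"
  obtains K and c :: "nat \<Rightarrow> nat \<times> nat \<times> nat \<Rightarrow> complex" where "finite K"
    "\<And>i k. i < N \<Longrightarrow> k < N \<Longrightarrow>
      (\<Sum>j<N. \<Sum>l<N. (\<Sum>t\<in>K. c j t * cnj (c l t)) *\<^sub>C (w i j * star (w k l))) =
      (\<Sum>t\<in>K. c i t * cnj (c k t)) *\<^sub>C 1"
    "\<And>x i. (\<And>t. t \<in> K \<Longrightarrow> (\<Sum>k<N. cnj (c k t) * x k) = 0) \<Longrightarrow> i < N \<Longrightarrow> x i = 0"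
proof -
  have "finite ((\<lambda>(i, j). w i j) ` ({..<N} \<times> {..<N}))" by simp
  then obtain M v where v: "unitary_comod M v"
    and wv: "(\<lambda>(i, j). w i j) ` ({..<N} \<times> {..<N}) \<subseteq> coeffs M v"
    by (rule common_unitary_comod)
  have "\<exists>f. clinear f \<and> w i j = dual_coeff M v f" if "i < N" "j < N" for i j
  proof -
    have "w i j \<in> coeffs M v" using wv that by auto
    thus ?thesis by (rule coeff_eq_dual_coeff) blast
  qed
  then obtain f where f: "\<And>i j. i < N \<Longrightarrow> j < N \<Longrightarrow> clinear (f i j)"
    "\<And>i j. i < N \<Longrightarrow> j < N \<Longrightarrow> w i j = dual_coeff M v (f i j)" by metis
  define d where "d i j k l = cnj (f i j (v k l))" for i j k l
  have w: "w i j = (\<Sum>k<M. \<Sum>l<M. d i j k l *\<^sub>C v k l)" if "i < N" "j < N" for i j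
    using f(2)[OF that] by (simp add: dual_coeff_def d_def)
  have intertwine: "(\<Sum>s<N. d s j m l *\<^sub>C w i s) = (\<Sum>k<M. d i j k l *\<^sub>C v k m)"
    if ij: "i < N" "j < N" and ml: "m < M" "l < M" for i j m l
  proof (rule clinear_functional_eqI)
    fix g :: "'a \<Rightarrow> complex" assume g: "clinear g"
    \<comment> \<open>Tested on \<open>g\<close>, the relation says up to conjugation that
      \<open>h\<close> vanishes at \<open>v m l\<close>. The two parts of
      \<open>dual_coeff M v h\<close> are both the slice of \<open>\<Delta> (w i j)\<close> by
      \<open>g\<close>, so they cancel, and definiteness makes \<open>h\<close> vanish on the
      coefficients of \<open>v\<close>.\<close>
    define h where "h y = (\<Sum>s<N. cnj (g (w i s)) * f s j y) -
        f i j (slice_left (functional_adj g) (\<Delta> y))" for y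
    have h: "clinear h"
      unfolding clinear_iff h_def scaleC_complex_def
      by (simp add: clinear_add[OF f(1)] clinear_functional_scaleC[OF f(1)] ij sum.distrib
          slice_simps clinear_functional_adj[OF g] clinear_add[OF clinear_comult]
          clinear_scaleC[OF clinear_comult] sum_distrib_left right_diff_distrib algebra_simps)
    have "dual_coeff M v h = (\<Sum>s<N. g (w i s) *\<^sub>C w s j) -
        dual_coeff M v (\<lambda>y. f i j (slice_left (functional_adj g) (\<Delta> y)))"
    proof -
      have "dual_coeff M v h = (\<Sum>a<M. \<Sum>b<M. \<Sum>s<N. (g (w i s) * d s j a b) *\<^sub>C v a b) -
          dual_coeff M v (\<lambda>y. f i j (slice_left (functional_adj g) (\<Delta> y)))"
        by (simp add: dual_coeff_def h_def d_def cvs.scale_left_diff_distrib sum_subtractf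
            cvs.scale_sum_left)
      also have "(\<Sum>a<M. \<Sum>b<M. \<Sum>s<N. (g (w i s) * d s j a b) *\<^sub>C v a b) =
          (\<Sum>a<M. \<Sum>s<N. \<Sum>b<M. (g (w i s) * d s j a b) *\<^sub>C v a b)"
        by (intro sum.cong refl sum.swap)
      also have "\<dots> = (\<Sum>s<N. \<Sum>a<M. \<Sum>b<M. (g (w i s) * d s j a b) *\<^sub>C v a b)" by (rule sum.swap)
      also have "\<dots> = (\<Sum>s<N. g (w i s) *\<^sub>C w s j)"
        by (rule sum.cong) (use w ij in \<open>auto simp: cvs.scale_sum_right scaleC_scaleC\<close>)
      finally show ?thesis .
    qed
    also have "(\<Sum>s<N. g (w i s) *\<^sub>C w s j) = slice_left g (\<Delta> (w i j))"
      by (simp only: comult[OF ij] slice_left_sum[OF g])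
    also have "\<dots> = dual_coeff M v (\<lambda>y. f i j (slice_left (functional_adj g) (\<Delta> y)))"
      unfolding f(2)[OF ij] by (rule slice_left_dual_coeff[OF v f(1)[OF ij] g])
    finally have "dual_coeff M v h = 0" by simp
    hence "h (dual_coeff M v h) = 0" using clinear_0[OF h] by simp
    from dual_coeff_eq_0[OF h this ml]
    have "(\<Sum>s<N. cnj (g (w i s)) * f s j (v m l)) =
        f i j (slice_left (functional_adj g) (\<Delta> (v m l)))" by (simp add: h_def)
    also have "\<dots> = (\<Sum>k<M. cnj (g (v k m)) * f i j (v k l))"
      unfolding unitary_comodD(1)[OF v ml] slice_left_sum[OF clinear_functional_adj[OF g]]
        clinear_sum[OF f(1)[OF ij]] clinear_functional_scaleC[OF f(1)[OF ij]]
      by (rule sum.cong) (use functional_adj_entry[OF v] ml in auto)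
    finally have "cnj (\<Sum>s<N. cnj (g (w i s)) * f s j (v m l)) = cnj (\<Sum>k<M. cnj (g (v k m)) * f i j (v k l))"
      by (rule arg_cong)
    thus "g (\<Sum>s<N. d s j m l *\<^sub>C w i s) = g (\<Sum>k<M. d i j k l *\<^sub>C v k m)"
      by (simp add: clinear_sum[OF g] clinear_functional_scaleC[OF g] d_def mult.commute)
  qed
  define K where "K = {..<N} \<times> {..<M} \<times> {..<M}"
  \<comment> \<open>Row \<open>i\<close> and column \<open>(j, k, l)\<close> hold the coefficient of
    \<open>v k l\<close> in \<open>w i j\<close>. All columns \<open>j\<close> of \<open>w\<close>
    are taken together so that the adjoint of \<open>c\<close> has no kernel.\<close>
  define c where "c i t = (case t of (j, k, l) \<Rightarrow> d i j k l)" for i t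
  have sum_K: "(\<Sum>t\<in>K. F t) = (\<Sum>j<N. \<Sum>k<M. \<Sum>l<M. F (j, k, l))" for F :: "_ \<Rightarrow> 'z::comm_monoid_add"
    by (simp add: K_def sum.cartesian_product)
  show ?thesis
  proof (rule that)
    show "finite K" by (simp add: K_def)
    fix i k assume ik: "i < N" "k < N"
    have "(\<Sum>j<N. \<Sum>l<N. (\<Sum>t\<in>K. c j t * cnj (c l t)) *\<^sub>C (w i j * star (w k l))) =
        (\<Sum>j<N. \<Sum>l<N. \<Sum>t\<in>K. (c j t *\<^sub>C w i j) * star (c l t *\<^sub>C w k l))"
      by (simp add: star_scaleC mult_scaleC_left mult_scaleC_right scaleC_scaleC cvs.scale_sum_left mult.commute)
    also have "\<dots> = (\<Sum>j<N. \<Sum>t\<in>K. \<Sum>l<N. (c j t *\<^sub>C w i j) * star (c l t *\<^sub>C w k l))"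
      by (intro sum.cong refl sum.swap)
    also have "\<dots> = (\<Sum>t\<in>K. \<Sum>j<N. \<Sum>l<N. (c j t *\<^sub>C w i j) * star (c l t *\<^sub>C w k l))"
      by (rule sum.swap)
    also have "\<dots> = (\<Sum>t\<in>K. (\<Sum>j<N. c j t *\<^sub>C w i j) * star (\<Sum>l<N. c l t *\<^sub>C w k l))"
      by (simp only: star_sum sum_product)
    also have "\<dots> = (\<Sum>j<N. \<Sum>m<M. \<Sum>l<M. (\<Sum>a<M. d i j a l *\<^sub>C v a m) * star (\<Sum>b<M. d k j b l *\<^sub>C v b m))"
      unfolding sum_K c_def prod.case
      by (intro sum.cong refl arg_cong2[of _ _ _ _ "(*)"] arg_cong[of _ _ star] intertwine) (use ik in auto)
    also have "\<dots> = (\<Sum>j<N. \<Sum>l<M. \<Sum>m<M. (\<Sum>a<M. d i j a l *\<^sub>C v a m) * star (\<Sum>b<M. d k j b l *\<^sub>C v b m))"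
      by (intro sum.cong refl sum.swap)
    also have "\<dots> = (\<Sum>j<N. \<Sum>l<M. (\<Sum>a<M. d i j a l * cnj (d k j a l)) *\<^sub>C 1)"
    proof (intro sum.cong refl)
      fix j l
      have "(\<Sum>m<M. (\<Sum>a<M. d i j a l *\<^sub>C v a m) * star (\<Sum>b<M. d k j b l *\<^sub>C v b m)) =
          (\<Sum>m<M. \<Sum>a<M. \<Sum>b<M. (d i j a l * cnj (d k j b l)) *\<^sub>C (v a m * star (v b m)))"
        by (simp add: star_sum star_scaleC sum_product mult_scaleC_left mult_scaleC_right scaleC_scaleC mult.commute)
      also have "\<dots> = (\<Sum>a<M. \<Sum>m<M. \<Sum>b<M. (d i j a l * cnj (d k j b l)) *\<^sub>C (v a m * star (v b m)))"
        by (rule sum.swap)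
      also have "\<dots> = (\<Sum>a<M. \<Sum>b<M. \<Sum>m<M. (d i j a l * cnj (d k j b l)) *\<^sub>C (v a m * star (v b m)))"
        by (intro sum.cong refl sum.swap)
      also have "\<dots> = (\<Sum>a<M. \<Sum>b<M. (d i j a l * cnj (d k j b l)) *\<^sub>C (if a = b then 1 else 0))"
        by (intro sum.cong refl) (simp add: unitary_comodD(4)[OF v] flip: cvs.scale_sum_right)
      also have "\<dots> = (\<Sum>a<M. (d i j a l * cnj (d k j a l)) *\<^sub>C 1)"
        by (intro sum.cong refl, subst sum_eq_single) auto
      finally show "(\<Sum>m<M. (\<Sum>a<M. d i j a l *\<^sub>C v a m) * star (\<Sum>b<M. d k j b l *\<^sub>C v b m)) =
          (\<Sum>a<M. d i j a l * cnj (d k j a l)) *\<^sub>C 1" by (simp only: cvs.scale_sum_left)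
    qed
    also have "\<dots> = (\<Sum>j<N. \<Sum>l<M. \<Sum>a<M. d i j a l * cnj (d k j a l)) *\<^sub>C 1"
      by (simp only: cvs.scale_sum_left)
    also have "(\<Sum>j<N. \<Sum>l<M. \<Sum>a<M. d i j a l * cnj (d k j a l)) =
        (\<Sum>j<N. \<Sum>a<M. \<Sum>l<M. d i j a l * cnj (d k j a l))"
      by (intro sum.cong refl sum.swap)
    also have "\<dots> = (\<Sum>t\<in>K. c i t * cnj (c k t))"
      by (simp only: sum_K c_def prod.case)
    finally show "(\<Sum>j<N. \<Sum>l<N. (\<Sum>t\<in>K. c j t * cnj (c l t)) *\<^sub>C (w i j * star (w k l))) =
        (\<Sum>t\<in>K. c i t * cnj (c k t)) *\<^sub>C 1" .
  next
    fix x :: "nat \<Rightarrow> complex" and i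
    assume zero: "\<And>t. t \<in> K \<Longrightarrow> (\<Sum>k<N. cnj (c k t) * x k) = 0" and i: "i < N"
    \<comment> \<open>If the adjoint of \<open>c\<close> kills \<open>x\<close>, the combination of
      the \<open>w k i\<close> with weights \<open>cnj (x k)\<close> is 0; the counit, which sends
      \<open>w\<close> to the identity matrix, then reads off \<open>x i\<close>.\<close>
    have "(\<Sum>k<N. cnj (x k) *\<^sub>C w k i) = (\<Sum>k<N. \<Sum>a<M. \<Sum>b<M. (cnj (x k) * d k i a b) *\<^sub>C v a b)"
      by (rule sum.cong) (use w i in \<open>auto simp: cvs.scale_sum_right scaleC_scaleC\<close>)
    also have "\<dots> = (\<Sum>a<M. \<Sum>k<N. \<Sum>b<M. (cnj (x k) * d k i a b) *\<^sub>C v a b)" by (rule sum.swap)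
    also have "\<dots> = (\<Sum>a<M. \<Sum>b<M. \<Sum>k<N. (cnj (x k) * d k i a b) *\<^sub>C v a b)"
      by (intro sum.cong refl sum.swap)
    also have "\<dots> = 0"
    proof (rule sum.neutral, rule ballI, rule sum.neutral, rule ballI)
      fix a b assume ab: "a \<in> {..<M}" "b \<in> {..<M}"
      have "(\<Sum>k<N. cnj (c k (i, a, b)) * x k) = 0" by (rule zero) (use i ab in \<open>auto simp: K_def\<close>)
      hence "cnj (\<Sum>k<N. cnj (c k (i, a, b)) * x k) = 0" by simp
      hence "(\<Sum>k<N. cnj (x k) * d k i a b) = 0" by (simp add: c_def mult.commute)
      thus "(\<Sum>k<N. (cnj (x k) * d k i a b) *\<^sub>C v a b) = 0" by (simp flip: cvs.scale_sum_left)
    qed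
    finally have "\<epsilon> (\<Sum>k<N. cnj (x k) *\<^sub>C w k i) = 0" by (simp add: clinear_0[OF clinear_counit])
    hence "(\<Sum>k<N. cnj (x k) * \<epsilon> (w k i)) = 0"
      by (simp add: clinear_sum[OF clinear_counit] clinear_functional_scaleC[OF clinear_counit])
    moreover have "(\<Sum>k<N. cnj (x k) * \<epsilon> (w k i)) = cnj (x i) * \<epsilon> (w i i)"
      by (rule sum_eq_single) (use i counit in auto)
    ultimately show "x i = 0" using counit i by simp
  qed
qed

end

lemma sum_swap4:
  "(\<Sum>i\<in>I. \<Sum>k\<in>K. \<Sum>r\<in>R. \<Sum>s\<in>T. g i k r s) = (\<Sum>r\<in>R. \<Sum>s\<in>T. \<Sum>i\<in>I. \<Sum>k\<in>K. g i k r s)"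
proof -
  have "(\<Sum>i\<in>I. \<Sum>k\<in>K. \<Sum>r\<in>R. \<Sum>s\<in>T. g i k r s) = (\<Sum>i\<in>I. \<Sum>r\<in>R. \<Sum>k\<in>K. \<Sum>s\<in>T. g i k r s)"
    by (intro sum.cong refl sum.swap)
  also have "\<dots> = (\<Sum>r\<in>R. \<Sum>i\<in>I. \<Sum>k\<in>K. \<Sum>s\<in>T. g i k r s)" by (rule sum.swap)
  also have "\<dots> = (\<Sum>r\<in>R. \<Sum>i\<in>I. \<Sum>s\<in>T. \<Sum>k\<in>K. g i k r s)"
    by (intro sum.cong refl sum.swap)
  also have "\<dots> = (\<Sum>r\<in>R. \<Sum>s\<in>T. \<Sum>i\<in>I. \<Sum>k\<in>K. g i k r s)"
    by (intro sum.cong refl sum.swap)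
  finally show ?thesis .
qed

text \<open>Entry \<open>(j, l)\<close> of \<open>star u (m \<otimes> 1) u\<close>, the adjoint
  coaction on \<open>N\<close> by \<open>N\<close> matrices.\<close>

definition adj_coaction ::
  "nat \<Rightarrow> (nat \<Rightarrow> nat \<Rightarrow> 'a::complex_star_algebra) \<Rightarrow> (nat \<Rightarrow> nat \<Rightarrow> complex) \<Rightarrow> nat \<Rightarrow> nat \<Rightarrow> 'a" where
  "adj_coaction N u m j l = (\<Sum>i<N. \<Sum>k<N. m i k *\<^sub>C (star (u i j) * u k l))"

lemma adj_coaction_cong:
  "(\<And>i k. i < N \<Longrightarrow> k < N \<Longrightarrow> m i k = m' i k) \<Longrightarrow> adj_coaction N u m = adj_coaction N u m'"
  by (simp add: adj_coaction_def fun_eq_iff)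

lemma star_adj_coaction:
  "star (adj_coaction N u m l j) = adj_coaction N u (\<lambda>i k. cnj (m k i)) j l"
proof -
  have "star (adj_coaction N u m l j) = (\<Sum>i<N. \<Sum>k<N. cnj (m i k) *\<^sub>C (star (u k j) * u i l))"
    by (simp add: adj_coaction_def star_sum star_scaleC star_mult star_star)
  also have "\<dots> = (\<Sum>k<N. \<Sum>i<N. cnj (m i k) *\<^sub>C (star (u k j) * u i l))" by (rule sum.swap)
  finally show ?thesis by (simp add: adj_coaction_def)
qed

text \<open>The two factors meet in \<open>u\<close> times its adjoint, which is the
  identity.\<close>

lemma (in cqg_algebra) adj_coaction_mult:
  assumes u: "unitary_comod N u"
  shows "adj_coaction N u (\<lambda>i k. \<Sum>a<N. m i a * m' a k) j l =
    (\<Sum>r<N. adj_coaction N u m j r * adj_coaction N u m' r l)"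
proof -
  define X where "X a = (\<Sum>i<N. m i a *\<^sub>C star (u i j))" for a
  define Y where "Y b = (\<Sum>k<N. m' b k *\<^sub>C u k l)" for b
  have X: "adj_coaction N u m j r = (\<Sum>a<N. X a * u a r)" for r
    unfolding adj_coaction_def X_def sum_distrib_right mult_scaleC_left by (rule sum.swap)
  have Y: "adj_coaction N u m' r l = (\<Sum>b<N. star (u b r) * Y b)" for r
    unfolding adj_coaction_def Y_def sum_distrib_left mult_scaleC_right ..
  have "(\<Sum>r<N. adj_coaction N u m j r * adj_coaction N u m' r l) =
      (\<Sum>r<N. \<Sum>a<N. \<Sum>b<N. X a * (u a r * star (u b r)) * Y b)"
    unfolding X Y by (simp add: sum_product mult.assoc)
  also have "\<dots> = (\<Sum>a<N. \<Sum>r<N. \<Sum>b<N. X a * (u a r * star (u b r)) * Y b)" by (rule sum.swap)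
  also have "\<dots> = (\<Sum>a<N. \<Sum>b<N. \<Sum>r<N. X a * (u a r * star (u b r)) * Y b)"
    by (intro sum.cong refl sum.swap)
  also have "\<dots> = (\<Sum>a<N. \<Sum>b<N. X a * (if a = b then 1 else 0) * Y b)"
    by (intro sum.cong refl)
      (simp add: unitary_comodD(4)[OF u] flip: sum_distrib_left sum_distrib_right)
  also have "\<dots> = (\<Sum>a<N. X a * Y a)"
    by (intro sum.cong refl, subst sum_eq_single) auto
  also have "\<dots> = (\<Sum>a<N. \<Sum>i<N. \<Sum>k<N. (m i a * m' a k) *\<^sub>C (star (u i j) * u k l))"
    by (simp add: X_def Y_def sum_product mult_scaleC_left mult_scaleC_right scaleC_scaleC mult.commute)
  also have "\<dots> = (\<Sum>i<N. \<Sum>a<N. \<Sum>k<N. (m i a * m' a k) *\<^sub>C (star (u i j) * u k l))" by (rule sum.swap)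
  also have "\<dots> = (\<Sum>i<N. \<Sum>k<N. \<Sum>a<N. (m i a * m' a k) *\<^sub>C (star (u i j) * u k l))"
    by (intro sum.cong refl sum.swap)
  also have "\<dots> = adj_coaction N u (\<lambda>i k. \<Sum>a<N. m i a * m' a k) j l"
    by (simp only: adj_coaction_def cvs.scale_sum_left)
  finally show ?thesis by (rule sym)
qed

context cqg_expectation
begin

definition cond_exp :: "nat \<Rightarrow> (nat \<Rightarrow> nat \<Rightarrow> 'a) \<Rightarrow> (nat \<Rightarrow> nat \<Rightarrow> complex) \<Rightarrow> nat \<Rightarrow> nat \<Rightarrow> complex" where
  "cond_exp N u m j l = phi (adj_coaction N u m j l)"

lemma cond_exp_eq:
  "cond_exp N u m j l = (\<Sum>i<N. \<Sum>k<N. m i k * phi (star (u i j) * u k l))"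
  by (simp add: cond_exp_def adj_coaction_def clinear_sum[OF clinear_phi]
      clinear_functional_scaleC[OF clinear_phi])

lemma cond_exp_star: "cond_exp N u (\<lambda>i k. cnj (m k i)) j l = cnj (cond_exp N u m l j)"
  unfolding cond_exp_def star_adj_coaction[symmetric] by (rule phi_star)

context
  fixes N :: nat and u :: "nat \<Rightarrow> nat \<Rightarrow> 'a"
  assumes u: "unitary_comod N u"
begin

text \<open>As \<open>p\<close> is slicing by \<open>phi\<close>, comultiplicativity of
  \<open>u\<close> lets it act on the coefficient matrix \<open>m\<close>. With \<open>phi_p\<close>
  this makes \<open>cond_exp\<close> idempotent, and its fixed matrices get coaction entries in
  \<open>A\<close>.\<close>

lemma p_adj_coaction:
  assumes jl: "j < N" "l < N"
  shows "p (adj_coaction N u m j l) = adj_coaction N u (cond_exp N u m) j l"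
proof -
  have p: "p (star (u i j) * u k l) =
      (\<Sum>r<N. \<Sum>s<N. phi (star (u i r) * u k s) *\<^sub>C (star (u r j) * u s l))"
    if ik: "i < N" "k < N" for i k
  proof -
    have "\<Delta> (star (u i j) * u k l) =
        (\<Sum>r<N. \<Sum>s<N. (star (u i r) * u k s) \<otimes>\<^sub>t (star (u r j) * u s l))"
      unfolding comult_mult comodule_mat_star(1)[OF u ik(1) jl(1)] unitary_comodD(1)[OF u ik(2) jl(2)]
      by (simp add: sum_product times_tensor_pure)
    thus ?thesis
      unfolding p_slice(1)[of "star (u i j) * u k l", symmetric]
      by (simp add: clinear_sum[OF clinear_slice_left[OF clinear_phi]] slice_left_tensor clinear_phi)
  qed
  have "p (adj_coaction N u m j l) =
      (\<Sum>i<N. \<Sum>k<N. \<Sum>r<N. \<Sum>s<N. (m i k * phi (star (u i r) * u k s)) *\<^sub>C (star (u r j) * u s l))"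
    by (simp add: adj_coaction_def clinear_sum[OF clinear_p] clinear_scaleC[OF clinear_p] p
        cvs.scale_sum_right scaleC_scaleC)
  also have "\<dots> = (\<Sum>r<N. \<Sum>s<N. \<Sum>i<N. \<Sum>k<N. (m i k * phi (star (u i r) * u k s)) *\<^sub>C (star (u r j) * u s l))"
    by (rule sum_swap4)
  also have "\<dots> = adj_coaction N u (cond_exp N u m) j l"
    by (simp add: adj_coaction_def cond_exp_eq cvs.scale_sum_left)
  finally show ?thesis .
qed

lemma cond_exp_idempotent:
  assumes "j < N" "l < N"
  shows "cond_exp N u (cond_exp N u m) j l = cond_exp N u m j l"
  unfolding cond_exp_def[of N u "cond_exp N u m"] p_adj_coaction[OF assms, symmetric] phi_p
  by (simp only: cond_exp_def)

definition fixed :: "(nat \<Rightarrow> nat \<Rightarrow> complex) \<Rightarrow> bool" where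
  "fixed m \<longleftrightarrow> (\<forall>j<N. \<forall>l<N. cond_exp N u m j l = m j l)"

lemma fixed_adj_coaction: "fixed m \<Longrightarrow> j < N \<Longrightarrow> l < N \<Longrightarrow> adj_coaction N u m j l \<in> A"
  using p_adj_coaction[of j l m] adj_coaction_cong[of N "cond_exp N u m" m u] p_in_A
  by (metis fixed_def)

lemma counit_adj_coaction:
  assumes jl: "j < N" "l < N"
  shows "\<epsilon> (adj_coaction N u m j l) = m j l"
proof -
  have "\<epsilon> (adj_coaction N u m j l) =
      (\<Sum>i<N. \<Sum>k<N. m i k * ((if i = j then 1 else 0) * (if k = l then 1 else 0)))"
    by (simp add: adj_coaction_def clinear_sum[OF clinear_counit] clinear_functional_scaleC[OF clinear_counit]
        counit_mult comodule_mat_star(2)[OF u _ jl(1)] unitary_comodD(2)[OF u _ jl(2)])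
  also have "\<dots> = (\<Sum>k<N. m j k * (if k = l then 1 else 0))"
    by (subst sum_eq_single[of _ j]) (use jl in auto)
  also have "\<dots> = m j l" by (subst sum_eq_single[of _ l]) (use jl in auto)
  finally show ?thesis .
qed

text \<open>A fixed \<open>n\<close> has coaction entries in \<open>A\<close>, from which
  \<open>phi\<close> pulls out the counit, and the counit of the coaction of \<open>n\<close> is
  \<open>n\<close> itself.\<close>

lemma cond_exp_mult:
  assumes n: "fixed n" and jl: "j < N" "l < N"
  shows "cond_exp N u (\<lambda>i k. \<Sum>a<N. n i a * m a k) j l = (\<Sum>r<N. n j r * cond_exp N u m r l)"
    "cond_exp N u (\<lambda>i k. \<Sum>a<N. m i a * n a k) j l = (\<Sum>r<N. cond_exp N u m j r * n r l)"
proof -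
  show "cond_exp N u (\<lambda>i k. \<Sum>a<N. n i a * m a k) j l = (\<Sum>r<N. n j r * cond_exp N u m r l)"
    unfolding cond_exp_def adj_coaction_mult[OF u] clinear_sum[OF clinear_phi]
    by (rule sum.cong) (use n jl in \<open>auto simp: phi_mult_left fixed_adj_coaction counit_adj_coaction\<close>)
  show "cond_exp N u (\<lambda>i k. \<Sum>a<N. m i a * n a k) j l = (\<Sum>r<N. cond_exp N u m j r * n r l)"
    unfolding cond_exp_def adj_coaction_mult[OF u] clinear_sum[OF clinear_phi]
    by (rule sum.cong) (use n jl in \<open>auto simp: phi_mult_right fixed_adj_coaction counit_adj_coaction\<close>)
qed

lemma cond_exp_cong:
  "(\<And>i k. i < N \<Longrightarrow> k < N \<Longrightarrow> m i k = m' i k) \<Longrightarrow> cond_exp N u m = cond_exp N u m'"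
  using adj_coaction_cong[of N m m' u] by (simp add: cond_exp_def fun_eq_iff)

text \<open>Ensures that the element \<open>k\<close> of \<open>negative_part\<close>, taken for a
  fixed matrix, is fixed as well.\<close>

lemma closed_subalgebra_fixed: "closed_subalgebra {X :: complex block_matrix. fixed (block X N)}"
  unfolding closed_subalgebra_def
proof (intro conjI ballI)
  have "{X :: complex block_matrix. fixed (block X N)} =
      (\<Inter>j<N. \<Inter>l<N. {X. cond_exp N u (block X N) j l = block X N j l})"
    by (auto simp: fixed_def)
  moreover have "closed {X :: complex block_matrix. cond_exp N u (block X N) j l = block X N j l}" for j l
  proof -
    have "continuous_on UNIV (\<lambda>X :: complex block_matrix. block X N i k)" for i k
      by (rule linear_continuous_on[OF bounded_linear_block])
    thus ?thesis
      unfolding cond_exp_eq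
      by (intro closed_Collect_eq continuous_on_sum continuous_on_mult_right)
  qed
  ultimately show "closed {X :: complex block_matrix. fixed (block X N)}"
    by (simp only:) (intro closed_INT ballI)
  show "csubspace {X :: complex block_matrix. fixed (block X N)}"
    unfolding cvs.subspace_def
  proof (intro conjI ballI allI)
    show "0 \<in> {X :: complex block_matrix. fixed (block X N)}"
      by (simp add: fixed_def cond_exp_eq block_simps)
    fix X Y :: "complex block_matrix" and c
    assume X: "X \<in> {X. fixed (block X N)}" and Y: "Y \<in> {X. fixed (block X N)}"
    have "cond_exp N u (block (X + Y) N) j l = cond_exp N u (block X N) j l + cond_exp N u (block Y N) j l" for j l
      by (simp add: cond_exp_eq block_simps distrib_right sum.distrib)
    thus "X + Y \<in> {X. fixed (block X N)}" using X Y by (simp add: fixed_def block_simps)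
    have "cond_exp N u (block (c *\<^sub>C X) N) j l = c * cond_exp N u (block X N) j l" for j l
      by (simp add: cond_exp_eq block_simps scaleC_complex_def sum_distrib_left mult.assoc)
    thus "c *\<^sub>C X \<in> {X. fixed (block X N)}" using X by (simp add: fixed_def block_simps scaleC_complex_def)
  qed
  have "adj_coaction N u (block 1 N) j l = (if j = l then 1 else 0)" if "j < N" "l < N" for j l
  proof -
    have "adj_coaction N u (block 1 N) j l = (\<Sum>i<N. star (u i j) * u i l)"
      unfolding adj_coaction_def
      by (intro sum.cong refl, subst sum_eq_single) (auto simp: block_1 scaleC_one)
    thus ?thesis using unitary_comodD(3)[OF u that] by simp
  qed
  thus "1 \<in> {X :: complex block_matrix. fixed (block X N)}"
    by (auto simp: fixed_def cond_exp_def block_1 phi_1 clinear_0[OF clinear_phi])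
  fix X Y :: "complex block_matrix"
  assume X: "X \<in> {X. fixed (block X N)}" and Y: "Y \<in> {X. fixed (block X N)}"
  have "cond_exp N u (block (X * Y) N) j l = block (X * Y) N j l" if jl: "j < N" "l < N" for j l
  proof -
    have "cond_exp N u (block (X * Y) N) j l = (\<Sum>r<N. block X N j r * cond_exp N u (block Y N) r l)"
      unfolding times_block_matrix.rep_eq by (rule cond_exp_mult(1)) (use X jl in auto)
    also have "\<dots> = block (X * Y) N j l"
      unfolding block_simps by (rule sum.cong) (use Y jl in \<open>auto simp: fixed_def\<close>)
    finally show ?thesis .
  qed
  thus "X * Y \<in> {X. fixed (block X N)}" by (simp add: fixed_def)
qed

text \<open>
  \<open>cond_exp\<close> preserves the faithful positive functional \<open>m \<mapsto> \<Sum>i k. G\<^sub>i\<^sub>k m\<^sub>i\<^sub>k\<close>, where \<open>G\<close> is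
  the invariant form of the conjugate comodule. Evaluating it on \<open>k r k\<close>, with \<open>k\<close> the negative
  part of \<open>r\<close>, shows that the negative part vanishes.
\<close>

lemma cond_exp_positive:
  "is_positive (single_block N (cond_exp N u (\<lambda>i k. cnj (a i) * a k)))"
proof -
  obtain K and c :: "nat \<Rightarrow> nat \<times> nat \<times> nat \<Rightarrow> complex" where fin: "finite K"
    and inv: "\<And>i k. i < N \<Longrightarrow> k < N \<Longrightarrow>
      (\<Sum>j<N. \<Sum>l<N. (\<Sum>t\<in>K. c j t * cnj (c l t)) *\<^sub>C (star (u i j) * star (star (u k l)))) =
      (\<Sum>t\<in>K. c i t * cnj (c k t)) *\<^sub>C 1"
    and faithful: "\<And>x i. (\<And>t. t \<in> K \<Longrightarrow> (\<Sum>k<N. cnj (c k t) * x k) = 0) \<Longrightarrow> i < N \<Longrightarrow> x i = 0"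
    by (rule comodule_invariant_form[of N "\<lambda>i j. star (u i j)"])
      (use comodule_mat_star[OF u] in \<open>assumption | blast\<close>)+
  define G where "G i k = (\<Sum>t\<in>K. c i t * cnj (c k t))" for i k
  define \<omega> where "\<omega> m = (\<Sum>i<N. \<Sum>k<N. G i k * m i k)" for m :: "nat \<Rightarrow> nat \<Rightarrow> complex"
  have \<omega>_cong: "\<omega> m = \<omega> m'" if "\<And>i k. i < N \<Longrightarrow> k < N \<Longrightarrow> m i k = m' i k" for m m'
    unfolding \<omega>_def by (intro sum.cong refl) (use that in auto)
  \<comment> \<open>Invariance of \<open>G\<close> under the conjugate comodule turns the sum over
    \<open>j\<close> and \<open>l\<close> into \<open>G i k\<close> times 1, and
    \<open>phi 1 = 1\<close>.\<close>
  have \<omega>_cond_exp: "\<omega> (cond_exp N u m) = \<omega> m" for m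
  proof -
    have "\<omega> (cond_exp N u m) =
        (\<Sum>j<N. \<Sum>l<N. \<Sum>i<N. \<Sum>k<N. m i k * (G j l * phi (star (u i j) * u k l)))"
      by (simp add: \<omega>_def cond_exp_eq sum_distrib_left mult_ac)
    also have "\<dots> = (\<Sum>i<N. \<Sum>k<N. \<Sum>j<N. \<Sum>l<N. m i k * (G j l * phi (star (u i j) * u k l)))"
      by (rule sum_swap4)
    also have "\<dots> = (\<Sum>i<N. \<Sum>k<N. m i k * phi (\<Sum>j<N. \<Sum>l<N. G j l *\<^sub>C (star (u i j) * u k l)))"
      by (simp add: clinear_sum[OF clinear_phi] clinear_functional_scaleC[OF clinear_phi] sum_distrib_left)
    also have "\<dots> = (\<Sum>i<N. \<Sum>k<N. m i k * phi (G i k *\<^sub>C 1))"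
      by (intro sum.cong refl) (use inv in \<open>simp add: G_def star_star\<close>)
    also have "\<dots> = \<omega> m"
      by (simp add: clinear_functional_scaleC[OF clinear_phi] phi_1 \<omega>_def mult.commute)
    finally show ?thesis .
  qed
  have \<omega>_gram: "\<omega> (\<lambda>i k. \<Sum>r<R. cnj (y r i) * y r k) =
      of_real (\<Sum>r<R. \<Sum>t\<in>K. (cmod (\<Sum>k<N. cnj (c k t) * y r k))\<^sup>2)" for R :: nat and y
  proof -
    have "\<omega> (\<lambda>i k. \<Sum>r<R. cnj (y r i) * y r k) =
        (\<Sum>i<N. \<Sum>k<N. \<Sum>r<R. \<Sum>t\<in>K. (c i t * cnj (y r i)) * (cnj (c k t) * y r k))"
      by (simp add: \<omega>_def G_def sum_product sum_distrib_left sum_distrib_right mult_ac sum.swap[of _ K])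
    also have "\<dots> = (\<Sum>r<R. \<Sum>t\<in>K. \<Sum>i<N. \<Sum>k<N. (c i t * cnj (y r i)) * (cnj (c k t) * y r k))"
      by (rule sum_swap4)
    also have "\<dots> = (\<Sum>r<R. \<Sum>t\<in>K. cnj (\<Sum>k<N. cnj (c k t) * y r k) * (\<Sum>k<N. cnj (c k t) * y r k))"
      by (simp add: sum_product)
    also have "\<dots> = (\<Sum>r<R. \<Sum>t\<in>K. of_real ((cmod (\<Sum>k<N. cnj (c k t) * y r k))\<^sup>2))"
      by (intro sum.cong refl) (subst complex_norm_square, rule mult.commute)
    finally show ?thesis by (simp only: of_real_sum)
  qed
  define m0 where "m0 i k = cnj (a i) * a k" for i k
  define r where "r = single_block N (cond_exp N u m0)"
  have r_block: "block r N i j = cond_exp N u m0 i j" if "i < N" "j < N" for i j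
    using that by (simp add: r_def block_single_block)
  have "star r = r"
  proof (rule block_matrix_eqI)
    fix n i j :: nat
    have "(\<lambda>i k. cnj (m0 k i)) = m0" by (simp add: m0_def fun_eq_iff mult.commute)
    hence "cnj (cond_exp N u m0 j i) = cond_exp N u m0 i j"
      using cond_exp_star[of N u m0 i j] by (simp only:)
    thus "block (star r) n i j = block r n i j"
      by (simp add: block_simps r_def block_single_block star_complex_def)
  qed
  then obtain k g where k: "star k = k" and krk: "k * r * k = - (star g * g)"
    and pos: "g = 0 \<Longrightarrow> is_positive r"
    and gc: "\<And>c. r * c = 0 \<Longrightarrow> g * c = 0"
    and kD: "\<And>D. closed_subalgebra D \<Longrightarrow> r \<in> D \<Longrightarrow> k \<in> D"
    by (rule negative_part) blast
  have "fixed (block r N)"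
    unfolding fixed_def
  proof (intro allI impI)
    fix j l assume jl: "j < N" "l < N"
    have "cond_exp N u (block r N) = cond_exp N u (cond_exp N u m0)"
      by (rule cond_exp_cong) (rule r_block)
    thus "cond_exp N u (block r N) j l = block r N j l"
      by (simp add: cond_exp_idempotent jl r_block)
  qed
  hence k_fixed: "fixed (block k N)" using kD[OF closed_subalgebra_fixed] by simp
  have k_sym: "cnj (block k N i j) = block k N j i" for i j
    using k block_simps(6)[of k N j i] by (simp add: star_complex_def)
  \<comment> \<open>The row vector \<open>a k\<close>. As \<open>k\<close> is fixed,
    \<open>k * r * k\<close> is \<open>cond_exp\<close> of \<open>k m0 k\<close>, again a rank one
    matrix, now built from \<open>z\<close>; the sum over \<open>r<Suc 0\<close> gives it the shape
    of \<open>\<omega>_gram\<close>.\<close>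
  define z where "z l = (\<Sum>s<N. a s * block k N s l)" for l
  have "block (k * r * k) N j l = cond_exp N u (\<lambda>i k. \<Sum>r<Suc 0. cnj (z i) * z k) j l"
    if jl: "j < N" "l < N" for j l
  proof -
    have "block (k * r * k) N j l = (\<Sum>s<N. (\<Sum>r<N. block k N j r * cond_exp N u m0 r s) * block k N s l)"
      unfolding block_simps by (intro sum.cong refl arg_cong2[of _ _ _ _ "(*)"]) (use jl in \<open>auto simp: r_block\<close>)
    also have "\<dots> = (\<Sum>s<N. cond_exp N u (\<lambda>i k'. \<Sum>a<N. block k N i a * m0 a k') j s * block k N s l)"
      by (intro sum.cong refl) (use jl k_fixed in \<open>simp add: cond_exp_mult(1)\<close>)
    also have "\<dots> = cond_exp N u (\<lambda>i k'. \<Sum>b<N. (\<Sum>a<N. block k N i a * m0 a b) * block k N b k') j l"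
      by (rule cond_exp_mult(2)[symmetric]) (use jl k_fixed in auto)
    also have "(\<lambda>i k'. \<Sum>b<N. (\<Sum>a<N. block k N i a * m0 a b) * block k N b k') =
        (\<lambda>i k. \<Sum>r<Suc 0. cnj (z i) * z k)"
    proof (intro ext)
      fix i k'
      have "cnj (z i) = (\<Sum>a'<N. block k N i a' * cnj (a a'))"
        by (simp add: z_def k_sym mult.commute)
      hence "cnj (z i) * z k' = (\<Sum>b<N. (\<Sum>a'<N. block k N i a' * cnj (a a')) * (a b * block k N b k'))"
        by (simp add: z_def sum_distrib_left)
      thus "(\<Sum>b<N. (\<Sum>a<N. block k N i a * m0 a b) * block k N b k') = (\<Sum>r<Suc 0. cnj (z i) * z k')"
        by (simp add: m0_def sum_distrib_right mult.assoc)
    qed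
    finally show ?thesis .
  qed
  hence "\<omega> (block (k * r * k) N) = \<omega> (cond_exp N u (\<lambda>i k. \<Sum>r<Suc 0. cnj (z i) * z k))"
    by (rule \<omega>_cong)
  also have "\<dots> = of_real (\<Sum>r<Suc 0. \<Sum>t\<in>K. (cmod (\<Sum>k<N. cnj (c k t) * z k))\<^sup>2)"
    unfolding \<omega>_cond_exp by (rule \<omega>_gram[where y = "\<lambda>r. z"])
  finally have \<omega>1: "\<omega> (block (k * r * k) N) = of_real (\<Sum>r<Suc 0. \<Sum>t\<in>K. (cmod (\<Sum>k<N. cnj (c k t) * z k))\<^sup>2)"
    (is "_ = of_real ?\<sigma>") .
  have \<sigma>: "?\<sigma> \<ge> 0" by (intro sum_nonneg zero_le_power2)
  \<comment> \<open>The second evaluation, from \<open>k * r * k = - (star g * g)\<close>. The first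
    is nonnegative and this one nonpositive, so all squares vanish.\<close>
  define \<rho> where "\<rho> = (\<Sum>r<N. \<Sum>t\<in>K. (cmod (\<Sum>k<N. cnj (c k t) * block g N r k))\<^sup>2)"
  have "block (- (star g * g)) N i j = - (\<Sum>r<N. cnj (block g N r i) * block g N r j)" for i j
    using block_simps(3)[of 0 "star g * g" N i j] by (simp add: block_simps star_complex_def)
  hence "\<omega> (block (k * r * k) N) = - \<omega> (\<lambda>i j. \<Sum>r<N. cnj (block g N r i) * block g N r j)"
    unfolding krk by (simp add: \<omega>_def sum_negf)
  hence \<omega>2: "\<omega> (block (k * r * k) N) = of_real (- \<rho>)"
    unfolding \<omega>_gram \<rho>_def[symmetric] of_real_minus .
  have "?\<sigma> = - \<rho>"
    using trans[OF \<omega>1[symmetric] \<omega>2] unfolding of_real_eq_iff .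
  moreover have "\<rho> \<ge> 0" unfolding \<rho>_def by (intro sum_nonneg zero_le_power2)
  ultimately have \<rho>0: "\<rho> = 0" using \<sigma> by linarith
  have gN: "block g N r i = 0" if "r < N" "i < N" for r i
  proof (rule faithful[OF _ that(2)])
    fix t assume t: "t \<in> K"
    have "(\<Sum>t\<in>K. (cmod (\<Sum>k<N. cnj (c k t) * block g N r k))\<^sup>2) = 0"
      using \<rho>0 that(1) unfolding \<rho>_def by (subst (asm) sum_nonneg_eq_0_iff) (auto intro: sum_nonneg)
    hence "(cmod (\<Sum>k<N. cnj (c k t) * block g N r k))\<^sup>2 = 0"
      using t fin by (subst (asm) sum_nonneg_eq_0_iff) auto
    thus "(\<Sum>k<N. cnj (c k t) * block g N r k) = 0" by simp
  qed
  \<comment> \<open>Faithfulness of \<open>\<omega>\<close> controls only the block of size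
    \<open>N\<close> of \<open>g\<close>. The unit \<open>e\<close> of all other factors is
    annihilated by \<open>r\<close>, hence by \<open>g\<close>.\<close>
  define e where "e = 1 - single_block N (\<lambda>i j. if i = j then 1 else (0::complex))"
  have e: "block e n i j = (if n = N then 0 else if i = j then 1 else 0)" if "i < n" "j < n" for n i j
    using that by (simp add: e_def block_simps block_1 block_single_block)
  have "r * e = 0"
    by (rule block_matrix_eqI) (auto simp: block_simps e r_def block_single_block intro!: sum.neutral)
  hence ge: "g * e = 0" by (rule gc)
  have "g = 0"
  proof (rule block_matrix_eqI)
    fix n i j :: nat assume ij: "i < n" "j < n"
    show "block g n i j = block 0 n i j"
    proof (cases "n = N")
      case True
      thus ?thesis using gN ij by (simp add: block_simps)
    next
      case False
      have "block (g * e) n i j = block g n i j * block e n j j"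
        unfolding block_simps by (rule sum_eq_single) (use ij e False in auto)
      thus ?thesis using e[OF ij(2,2)] False ge by (simp add: block_simps)
    qed
  qed
  from pos[OF this] show ?thesis by (simp only: r_def m0_def[abs_def])
qed

end

lemma phi_positive: "\<exists>\<rho>\<ge>0. phi (star y * y) = complex_of_real \<rho>"
proof -
  obtain N u a b where u: "unitary_comod N u" and y: "y = (\<Sum>i<N. \<Sum>j<N. (a i * b j) *\<^sub>C u i j)"
    by (rule matrix_coefficient)
  define m0 where "m0 i k = cnj (a i) * a k" for i k
  obtain s where s: "single_block N (cond_exp N u m0) = star s * s"
    using cond_exp_positive[OF u, of a] unfolding positive_iff_star_mult_self m0_def by blast
  have E: "cond_exp N u m0 j l = (\<Sum>r<N. cnj (block s N r j) * block s N r l)" if "j < N" "l < N" for j l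
    using arg_cong[OF s, of "\<lambda>X. block X N j l"] that
    by (simp add: block_single_block block_simps star_complex_def)
  \<comment> \<open>\<open>phi (star y * y)\<close> is the form of \<open>cond_exp N u m0\<close> at
    the vector \<open>b\<close>; with the factor \<open>s\<close> it becomes the squared length of
    \<open>z = s b\<close>.\<close>
  define z where "z r = (\<Sum>l<N. block s N r l * b l)" for r
  have y': "y = (\<Sum>j<N. \<Sum>i<N. (a i * b j) *\<^sub>C u i j)" unfolding y by (rule sum.swap)
  have "star y * y = (\<Sum>j<N. \<Sum>l<N. \<Sum>i<N. \<Sum>k<N. (cnj (b j) * b l * m0 i k) *\<^sub>C (star (u i j) * u k l))"
    unfolding y' star_sum sum_product
    by (intro sum.cong refl)
      (simp add: star_sum sum_product star_scaleC mult_scaleC_left mult_scaleC_right scaleC_scaleC m0_def mult_ac)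
  also have "\<dots> = (\<Sum>j<N. \<Sum>l<N. (cnj (b j) * b l) *\<^sub>C adj_coaction N u m0 j l)"
    by (simp add: adj_coaction_def cvs.scale_sum_right scaleC_scaleC)
  finally have "phi (star y * y) = (\<Sum>j<N. \<Sum>l<N. (cnj (b j) * b l) * cond_exp N u m0 j l)"
    by (simp add: clinear_sum[OF clinear_phi] clinear_functional_scaleC[OF clinear_phi] cond_exp_def)
  also have "\<dots> = (\<Sum>j<N. \<Sum>l<N. \<Sum>r<N. cnj (block s N r j * b j) * (block s N r l * b l))"
    by (intro sum.cong refl) (simp add: E sum_distrib_left mult_ac)
  also have "\<dots> = (\<Sum>j<N. \<Sum>r<N. \<Sum>l<N. cnj (block s N r j * b j) * (block s N r l * b l))"
    by (intro sum.cong refl sum.swap)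
  also have "\<dots> = (\<Sum>r<N. \<Sum>j<N. \<Sum>l<N. cnj (block s N r j * b j) * (block s N r l * b l))"
    by (rule sum.swap)
  also have "\<dots> = (\<Sum>r<N. cnj (z r) * z r)" by (simp add: z_def sum_product)
  also have "\<dots> = (\<Sum>r<N. of_real ((cmod (z r))\<^sup>2))"
    by (intro sum.cong refl) (subst complex_norm_square, rule mult.commute)
  also have "\<dots> = of_real (\<Sum>r<N. (cmod (z r))\<^sup>2)" by (simp only: of_real_sum)
  finally show ?thesis by (intro exI[of _ "\<Sum>r<N. (cmod (z r))\<^sup>2"]) (simp add: sum_nonneg)
qed

end

section \<open>Complete positivity\<close>

lemma tendsto_scaleC:
  assumes "(f \<longlongrightarrow> (a::'b::cstar_algebra)) F"
  shows "((\<lambda>x. c *\<^sub>C f x) \<longlongrightarrow> c *\<^sub>C a) F"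
proof -
  have eq: "c *\<^sub>C x = (c *\<^sub>C 1) * x" for x :: 'b by (simp add: mult_scaleC_left)
  show ?thesis unfolding eq[of "f _"] eq[of a] by (intro tendsto_intros assms)
qed

lemma in_closure_sequentially: "\<forall>n. f n \<in> V \<Longrightarrow> f \<longlonglongrightarrow> x \<Longrightarrow> x \<in> closure V"
  for x :: "'b::metric_space"
  unfolding closure_sequential by (intro exI[of _ f] conjI)

lemma closed_subalgebra_closure:
  fixes V :: "'b::cstar_algebra set"
  assumes V: "csubspace V" and 1: "1 \<in> V" and mult: "\<And>x y. x \<in> V \<Longrightarrow> y \<in> V \<Longrightarrow> x * y \<in> V"
  shows "closed_subalgebra (closure V)"
  unfolding closed_subalgebra_def cvs.subspace_def
proof (intro conjI ballI allI)
  show "1 \<in> closure V" "0 \<in> closure V" using 1 cvs.subspace_0[OF V] closure_subset[of V] by blast+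
  fix x y c assume "x \<in> closure V" "y \<in> closure V"
  then obtain f g where f: "\<forall>n. f n \<in> V" "f \<longlonglongrightarrow> x" and g: "\<forall>n. g n \<in> V" "g \<longlonglongrightarrow> y"
    unfolding closure_sequential by blast
  have "\<forall>n. f n + g n \<in> V" "(\<lambda>n. f n + g n) \<longlonglongrightarrow> x + y"
    using f g cvs.subspace_add[OF V] by (auto intro: tendsto_add)
  thus "x + y \<in> closure V" by (rule in_closure_sequentially)
  have "\<forall>n. f n * g n \<in> V" "(\<lambda>n. f n * g n) \<longlonglongrightarrow> x * y"
    using f g mult by (auto intro: tendsto_mult)
  thus "x * y \<in> closure V" by (rule in_closure_sequentially)
  have "\<forall>n. c *\<^sub>C f n \<in> V" "(\<lambda>n. c *\<^sub>C f n) \<longlonglongrightarrow> c *\<^sub>C x"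
    using f cvs.subspace_scale[OF V] by (auto intro: tendsto_scaleC)
  thus "c *\<^sub>C x \<in> closure V" by (rule in_closure_sequentially)
qed simp

lemma span_image_lessThan:
  fixes e :: "nat \<Rightarrow> 'a::complex_vector"
  assumes "b \<in> cspan (e ` {..<K})"
  obtains c where "b = (\<Sum>r<K. c r *\<^sub>C e r)"
proof -
  from assms have "\<exists>c. b = (\<Sum>r<K. c r *\<^sub>C e r)"
  proof (induction rule: cvs.span_induct_alt)
    case base
    show ?case by (rule exI[of _ "\<lambda>_. 0"]) simp
  next
    case (step d x y)
    from step(2) obtain c where c: "y = (\<Sum>r<K. c r *\<^sub>C e r)" by (elim exE)
    from step(1) obtain s where s: "s < K" "x = e s" by auto
    have "(\<Sum>r<K. (if r = s then d else 0) *\<^sub>C e r) = d *\<^sub>C x"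
      by (subst sum_eq_single[of _ s]) (use s in auto)
    hence "d *\<^sub>C x + y = (\<Sum>r<K. ((if r = s then d else 0) + c r) *\<^sub>C e r)"
      unfolding c scaleC_add_left sum.distrib by (simp only:)
    thus ?case by (rule exI[of _ "\<lambda>r. (if r = s then d else 0) + c r"])
  qed
  thus ?thesis by (elim exE) (rule that)
qed

text \<open>The family \<open>e\<close> is left open because it is chosen later: common to several
  tensors and orthogonal for \<open>phi\<close>.\<close>

lemma tensor_expansion:
  fixes t :: "('a::complex_vector, 'b::complex_vector) tensor"
  obtains X where "finite X"
    "\<And>K e. X \<subseteq> cspan (e ` {..<K::nat}) \<Longrightarrow> \<exists>z. t = (\<Sum>r<K. z r \<otimes>\<^sub>t e r)"
proof -
  have "\<exists>X. finite X \<and> (\<forall>K e. X \<subseteq> cspan (e ` {..<K::nat}) \<longrightarrow> (\<exists>z. t = (\<Sum>r<K. z r \<otimes>\<^sub>t e r)))"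
  proof (induction t rule: tensor_induct)
    case zero
    show ?case by (rule exI[of _ "{}"]) (auto intro!: exI[of _ "\<lambda>_. 0"])
  next
    case (add a b t)
    then obtain X where X: "finite X"
      "\<And>K e. X \<subseteq> cspan (e ` {..<K::nat}) \<Longrightarrow> \<exists>z. t = (\<Sum>r<K. z r \<otimes>\<^sub>t e r)" by blast
    show ?case
    proof (intro exI[of _ "insert b X"] conjI allI impI)
      fix K :: nat and e assume sub: "insert b X \<subseteq> cspan (e ` {..<K})"
      then obtain z where z: "t = (\<Sum>r<K. z r \<otimes>\<^sub>t e r)" using X(2)[of e K] by auto
      from sub have "b \<in> cspan (e ` {..<K})" by simp
      then obtain c where c: "b = (\<Sum>r<K. c r *\<^sub>C e r)" by (rule span_image_lessThan)
      have lin: "clinear (\<lambda>y. a \<otimes>\<^sub>t y)" using cbilinear_tensor unfolding cbilinear_def by blast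
      have "a \<otimes>\<^sub>t b = (\<Sum>r<K. (c r *\<^sub>C a) \<otimes>\<^sub>t e r)"
        unfolding c clinear_sum[OF lin] by (simp only: tensor_scale_right tensor_scale_left)
      hence "a \<otimes>\<^sub>t b + t = (\<Sum>r<K. (c r *\<^sub>C a + z r) \<otimes>\<^sub>t e r)"
        by (simp only: z tensor_add_left sum.distrib)
      thus "\<exists>z. a \<otimes>\<^sub>t b + t = (\<Sum>r<K. z r \<otimes>\<^sub>t e r)"
        by (rule exI[of _ "\<lambda>r. c r *\<^sub>C a + z r"])
    qed (use X(1) in simp)
  qed
  thus ?thesis using that by blast
qed

section \<open>Orthogonal expansions for \<open>phi\<close>\<close>

context cqg_expectation
begin

text \<open>Cauchy-Schwarz at a null vector; \<open>phi\<close> need not be faithful, as it is a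
  character on \<open>A\<close>.\<close>

lemma phi_null:
  assumes "phi (star e * e) = 0"
  shows "phi (star e * x) = 0"
proof (rule ccontr)
  define w where "w = phi (star e * x)"
  assume "phi (star e * x) \<noteq> 0"
  hence w: "cmod w > 0" by (simp add: w_def)
  obtain \<rho> where \<rho>: "\<rho> \<ge> 0" "phi (star x * x) = complex_of_real \<rho>" using phi_positive by blast
  \<comment> \<open>Chosen so that
    \<open>phi (star (x + s *\<^sub>C e) * (x + s *\<^sub>C e))\<close> becomes
    \<open>\<rho> - (\<rho> + 1) = -1\<close>.\<close>
  define s where "s = - complex_of_real ((\<rho> + 1) / (2 * (cmod w)\<^sup>2)) * w"
  have ex: "phi (star x * e) = cnj w"
    using phi_star[of "star e * x"] by (simp add: w_def star_mult star_star)
  obtain \<tau> where \<tau>: "\<tau> \<ge> 0" "phi (star (x + s *\<^sub>C e) * (x + s *\<^sub>C e)) = complex_of_real \<tau>"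
    using phi_positive by blast
  have "star (x + s *\<^sub>C e) * (x + s *\<^sub>C e) =
      star x * x + s *\<^sub>C (star x * e) + cnj s *\<^sub>C (star e * x) + (cnj s * s) *\<^sub>C (star e * e)"
    by (simp add: star_add star_scaleC distrib_left distrib_right mult_scaleC_left
        mult_scaleC_right scaleC_scaleC scaleC_add_right mult.commute add_ac)
  hence "complex_of_real \<tau> = complex_of_real \<rho> + s * cnj w + cnj s * w"
    using \<tau>(2) by (simp add: clinear_add[OF clinear_phi] clinear_functional_scaleC[OF clinear_phi]
        ex assms \<rho>(2) w_def)
  also have "s * cnj w = - complex_of_real ((\<rho> + 1) / 2)"
  proof -
    have "s * cnj w = - complex_of_real ((\<rho> + 1) / (2 * (cmod w)\<^sup>2)) * complex_of_real ((cmod w)\<^sup>2)"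
      unfolding complex_norm_square by (simp add: s_def)
    also have "\<dots> = - complex_of_real ((\<rho> + 1) / (2 * (cmod w)\<^sup>2) * (cmod w)\<^sup>2)"
      by (simp only: of_real_mult mult_minus_left)
    also have "(\<rho> + 1) / (2 * (cmod w)\<^sup>2) * (cmod w)\<^sup>2 = (\<rho> + 1) / 2" using w by simp
    finally show ?thesis .
  qed
  also have "cnj s * w = cnj (s * cnj w)" by simp
  also have "s * cnj w = - complex_of_real ((\<rho> + 1) / 2)" by fact
  finally have "complex_of_real \<tau> = complex_of_real (- 1)"
    by (simp add: field_simps)
  hence "\<tau> = - 1" by (simp only: of_real_eq_iff)
  thus False using \<tau>(1) by simp
qed

text \<open>Gram-Schmidt without normalisation; null vectors stay in the family.\<close>

lemma phi_orthogonal_family: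
  assumes "finite X"
  obtains K :: nat and e where "X \<subseteq> cspan (e ` {..<K})"
    "\<And>r s. r < K \<Longrightarrow> s < K \<Longrightarrow> r \<noteq> s \<Longrightarrow> phi (star (e r) * e s) = 0"
proof -
  have "\<exists>K e. X \<subseteq> cspan (e ` {..<K::nat}) \<and>
      (\<forall>r<K. \<forall>s<K. r \<noteq> s \<longrightarrow> phi (star (e r) * e s) = 0)"
    using assms
  proof (induction X)
    case empty
    show ?case by (intro exI[of _ 0]) simp
  next
    case (insert x X)
    then obtain K e where K: "X \<subseteq> cspan (e ` {..<K::nat})"
      and orth: "\<And>r s. r < K \<Longrightarrow> s < K \<Longrightarrow> r \<noteq> s \<Longrightarrow> phi (star (e r) * e s) = 0" by blast
    \<comment> \<open>For a null vector \<open>e r\<close> this is a division by zero, hence 0,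
      which is right because \<open>phi_null\<close> makes the numerator 0.\<close>
    define c where "c r = phi (star (e r) * x) / phi (star (e r) * e r)" for r
    define y where "y = x - (\<Sum>r<K. c r *\<^sub>C e r)"
    have y: "phi (star (e s) * y) = 0" if s: "s < K" for s
    proof -
      have "phi (star (e s) * y) = phi (star (e s) * x) - (\<Sum>r<K. c r * phi (star (e s) * e r))"
        by (simp add: y_def right_diff_distrib sum_distrib_left mult_scaleC_right clinear_diff[OF clinear_phi]
            clinear_sum[OF clinear_phi] clinear_functional_scaleC[OF clinear_phi])
      also have "(\<Sum>r<K. c r * phi (star (e s) * e r)) = c s * phi (star (e s) * e s)"
        by (rule sum_eq_single) (use s orth in auto)
      also have "phi (star (e s) * x) - c s * phi (star (e s) * e s) = 0"
        using phi_null[of "e s" x] by (cases "phi (star (e s) * e s) = 0") (auto simp: c_def)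
      finally show ?thesis .
    qed
    have y': "phi (star y * e s) = 0" if "s < K" for s
      using phi_star[of "star (e s) * y"] y[OF that] by (simp add: star_mult star_star)
    define e' where "e' = e(K := y)"
    have e': "e' r = e r" if "r < K" for r using that by (simp add: e'_def)
    have e'K: "e' K = y" by (simp add: e'_def)
    have sub: "cspan (e ` {..<K}) \<subseteq> cspan (e' ` {..<Suc K})"
      by (rule cvs.span_mono) (auto simp: e'_def)
    have er: "e r \<in> cspan (e' ` {..<Suc K})" if "r < K" for r
      by (rule subsetD[OF sub cvs.span_base]) (use that in auto)
    have "y \<in> cspan (e' ` {..<Suc K})" by (rule cvs.span_base) (use e'K in force)
    moreover have "(\<Sum>r<K. c r *\<^sub>C e r) \<in> cspan (e' ` {..<Suc K})"
      by (intro cvs.span_sum cvs.span_scale er) simp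
    ultimately have "y + (\<Sum>r<K. c r *\<^sub>C e r) \<in> cspan (e' ` {..<Suc K})" by (rule cvs.span_add)
    hence "x \<in> cspan (e' ` {..<Suc K})" by (simp add: y_def)
    moreover have "phi (star (e' r) * e' s) = 0" if "r < Suc K" "s < Suc K" "r \<noteq> s" for r s
      using that y y' orth e' e'K by (auto simp: less_Suc_eq)
    ultimately show ?case using K sub
      by (intro exI[of _ "Suc K"] exI[of _ e'] conjI) auto
  qed
  thus ?thesis using that by blast
qed

text \<open>
  Since \<open>p = (id \<otimes> phi) \<circ> \<Delta>\<close>, the matrix is the Gram matrix of the \<open>\<Delta> x\<^sub>i\<close> for the form
  \<open>(a \<otimes> b, a' \<otimes> b') \<mapsto> phi (b\<^sup>* b') a\<^sup>* a'\<close>.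
\<close>

lemma p_gram:
  obtains K and z :: "nat \<Rightarrow> nat \<Rightarrow> 'a" where
    "\<And>i l. i < n \<Longrightarrow> l < n \<Longrightarrow> p (star (x i) * x l) = (\<Sum>r<K::nat. star (z r i) * z r l)"
proof -
  have "\<exists>X. finite X \<and> (\<forall>K e. X \<subseteq> cspan (e ` {..<K::nat}) \<longrightarrow> (\<exists>z. \<Delta> (x i) = (\<Sum>r<K. z r \<otimes>\<^sub>t e r)))" for i :: nat
    by (rule tensor_expansion[of "\<Delta> (x i)"]) blast
  then obtain X where X: "\<And>i. finite (X i)"
    "\<And>i K e. X i \<subseteq> cspan (e ` {..<K::nat}) \<Longrightarrow> \<exists>z. \<Delta> (x i) = (\<Sum>r<K. z r \<otimes>\<^sub>t e r)" by metis
  have "finite (\<Union>i<n. X i)" using X(1) by simp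
  then obtain K e where e: "(\<Union>i<n. X i) \<subseteq> cspan (e ` {..<K::nat})"
    and orth: "\<And>r s. r < K \<Longrightarrow> s < K \<Longrightarrow> r \<noteq> s \<Longrightarrow> phi (star (e r) * e s) = 0"
    by (rule phi_orthogonal_family) blast
  have "\<exists>z. \<Delta> (x i) = (\<Sum>r<K. z r \<otimes>\<^sub>t e r)" if "i < n" for i
    by (rule X(2)) (use e that in blast)
  then obtain z where z: "\<And>i. i < n \<Longrightarrow> \<Delta> (x i) = (\<Sum>r<K. z i r \<otimes>\<^sub>t e r)" by metis
  obtain \<rho> where \<rho>: "\<And>r. \<rho> r \<ge> 0" "\<And>r. phi (star (e r) * e r) = complex_of_real (\<rho> r)"
    using phi_positive[of "e _"] by metis
  \<comment> \<open>Orthogonality leaves one term for each \<open>r\<close>, weighted by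
    \<open>\<rho> r\<close>; the root of the weight is absorbed here.\<close>
  define z' where "z' r i = complex_of_real (sqrt (\<rho> r)) *\<^sub>C z i r" for r i
  have "p (star (x i) * x l) = (\<Sum>r<K. star (z' r i) * z' r l)" if il: "i < n" "l < n" for i l
  proof -
    have "\<Delta> (star (x i) * x l) = (\<Sum>r<K. \<Sum>s<K. (star (z i r) * z l s) \<otimes>\<^sub>t (star (e r) * e s))"
      unfolding comult_mult comult_star z[OF il(1)] z[OF il(2)]
      by (simp add: star_sum star_tensor_pure sum_product times_tensor_pure)
    hence "p (star (x i) * x l) = (\<Sum>r<K. \<Sum>s<K. phi (star (e r) * e s) *\<^sub>C (star (z i r) * z l s))"
      unfolding p_slice(2)[of "star (x i) * x l", symmetric]
      by (simp add: clinear_sum[OF clinear_slice_right[OF clinear_phi]] slice_right_tensor clinear_phi)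
    also have "\<dots> = (\<Sum>r<K. complex_of_real (\<rho> r) *\<^sub>C (star (z i r) * z l r))"
    proof (rule sum.cong[OF refl])
      fix r assume r: "r \<in> {..<K}"
      have "(\<Sum>s<K. phi (star (e r) * e s) *\<^sub>C (star (z i r) * z l s)) =
          phi (star (e r) * e r) *\<^sub>C (star (z i r) * z l r)"
        by (rule sum_eq_single) (use r orth in auto)
      thus "(\<Sum>s<K. phi (star (e r) * e s) *\<^sub>C (star (z i r) * z l s)) =
          complex_of_real (\<rho> r) *\<^sub>C (star (z i r) * z l r)" by (simp only: \<rho>(2))
    qed
    also have "\<dots> = (\<Sum>r<K. star (z' r i) * z' r l)"
    proof (rule sum.cong[OF refl])
      fix r
      have "complex_of_real (sqrt (\<rho> r)) * complex_of_real (sqrt (\<rho> r)) = complex_of_real (\<rho> r)"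
        using \<rho>(1)[of r] by (simp flip: of_real_mult)
      thus "complex_of_real (\<rho> r) *\<^sub>C (star (z i r) * z l r) = star (z' r i) * z' r l"
        by (simp add: z'_def star_scaleC mult_scaleC_left mult_scaleC_right scaleC_scaleC)
    qed
    finally show ?thesis .
  qed
  thus ?thesis by (rule that)
qed

end

section \<open>\<open>H\<close> as a Hilbert module over \<open>A\<close>, and the extension of
  \<open>p\<close>\<close>

locale cqg_envelope = cqg_expectation +
  fixes j :: "'a \<Rightarrow> 'b::cstar_algebra"
  assumes enveloping: "is_enveloping_cstar_algebra j"
begin

lemma clinear_j: "clinear j" and j_1: "j 1 = 1" and j_mult: "j (x * y) = j x * j y"
  and j_star: "j (star x) = star (j x)"
  using enveloping by (simp_all add: is_enveloping_cstar_algebra_def star_hom_def)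

lemma j_dense: "closure (range j) = UNIV"
  and j_greatest: "cstar_seminorm q \<Longrightarrow> q x \<le> norm (j x)"
  using enveloping by (simp_all add: is_enveloping_cstar_algebra_def)

definition ip :: "'a \<Rightarrow> 'a \<Rightarrow> 'b" where
  "ip x y = j (p (star x * y))"

definition ip_norm :: "'a \<Rightarrow> real" where
  "ip_norm x = sqrt (norm (ip x x))"

lemma clinear_jp: "clinear (\<lambda>x. j (p x))"
  by (rule clinear_comp[OF clinear_j clinear_p])

lemma ip_add_left: "ip (x + y) z = ip x z + ip y z"
  and ip_add_right: "ip z (x + y) = ip z x + ip z y"
  and ip_diff_left: "ip (x - y) z = ip x z - ip y z"
  and ip_diff_right: "ip z (x - y) = ip z x - ip z y"
  by (simp_all add: ip_def star_add star_diff distrib_left distrib_right left_diff_distrib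
      right_diff_distrib clinear_add[OF clinear_jp] clinear_diff[OF clinear_jp])

lemma ip_scaleC_right: "ip x (c *\<^sub>C y) = c *\<^sub>C ip x y"
  and ip_scaleC_left: "ip (c *\<^sub>C x) y = cnj c *\<^sub>C ip x y"
  by (simp_all add: ip_def star_scaleC mult_scaleC_left mult_scaleC_right clinear_scaleC[OF clinear_jp])

lemma star_ip: "star (ip x y) = ip y x"
  by (simp add: ip_def star_mult star_star flip: j_star p_star)

lemma ip_mult_right: "a \<in> A \<Longrightarrow> ip x (y * a) = ip x y * j a"
  by (simp add: ip_def p_mult_right j_mult flip: mult.assoc)

lemma ip_mult_left: "a \<in> A \<Longrightarrow> ip (x * a) y = star (j a) * ip x y"
  by (simp add: ip_def star_mult p_mult_left star_in_A j_mult j_star mult.assoc)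

lemma positive_ip: "is_positive (ip x x)"
proof -
  obtain K and z :: "nat \<Rightarrow> nat \<Rightarrow> 'a" where
    "\<And>i l. i < 1 \<Longrightarrow> l < 1 \<Longrightarrow> p (star x * x) = (\<Sum>r<K::nat. star (z r i) * z r l)"
    by (rule p_gram[of 1 "\<lambda>_. x"]) blast
  from this[of 0 0] have "ip x x = (\<Sum>r<K. star (j (z r 0)) * j (z r 0))"
    by (simp add: ip_def clinear_sum[OF clinear_j] j_mult j_star)
  thus ?thesis by (simp add: is_positive_sum positive_star_mult_self)
qed

lemma ip_norm_nonneg: "ip_norm x \<ge> 0"
  by (simp add: ip_norm_def)

lemma ip_norm_square: "(ip_norm x)\<^sup>2 = norm (ip x x)"
  by (simp add: ip_norm_def)

text \<open>\<open>cstar_Cauchy_Schwarz\<close> calls for the vector \<open>y - x s\<close> with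
  \<open>s\<close> a multiple of the inner product. It exists in \<open>H\<close> itself, before any
  completion, because inner products are images of elements \<open>q\<close> of \<open>A\<close>,
  and \<open>p\<close> is \<open>A\<close>-linear.\<close>

lemma norm_ip_le: "norm (ip x y) \<le> ip_norm x * ip_norm y"
proof -
  define q where "q = p (star x * y)"
  have q: "q \<in> A" by (simp add: q_def p_in_A)
  have c: "ip x y = j q" "ip y x = star (j q)"
    using star_ip[of x y] by (simp_all add: ip_def q_def)
  have "(norm (j q))\<^sup>2 \<le> norm (ip y y) * norm (ip x x)"
  proof (rule cstar_Cauchy_Schwarz[OF positive_ip])
    fix r :: real
    define s where "s = complex_of_real r *\<^sub>C q"
    have s: "s \<in> A" using q by (simp add: s_def cvs.subspace_scale[OF csubspace_A])
    have js: "j s = r *\<^sub>R j q" by (simp add: s_def clinear_scaleC[OF clinear_j] scaleR_scaleC)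
    have "ip (y - x * s) (y - x * s) = ip y y - (2 * r) *\<^sub>R (star (j q) * j q) +
        r\<^sup>2 *\<^sub>R (star (j q) * ip x x * j q)"
      unfolding ip_diff_left ip_diff_right ip_mult_right[OF s] ip_mult_left[OF s] c js
      by (simp add: star_scaleR power2_eq_square mult.assoc scaleR_2 left_diff_distrib
          right_diff_distrib scaleR_right_diff_distrib flip: scaleR_scaleR)
    thus "is_positive (ip y y - (2 * r) *\<^sub>R (star (j q) * j q) + r\<^sup>2 *\<^sub>R (star (j q) * ip x x * j q))"
      using positive_ip[of "y - x * s"] by simp
  qed
  hence "(norm (ip x y))\<^sup>2 \<le> (ip_norm x * ip_norm y)\<^sup>2"
    by (simp add: c power_mult_distrib ip_norm_square mult.commute)
  thus ?thesis by (rule power2_le_imp_le) (simp add: ip_norm_nonneg)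
qed

lemma ip_norm_add: "ip_norm (x + y) \<le> ip_norm x + ip_norm y"
proof (rule power2_le_imp_le)
  have "(ip_norm (x + y))\<^sup>2 = norm (ip x x + ip y x + (ip x y + ip y y))"
    unfolding ip_norm_square ip_add_left ip_add_right by (simp add: add_ac)
  also have "\<dots> \<le> norm (ip x x) + norm (ip y x) + (norm (ip x y) + norm (ip y y))"
    by (intro norm_triangle_mono order_refl)
  also have "\<dots> \<le> (ip_norm x)\<^sup>2 + ip_norm y * ip_norm x + (ip_norm x * ip_norm y + (ip_norm y)\<^sup>2)"
    by (intro add_mono norm_ip_le) (simp_all add: ip_norm_square)
  also have "\<dots> = (ip_norm x + ip_norm y)\<^sup>2" by (simp add: power2_eq_square algebra_simps)
  finally show "(ip_norm (x + y))\<^sup>2 \<le> (ip_norm x + ip_norm y)\<^sup>2" .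
qed (simp add: ip_norm_nonneg)

lemma ip_norm_scaleC: "ip_norm (c *\<^sub>C x) = cmod c * ip_norm x"
  by (simp add: ip_norm_def ip_scaleC_left ip_scaleC_right norm_scaleC real_sqrt_mult
      complex_mod_mult_cnj)

text \<open>The columns of \<open>u\<close> have length 1, so \<open>ip x x\<close> is the sum over
  \<open>l\<close> of the positive elements \<open>ip (u l k * x) (u l k * x)\<close>, and each of
  them is dominated by the sum.\<close>

lemma ip_norm_entry:
  assumes u: "unitary_comod n u" and ik: "i < n" "k < n"
  shows "ip_norm (u i k * x) \<le> ip_norm x"
proof -
  have "(\<Sum>l<n. ip (u l k * x) (u l k * x)) = j (p (\<Sum>l<n. star x * (star (u l k) * u l k) * x))"
    by (simp add: ip_def clinear_sum[OF clinear_jp] star_mult mult.assoc)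
  also have "(\<Sum>l<n. star x * (star (u l k) * u l k) * x) = star x * x"
    using unitary_comodD(3)[OF u ik(2,2)] by (simp flip: sum_distrib_left sum_distrib_right)
  finally have "ip x x = (\<Sum>l<n. ip (u l k * x) (u l k * x))" by (simp add: ip_def)
  also have "\<dots> = ip (u i k * x) (u i k * x) + (\<Sum>l\<in>{..<n} - {i}. ip (u l k * x) (u l k * x))"
    by (rule sum.remove) (use ik(1) in auto)
  finally have "ip x x - ip (u i k * x) (u i k * x) = (\<Sum>l\<in>{..<n} - {i}. ip (u l k * x) (u l k * x))"
    by simp
  hence "norm (ip (u i k * x) (u i k * x)) \<le> norm (ip x x)"
    by (intro positive_norm_mono positive_ip) (simp add: is_positive_sum positive_ip)
  thus ?thesis by (simp add: ip_norm_def)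
qed

lemma ip_norm_mult_bounded: "\<exists>C\<ge>0. \<forall>x. ip_norm (r * x) \<le> C * ip_norm x"
proof -
  have "r \<in> cspan {u i j | n u i j. unitary_comod n u \<and> i < n \<and> j < n}"
    by (simp add: span_unitary_comod)
  thus ?thesis
  proof (induction rule: cvs.span_induct_alt)
    case base
    have "ip_norm (0 * x) = 0" for x by (simp add: ip_norm_def ip_def clinear_0[OF clinear_jp])
    thus ?case by (intro exI[of _ 0]) simp
  next
    case (step c v y)
    from step(2) obtain C where C: "C \<ge> 0" "\<And>x. ip_norm (y * x) \<le> C * ip_norm x" by blast
    from step(1) obtain n u i k where u: "unitary_comod n u" "i < n" "k < n" "v = u i k" by blast
    have "ip_norm ((c *\<^sub>C v + y) * x) \<le> (cmod c + C) * ip_norm x" for x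
    proof -
      have "ip_norm ((c *\<^sub>C v + y) * x) \<le> ip_norm (c *\<^sub>C (v * x)) + ip_norm (y * x)"
        unfolding distrib_right mult_scaleC_left by (rule ip_norm_add)
      also have "\<dots> \<le> cmod c * ip_norm x + C * ip_norm x"
        unfolding ip_norm_scaleC u(4)
        by (intro add_mono mult_left_mono ip_norm_entry[OF u(1-3)] C(2)) simp
      finally show ?thesis by (simp add: distrib_right)
    qed
    thus ?case using C(1) by (intro exI[of _ "cmod c + C"]) simp
  qed
qed

lemma op_rep_left_mult: "op_rep (*) ip_norm"
proof
  fix x r s :: 'a and c :: complex
  show "0 \<le> ip_norm x" by (rule ip_norm_nonneg)
  show "r * s * x = r * (s * x)" by (rule mult.assoc)
  show "ip_norm ((r + s) * x) \<le> ip_norm (r * x) + ip_norm (s * x)"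
    unfolding distrib_right by (rule ip_norm_add)
  show "ip_norm (c *\<^sub>C r * x) = cmod c * ip_norm (r * x)"
    unfolding mult_scaleC_left by (rule ip_norm_scaleC)
  have "(ip_norm (r * x))\<^sup>2 = norm (ip x (star r * r * x))"
    by (simp add: ip_norm_square ip_def star_mult mult.assoc)
  also have "\<dots> \<le> ip_norm x * ip_norm (star r * r * x)" by (rule norm_ip_le)
  finally show "(ip_norm (r * x))\<^sup>2 \<le> ip_norm x * ip_norm (star r * r * x)" .
  show "\<exists>C\<ge>0. \<forall>x. ip_norm (r * x) \<le> C * ip_norm x" by (rule ip_norm_mult_bounded)
qed

text \<open>
  The operator norm of left multiplication on \<open>H\<close>, viewed as a Hilbert module over \<open>A\<close> via \<open>p\<close>,
  is a C*-seminorm and hence at most the universal one.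
\<close>

lemma norm_jp_le: "norm (j (p h)) \<le> norm (j h)"
proof -
  interpret L: op_rep "(*)" ip_norm by (rule op_rep_left_mult)
  \<comment> \<open>\<open>p h\<close> is the inner product of 1 with \<open>h * 1\<close>, and the
    vector 1 has length 1.\<close>
  have 1: "ip_norm 1 = 1" by (simp add: ip_norm_def ip_def star_1 p_A one_in_A j_1)
  have "norm (j (p h)) = norm (ip 1 (h * 1))" by (simp add: ip_def star_1)
  also have "\<dots> \<le> ip_norm 1 * ip_norm (h * 1)" by (rule norm_ip_le)
  also have "\<dots> \<le> op_norm (*) ip_norm h" using L.op_norm_bound[of h 1] by (simp add: 1)
  also have "\<dots> \<le> norm (j h)" by (rule j_greatest[OF L.cstar_seminorm_op_norm])
  finally show ?thesis .
qed

lemma norm_jp_diff_le: "norm (j (p x) - j (p y)) \<le> norm (j x - j y)"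
  using norm_jp_le[of "x - y"] unfolding clinear_diff[OF clinear_p] clinear_diff[OF clinear_j] .

lemma approximation:
  obtains h where "(\<lambda>k. j (h k)) \<longlonglongrightarrow> b"
proof -
  have "b \<in> closure (range j)" by (simp add: j_dense)
  then obtain f where f: "\<forall>k. f k \<in> range j" "f \<longlonglongrightarrow> b" unfolding closure_sequential by blast
  from f(1) have "\<forall>k. \<exists>h. f k = j h" by blast
  then obtain h where "\<And>k. f k = j (h k)" by metis
  hence "f = (\<lambda>k. j (h k))" by (rule ext)
  thus ?thesis using f(2) that by simp
qed

text \<open>\<open>T\<close> is specified on all approximating sequences at once, so that each later
  property can be checked along a convenient one.\<close>

lemma extension_exists:
  obtains T where "\<And>h b. (\<lambda>k::nat. j (h k)) \<longlonglongrightarrow> b \<Longrightarrow> (\<lambda>k. j (p (h k))) \<longlonglongrightarrow> T b"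
proof -
  have "\<exists>h. (\<lambda>k. j (h k)) \<longlonglongrightarrow> b" for b by (rule approximation[of b]) blast
  then obtain H where H: "\<And>b. (\<lambda>k. j (H b k)) \<longlonglongrightarrow> b" by metis
  define T where "T b = lim (\<lambda>k. j (p (H b k)))" for b
  have T: "(\<lambda>k. j (p (H b k))) \<longlonglongrightarrow> T b" for b
  proof -
    have "Cauchy (\<lambda>k. j (H b k))" by (rule LIMSEQ_imp_Cauchy[OF H])
    have "Cauchy (\<lambda>k. j (p (H b k)))"
    proof (rule CauchyI)
      fix e :: real assume "e > 0"
      from CauchyD[OF \<open>Cauchy (\<lambda>k. j (H b k))\<close> this]
      obtain M where M: "\<forall>k\<ge>M. \<forall>l\<ge>M. norm (j (H b k) - j (H b l)) < e" by (elim exE)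
      show "\<exists>M. \<forall>k\<ge>M. \<forall>l\<ge>M. norm (j (p (H b k)) - j (p (H b l))) < e"
        by (intro exI[of _ M] allI impI, rule le_less_trans[OF norm_jp_diff_le]) (simp add: M)
    qed
    thus ?thesis unfolding T_def Cauchy_convergent_iff convergent_LIMSEQ_iff .
  qed
  show ?thesis
  proof (rule that)
    fix h b assume h: "(\<lambda>k::nat. j (h k)) \<longlonglongrightarrow> b"
    have "(\<lambda>k. norm (j (h k) - j (H b k))) \<longlonglongrightarrow> norm (b - b)"
      by (intro tendsto_norm tendsto_diff h H)
    hence lim: "(\<lambda>k. norm (j (h k) - j (H b k))) \<longlonglongrightarrow> 0" by simp
    have "\<forall>\<^sub>F k in sequentially. norm (j (p (h k)) - j (p (H b k))) \<le> norm (j (h k) - j (H b k))"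
      by (intro always_eventually allI norm_jp_diff_le)
    from Lim_null_comparison[OF this lim] have "(\<lambda>k. j (p (h k)) - j (p (H b k))) \<longlonglongrightarrow> 0" .
    from tendsto_add[OF this T[of b]] show "(\<lambda>k. j (p (h k))) \<longlonglongrightarrow> T b" by simp
  qed
qed

lemma closed_subalgebra_A_closure: "closed_subalgebra (closure (j ` A))"
proof (rule closed_subalgebra_closure)
  show "csubspace (j ` A)"
    unfolding cvs.subspace_def
  proof (intro conjI ballI allI)
    show "0 \<in> j ` A" using cvs.subspace_0[OF csubspace_A] clinear_0[OF clinear_j] by (metis imageI)
    fix x y c assume "x \<in> j ` A" "y \<in> j ` A"
    then obtain a b where ab: "a \<in> A" "b \<in> A" "x = j a" "y = j b" by blast
    have "x + y = j (a + b)" "c *\<^sub>C x = j (c *\<^sub>C a)"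
      by (simp_all add: ab clinear_add[OF clinear_j] clinear_scaleC[OF clinear_j])
    thus "x + y \<in> j ` A" "c *\<^sub>C x \<in> j ` A"
      using cvs.subspace_add[OF csubspace_A ab(1,2)] cvs.subspace_scale[OF csubspace_A ab(1)] by blast+
  qed
  show "1 \<in> j ` A" using one_in_A j_1 by (metis imageI)
  fix x y assume "x \<in> j ` A" "y \<in> j ` A"
  then obtain a b where ab: "a \<in> A" "b \<in> A" "x = j a" "y = j b" by blast
  have "x * y = j (a * b)" by (simp add: ab j_mult)
  thus "x * y \<in> j ` A" using mult_in_A[OF ab(1,2)] by blast
qed

text \<open>Each row \<open>c\<close> of \<open>x\<close> contributes a Gram matrix by
  \<open>p_gram\<close>.\<close>

lemma positive_jp_block:
  "is_positive (single_block n (\<lambda>a b. \<Sum>c<n. j (p (star (x c a) * x c b))))"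
proof -
  have "is_positive (single_block n (\<lambda>a b. j (p (star (y a) * y b))))" for y :: "nat \<Rightarrow> 'a"
  proof -
    obtain K and z :: "nat \<Rightarrow> nat \<Rightarrow> 'a" where
      z: "\<And>i l. i < n \<Longrightarrow> l < n \<Longrightarrow> p (star (y i) * y l) = (\<Sum>r<K::nat. star (z r i) * z r l)"
      by (rule p_gram[of n y]) blast
    have "single_block n (\<lambda>a b. j (p (star (y a) * y b))) =
        single_block n (\<lambda>a b. \<Sum>r<K. star (j (z r a)) * j (z r b))"
      by (rule block_matrix_eqI) (simp add: block_single_block z clinear_sum[OF clinear_j] j_mult j_star)
    thus ?thesis by (simp only: positive_single_block_gram)
  qed
  moreover have "single_block n (\<lambda>a b. \<Sum>c<n. j (p (star (x c a) * x c b))) =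
      (\<Sum>c<n. single_block n (\<lambda>a b. j (p (star (x c a) * x c b))))"
    by (rule block_matrix_eqI) (simp add: block_sum block_single_block)
  ultimately show ?thesis by (simp add: is_positive_sum)
qed

lemma completely_positive_extension:
  assumes T: "\<And>h b. (\<lambda>k::nat. j (h k)) \<longlonglongrightarrow> b \<Longrightarrow> (\<lambda>k. j (p (h k))) \<longlonglongrightarrow> T b"
  shows "completely_positive UNIV (closure (j ` A)) T"
proof -
  have TA: "T b \<in> closure (j ` A)" for b
  proof -
    obtain h where h: "(\<lambda>k. j (h k)) \<longlonglongrightarrow> b" by (rule approximation)
    have "\<forall>k. j (p (h k)) \<in> j ` A" using p_in_A by blast
    thus ?thesis using T[OF h] by (rule in_closure_sequentially)
  qed
  have "map_mat T M \<in> positive_mats n (closure (j ` A))" if M: "M \<in> positive_mats n UNIV" for n M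
  proof -
    obtain X where X: "X \<in> carrier_mat n n" "M = mat_star X * X"
      using M unfolding positive_mats_def by blast
    have Mij: "M $$ (a, b) = (\<Sum>c<n. star (X $$ (c, a)) * X $$ (c, b))" if "a < n" "b < n" for a b
      using X that by (auto simp: mat_star_def scalar_prod_def lessThan_atLeast0 intro!: sum.cong)
    \<comment> \<open>Approximating the entries of \<open>X\<close> rather than those of
      \<open>M\<close> keeps the form \<open>mat_star X * X\<close>, on which \<open>p\<close> is
      positive, at every stage before the limit.\<close>
    have "\<exists>h. (\<lambda>k. j (h k)) \<longlonglongrightarrow> X $$ (c, a)" for c a
      by (rule approximation[of "X $$ (c, a)"]) blast
    then obtain h where h: "\<And>c a. (\<lambda>k. j (h c a k)) \<longlonglongrightarrow> X $$ (c, a)" by metis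
    define f where "f k a b = (\<Sum>c<n. j (p (star (h c a k) * h c b k)))" for k a b
    have f: "(\<lambda>k. f k a b) \<longlonglongrightarrow> T (M $$ (a, b))" if ab: "a < n" "b < n" for a b
    proof -
      have "(\<lambda>k. \<Sum>c<n. star (j (h c a k)) * j (h c b k)) \<longlonglongrightarrow> M $$ (a, b)"
        unfolding Mij[OF ab]
        by (intro tendsto_sum tendsto_mult bounded_linear.tendsto[OF bounded_linear_star] h)
      hence "(\<lambda>k. j (\<Sum>c<n. star (h c a k) * h c b k)) \<longlonglongrightarrow> M $$ (a, b)"
        by (simp only: clinear_sum[OF clinear_j] j_mult j_star)
      from T[OF this] show ?thesis
        by (simp only: f_def clinear_sum[OF clinear_p] clinear_sum[OF clinear_j])
    qed
    define Z where "Z = single_block n (\<lambda>a b. T (M $$ (a, b)))"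
    have "(\<lambda>k. single_block n (f k)) \<longlonglongrightarrow> Z"
      unfolding Z_def by (rule tendsto_single_block) (rule f)
    moreover have "is_positive (single_block n (f k))" for k
      unfolding f_def[abs_def] by (rule positive_jp_block)
    ultimately have Z: "is_positive Z" by (rule positive_closed)
    \<comment> \<open>\<open>Z\<close> is so far positive over the whole completion; its root has
      entries in the closure of the image of \<open>A\<close>.\<close>
    obtain y where y: "\<And>a b. a < n \<Longrightarrow> b < n \<Longrightarrow> y a b \<in> closure (j ` A)"
      "\<And>a b. block Z n a b = (\<Sum>k<n. star (y k a) * y k b)"
      by (rule positive_block_factor[OF Z closed_subalgebra_A_closure, of n])
        (use TA in \<open>auto simp: Z_def block_single_block\<close>)
    define Y where "Y = mat n n (\<lambda>(a, b). y a b)"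
    have "map_mat T M = mat_star Y * Y"
    proof (rule eq_matI)
      show "dim_row (map_mat T M) = dim_row (mat_star Y * Y)" "dim_col (map_mat T M) = dim_col (mat_star Y * Y)"
        using X by (simp_all add: Y_def mat_star_def)
      fix a b assume "a < dim_row (mat_star Y * Y)" "b < dim_col (mat_star Y * Y)"
      hence ab: "a < n" "b < n" by (simp_all add: Y_def mat_star_def)
      have "(mat_star Y * Y) $$ (a, b) = (\<Sum>k<n. star (y k a) * y k b)"
        using ab by (auto simp: Y_def mat_star_def scalar_prod_def lessThan_atLeast0 intro!: sum.cong)
      also have "\<dots> = T (M $$ (a, b))" using ab y(2)[of a b] by (simp add: Z_def block_single_block)
      finally show "map_mat T M $$ (a, b) = (mat_star Y * Y) $$ (a, b)"
        using ab X by (simp add: mat_star_def)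
    qed
    moreover have "Y \<in> carrier_mat n n" by (simp add: Y_def)
    moreover have "elements_mat Y \<subseteq> closure (j ` A)"
      unfolding elements_mat_def Y_def using y(1) by auto
    ultimately show ?thesis unfolding positive_mats_def by blast
  qed
  thus ?thesis unfolding completely_positive_def using TA by blast
qed

lemma extension_clinear:
  assumes T: "\<And>h b. (\<lambda>k::nat. j (h k)) \<longlonglongrightarrow> b \<Longrightarrow> (\<lambda>k. j (p (h k))) \<longlonglongrightarrow> T b"
  shows "clinear T"
  unfolding clinear_iff
proof (intro conjI allI)
  fix x y c
  obtain h where h: "(\<lambda>k. j (h k)) \<longlonglongrightarrow> x" by (rule approximation)
  obtain g where g: "(\<lambda>k. j (g k)) \<longlonglongrightarrow> y" by (rule approximation)
  have "(\<lambda>k. j (h k + g k)) \<longlonglongrightarrow> x + y"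
    unfolding clinear_add[OF clinear_j] by (rule tendsto_add[OF h g])
  from T[OF this] have "(\<lambda>k. j (p (h k)) + j (p (g k))) \<longlonglongrightarrow> T (x + y)"
    by (simp only: clinear_add[OF clinear_p] clinear_add[OF clinear_j])
  from LIMSEQ_unique[OF this tendsto_add[OF T[OF h] T[OF g]]] show "T (x + y) = T x + T y" .
  have "(\<lambda>k. j (c *\<^sub>C h k)) \<longlonglongrightarrow> c *\<^sub>C x"
    unfolding clinear_scaleC[OF clinear_j] by (rule tendsto_scaleC[OF h])
  from T[OF this] have "(\<lambda>k. c *\<^sub>C j (p (h k))) \<longlonglongrightarrow> T (c *\<^sub>C x)"
    by (simp only: clinear_scaleC[OF clinear_p] clinear_scaleC[OF clinear_j])
  from LIMSEQ_unique[OF this tendsto_scaleC[OF T[OF h]]] show "T (c *\<^sub>C x) = c *\<^sub>C T x" .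
qed

end

theorem theorem3p1:
  fixes \<Delta> :: "'a::complex_star_algebra \<Rightarrow> ('a, 'a) tensor"
    and \<epsilon> :: "'a \<Rightarrow> complex"
    and S :: "'a \<Rightarrow> 'a"
    and A :: "'a set"
    and p :: "'a \<Rightarrow> 'a"
    and j :: "'a \<Rightarrow> 'b::cstar_algebra"
  assumes "cqg_algebra \<Delta> \<epsilon> S"
    and "cqg_subalgebra \<Delta> S A"
    and "is_expectation \<Delta> A p"
    and "is_enveloping_cstar_algebra j"
  shows "\<exists>T. clinear T \<and> completely_positive UNIV (closure (j ` A)) T \<and> (\<forall>h. T (j h) = j (p h))"
proof -
  interpret cqg_envelope \<Delta> \<epsilon> S A p j
    by (intro cqg_envelope.intro cqg_expectation.intro cqg_expectation_axioms.intro
        cqg_envelope_axioms.intro assms)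
  obtain T where T: "\<And>h b. (\<lambda>k::nat. j (h k)) \<longlonglongrightarrow> b \<Longrightarrow> (\<lambda>k. j (p (h k))) \<longlonglongrightarrow> T b"
    by (rule extension_exists) blast
  have "clinear T" by (rule extension_clinear) (rule T)
  moreover have "completely_positive UNIV (closure (j ` A)) T"
    by (rule completely_positive_extension) (rule T)
  \<comment> \<open>The constant sequence shows that \<open>T\<close> extends
    \<open>p\<close>.\<close>
  moreover have "T (j h) = j (p h)" for h
    using T[of "\<lambda>_. h" "j h"] by (simp add: LIMSEQ_const_iff)
  ultimately show ?thesis by (intro exI[of _ T] conjI allI)
qed

end
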